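(* Let $\mathbb{K}$ be a field and let $p,q,\lambda,\mu\in\mathbb{K}^{\ast}$. Suppose that neither $p$ nor $q$ is a root of unity, and let $A=\mathcal{A}_p(\lambda,\mu,\mathbb{K}_q[s,t])$. Any $\mathbb{K}$-algebra automorphism $\varphi$ of $A[w]$ is given by $$\varphi(x)=\alpha x,\quad \varphi(y)=\alpha^{-1}y,\quad \varphi(s)=\beta s,\quad \varphi(t)=\gamma t$$ for some $\alpha,\beta,\gamma\in\mathbb{K}^{\ast}$, and $$\varphi(w)=aw+b$$ for some $a\in\mathbb{K}^{\ast}$ and $b\in\mathbb{K}$. As a result, any $\mathbb{K}$-algebra automorphism of $A[w]$ is triangular. If $\mathbb{Z}\subset\mathbb{K}$ (i.e. $\mathbb{K}$ has characteristic zero), then any locally nilpotent $\mathbb{K}$-derivation of $A$ is zero.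
   Context: For a field $\mathbb{K}$ and $p,q,\lambda,\mu\in\mathbb{K}^{\ast}$, $\mathcal{A}_p(\lambda,\mu,\mathbb{K}_q[s,t])$ denotes the associative unital $\mathbb{K}$-algebra generated by $x,y,s,t$ subject to the relations $$xy-pyx=1,\quad st=qts,\quad sx=\lambda xs,\quad sy=\lambda^{-1}ys,\quad tx=\mu xt,\quad ty=\mu^{-1}yt.$$ The number $1$ counts as a root of unity. For a $\mathbb{K}$-algebra $A$, $A[w]=A\otimes_{\mathbb{K}}\mathbb{K}[w]$ is the polynomial extension (with $w$ central). A $\mathbb{K}$-algebra automorphism $h$ of $A[w]$ is triangular if there are $g\in\mathrm{Aut}_{\mathbb{K}}(A)$, $c\in\mathbb{K}^{\ast}$ and $r$ in the center of $A$ such that $h(w)=cw+r$ and $h(u)=g(u)\in A$ for all $u\in A$. *)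

theory Defs
  imports
    "HOL-Algebra.Algebra"
    "HOL-Algebra.Algebraic_Closure_Type"
    "HOL-Library.Poly_Mapping"
begin

section \<open>Free algebras\<close>

text \<open>
  The free monoid on \<open>'g\<close>, written additively so that \<open>'g word \<Rightarrow>\<^sub>0 'k\<close> with the convolution
  product of \<^theory>\<open>HOL-Library.Poly_Mapping\<close> is its monoid algebra, i.e. the free associative
  unital \<open>'k\<close>-algebra on \<open>'g\<close>.
\<close>

datatype 'g word = Word (letters: "'g list")

instantiation word :: (type) monoid_add
begin

definition zero_word :: "'a word" where
  "zero_word = Word []"

definition plus_word :: "'a word \<Rightarrow> 'a word \<Rightarrow> 'a word" where
  "plus_word u v = Word (letters u @ letters v)"

instance
  by standard (simp_all add: zero_word_def plus_word_def)

end

type_synonym ('g, 'k) free_alg = "'g word \<Rightarrow>\<^sub>0 'k"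

definition free_scalar :: "'k \<Rightarrow> ('g, 'k::field) free_alg" where
  "free_scalar c = Poly_Mapping.single 0 c"

definition free_gen :: "'g \<Rightarrow> ('g, 'k::field) free_alg" where
  "free_gen g = Poly_Mapping.single (Word [g]) 1"


section \<open>Algebras over a field\<close>

text \<open>
  A \<open>'k\<close>-algebra is represented by a record of type \<open>('k, 'a) module\<close>: its ring structure
  together with the scalar action \<open>\<odot>\<close> of \<open>'k\<close>.
\<close>

text \<open>
  The algebra presented by generators \<open>'g\<close> and relations \<open>r = 0\<close> for \<open>r \<in> rels\<close>. The ideals of
  \<^theory>\<open>HOL-Algebra.Ideal\<close>, hence also \<open>Idl\<close>, are two-sided.
\<close>

definition rel_ideal :: "('g, 'k::field) free_alg set \<Rightarrow> ('g, 'k) free_alg set" where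
  "rel_ideal rels = Idl\<^bsub>ring_of_type_algebra\<^esub> rels"

definition pres_class ::
    "('g, 'k::field) free_alg set \<Rightarrow> ('g, 'k) free_alg \<Rightarrow> ('g, 'k) free_alg set" where
  "pres_class rels f = rel_ideal rels +>\<^bsub>ring_of_type_algebra\<^esub> f"

definition pres_alg ::
    "('g, 'k::field) free_alg set \<Rightarrow> ('k, ('g, 'k) free_alg set) module" where
  "pres_alg rels =
    (let Q = ring_of_type_algebra Quot rel_ideal rels in
      \<lparr>carrier = carrier Q, monoid.mult = monoid.mult Q, one = one Q,
       ring.zero = ring.zero Q, add = add Q,
       module.smult = (\<lambda>c u. pres_class rels (free_scalar c) \<otimes>\<^bsub>Q\<^esub> u)\<rparr>)"

definition alg_aut :: "('k, 'a) module \<Rightarrow> ('a \<Rightarrow> 'a) set" where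
  "alg_aut A = {h \<in> ring_iso A A. \<forall>c. \<forall>u \<in> carrier A. h (c \<odot>\<^bsub>A\<^esub> u) = c \<odot>\<^bsub>A\<^esub> h u}"

definition alg_center :: "('k, 'a) module \<Rightarrow> 'a set" where
  "alg_center A = {z \<in> carrier A. \<forall>u \<in> carrier A. z \<otimes>\<^bsub>A\<^esub> u = u \<otimes>\<^bsub>A\<^esub> z}"

definition alg_derivation :: "('k, 'a) module \<Rightarrow> ('a \<Rightarrow> 'a) \<Rightarrow> bool" where
  "alg_derivation A d \<longleftrightarrow>
     d \<in> carrier A \<rightarrow> carrier A \<and>
     (\<forall>u \<in> carrier A. \<forall>v \<in> carrier A. d (u \<oplus>\<^bsub>A\<^esub> v) = d u \<oplus>\<^bsub>A\<^esub> d v) \<and>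
     (\<forall>c. \<forall>u \<in> carrier A. d (c \<odot>\<^bsub>A\<^esub> u) = c \<odot>\<^bsub>A\<^esub> d u) \<and>
     (\<forall>u \<in> carrier A. \<forall>v \<in> carrier A.
        d (u \<otimes>\<^bsub>A\<^esub> v) = (d u \<otimes>\<^bsub>A\<^esub> v) \<oplus>\<^bsub>A\<^esub> (u \<otimes>\<^bsub>A\<^esub> d v))"

definition locally_nilpotent :: "('k, 'a) module \<Rightarrow> ('a \<Rightarrow> 'a) \<Rightarrow> bool" where
  "locally_nilpotent A d \<longleftrightarrow> (\<forall>u \<in> carrier A. \<exists>n. (d ^^ n) u = \<zero>\<^bsub>A\<^esub>)"


section \<open>The polynomial extension \<open>A[w]\<close>\<close>

text \<open>
  \<^const>\<open>UP\<close> makes sense over a noncommutative ring; the variable is then central. Only its scalar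
  action, which is that of \<open>A\<close>, has to be replaced by the one of \<open>'k\<close>.
\<close>

definition poly_alg :: "('k, 'a) module \<Rightarrow> ('k, nat \<Rightarrow> 'a) module" where
  "poly_alg A =
     \<lparr>carrier = carrier (UP A), monoid.mult = monoid.mult (UP A), one = one (UP A),
      ring.zero = ring.zero (UP A), add = add (UP A),
      module.smult = (\<lambda>c f. (c \<odot>\<^bsub>A\<^esub> \<one>\<^bsub>A\<^esub>) \<odot>\<^bsub>UP A\<^esub> f)\<rparr>"

definition poly_const :: "('k, 'a) module \<Rightarrow> 'a \<Rightarrow> (nat \<Rightarrow> 'a)" where
  "poly_const A u = up_ring.monom (UP A) u 0"

definition poly_var :: "('k, 'a) module \<Rightarrow> (nat \<Rightarrow> 'a)" where
  "poly_var A = up_ring.monom (UP A) \<one>\<^bsub>A\<^esub> 1"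

definition triangular :: "('k::field, 'a) module \<Rightarrow> ((nat \<Rightarrow> 'a) \<Rightarrow> (nat \<Rightarrow> 'a)) \<Rightarrow> bool" where
  "triangular A h \<longleftrightarrow>
     (\<exists>g \<in> alg_aut A. \<exists>c r. c \<noteq> 0 \<and> r \<in> alg_center A \<and>
        h (poly_var A) = (c \<odot>\<^bsub>poly_alg A\<^esub> poly_var A) \<oplus>\<^bsub>poly_alg A\<^esub> poly_const A r \<and>
        (\<forall>u \<in> carrier A. h (poly_const A u) = poly_const A (g u)))"


section \<open>The algebra \<open>A\<^sub>p(\<lambda>, \<mu>, K\<^sub>q[s, t])\<close>\<close>

datatype gen = Gx | Gy | Gs | Gt

definition qweyl_rels :: "'k::field \<Rightarrow> 'k \<Rightarrow> 'k \<Rightarrow> 'k \<Rightarrow> (gen, 'k) free_alg set" where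
  "qweyl_rels p l m q =
    (let x = free_gen Gx; y = free_gen Gy; s = free_gen Gs; t = free_gen Gt in
     {x * y - free_scalar p * y * x - 1,
      s * t - free_scalar q * t * s,
      s * x - free_scalar l * x * s,
      s * y - free_scalar (inverse l) * y * s,
      t * x - free_scalar m * x * t,
      t * y - free_scalar (inverse m) * y * t})"

definition qweyl ::
    "'k::field \<Rightarrow> 'k \<Rightarrow> 'k \<Rightarrow> 'k \<Rightarrow> ('k, (gen, 'k) free_alg set) module" where
  "qweyl p l m q = pres_alg (qweyl_rels p l m q)"

definition qweyl_gen ::
    "'k::field \<Rightarrow> 'k \<Rightarrow> 'k \<Rightarrow> 'k \<Rightarrow> gen \<Rightarrow> (gen, 'k) free_alg set" where
  "qweyl_gen p l m q g = pres_class (qweyl_rels p l m q) (free_gen g)"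

text \<open>As \<open>n = 1\<close> is allowed, \<open>1\<close> is a root of unity.\<close>

definition root_of_unity :: "'k::field \<Rightarrow> bool" where
  "root_of_unity z \<longleftrightarrow> (\<exists>n::nat. n > 0 \<and> z ^ n = 1)"

end

theory Submission
  imports Defs "HOL-Library.Product_Plus" "HOL-Library.Product_Lexorder"
begin

text \<open>
  Throughout, \<open>z = x y - y x\<close>. It satisfies \<open>x z = p z x\<close> and \<open>z y = p y z\<close>, commutes with \<open>s\<close> and \<open>t\<close>, and
  \<open>(p - 1) y x = z - 1\<close>. Inverting \<open>x\<close> therefore turns \<open>A[w]\<close> into a subalgebra \<open>B\<close> of a quantum torus, whose
  basis consists of the monomials \<open>z^b x^k s^c t^d w^e\<close>; there \<open>y = (z - 1) x^{-1} / (p - 1)\<close>. Two monomials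
  commute up to a product of powers of \<open>p\<close>, \<open>q\<close>, \<open>l\<close>, \<open>m\<close>, and the exponents form an ordered group, so
  that leading and trailing exponents are additive. The torus is a domain, and in it the equation
  \<open>n u = v n\<close> with a monomial \<open>u\<close> forces \<open>v\<close> to be a multiple of \<open>u\<close> (\<open>normalizes_monomial\<close>). What
  distinguishes \<open>B\<close> inside the torus is that the coefficient of a negative power of \<open>x\<close> vanishes at \<open>z = 1\<close>
  (\<open>B_eval_z1\<close>).
  
  The center of \<open>B\<close> is \<open>K[w]\<close>: commuting with \<open>z\<close>, \<open>s\<close>, \<open>t\<close>, \<open>x\<close> leaves only powers of \<open>w\<close> because \<open>p\<close> and
  \<open>q\<close> are not roots of unity (\<open>central_poly_in_w\<close>). An automorphism \<open>\<phi>\<close> thus restricts to \<open>K[w]\<close>, and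
  comparing degrees with the inverse gives \<open>\<phi>(w) = a w + b\<close>. The normal elements of \<open>B\<close>, that is, those with
  \<open>n B \<subseteq> B n\<close>, are the elements \<open>r(w) z^b s^c t^d\<close> (\<open>normal_elt_structure\<close>). Automorphisms preserve
  normality, so the exponents of \<open>\<phi>(z)\<close>, \<open>\<phi>(s)\<close>, \<open>\<phi>(t)\<close> form a matrix of natural numbers, and so do those for
  the inverse. Two such matrices can only be mutually inverse if they are permutation matrices, and the
  relations between \<open>z\<close>, \<open>s\<close> and \<open>t\<close> rule out all permutations but the identity: \<open>z\<close>, \<open>s\<close>, \<open>t\<close> are
  multiplied by scalars (\<open>aut_ZST\<close>). Then \<open>\<phi>(x)\<close> and \<open>\<phi>(y)\<close> have the \<open>x\<close>-degrees of \<open>x\<close> and \<open>y\<close>, and the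
  product \<open>\<phi>(y) \<phi>(x)\<close> is too small to allow anything but multiples of \<open>x\<close> and \<open>y\<close> (\<open>aut_XY\<close>).
  
  To transfer this to the presented algebra one needs that \<open>A\<close> really embeds into the torus. The monomials
  \<open>y^i x^j s^a t^b\<close> span \<open>A\<close> by the relations, and their images have different leading exponents
  (\<open>torus_hom_kernel\<close>).
  
  Finally, a locally nilpotent derivation \<open>\<delta>\<close> of \<open>A\<close> in characteristic zero yields the automorphism \<open>exp(w \<delta>)\<close> of
  \<open>A[w]\<close>. It multiplies the generators of \<open>A\<close> by scalars, but the coefficient of \<open>w\<close> in the image of a
  generator \<open>u\<close> is \<open>\<delta>(u)\<close>. So \<open>\<delta>\<close> vanishes on the generators (\<open>derivation_zero\<close>).
\<close>

section \<open>Twisted group algebras of ordered groups\<close>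

abbreviation (input) "lookup \<equiv> Poly_Mapping.lookup"
abbreviation (input) "keys \<equiv> Poly_Mapping.keys"
abbreviation (input) "single \<equiv> Poly_Mapping.single"

instance prod :: (linordered_ab_group_add, linordered_ab_group_add) linordered_ab_group_add
  by standard auto

lemma poly_mapping_sum_single:
  assumes "finite U" "keys f \<subseteq> U"
  shows "(\<Sum>u\<in>U. single u (lookup f u)) = f"
proof (rule poly_mapping_eqI)
  fix v
  have "(\<Sum>u\<in>U. lookup (single u (lookup f u)) v) =
        (\<Sum>u\<in>U. if u = v then lookup f v else 0)"
    by (rule sum.cong) (auto simp: lookup_single when_def)
  also have "\<dots> = lookup f v"
    using assms by (auto simp: sum.delta in_keys_iff subset_iff)
  finally show "lookup (\<Sum>u\<in>U. single u (lookup f u)) v = lookup f v"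
    by (simp add: lookup_sum)
qed

text \<open>
  For a bicharacter \<open>\<chi>\<close> on an ordered abelian group, the finitely supported functions form an algebra
  in which the product of the basis elements at \<open>u\<close> and \<open>v\<close> is \<open>\<chi> u v\<close> times the one at \<open>u + v\<close>.
  The order makes it a domain, because leading exponents add up.
\<close>

locale twisted =
  fixes \<chi> :: "'g::linordered_ab_group_add \<Rightarrow> 'g \<Rightarrow> 'k::field"
  assumes chi_add_left: "\<chi> (u + v) w = \<chi> u w * \<chi> v w"
    and chi_add_right: "\<chi> u (v + w) = \<chi> u v * \<chi> u w"
    and chi_nz: "\<chi> u v \<noteq> 0"
begin

lemma chi_zero [simp]: "\<chi> 0 u = 1" "\<chi> u 0 = 1"
  using chi_add_left[of 0 0 u] chi_add_right[of u 0 0] chi_nz[of 0 u] chi_nz[of u 0] by auto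

definition tmul :: "('g \<Rightarrow>\<^sub>0 'k) \<Rightarrow> ('g \<Rightarrow>\<^sub>0 'k) \<Rightarrow> ('g \<Rightarrow>\<^sub>0 'k)" (infixl "\<star>" 70) where
  "f \<star> g = (\<Sum>u\<in>keys f. \<Sum>v\<in>keys g.
     single (u + v) (\<chi> u v * lookup f u * lookup g v))"

lemma tmul_superset:
  assumes "finite U" "keys f \<subseteq> U" "finite V" "keys g \<subseteq> V"
  shows "f \<star> g = (\<Sum>u\<in>U. \<Sum>v\<in>V.
     single (u + v) (\<chi> u v * lookup f u * lookup g v))"
proof -
  have "(\<Sum>u\<in>U. \<Sum>v\<in>V. single (u + v) (\<chi> u v * lookup f u * lookup g v))
     = (\<Sum>u\<in>keys f. \<Sum>v\<in>V. single (u + v) (\<chi> u v * lookup f u * lookup g v))"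
    by (rule sum.mono_neutral_right) (use assms in \<open>auto simp: in_keys_iff\<close>)
  also have "\<dots> = f \<star> g" unfolding tmul_def
    by (intro sum.cong refl sum.mono_neutral_right) (use assms in \<open>auto simp: in_keys_iff\<close>)
  finally show ?thesis by simp
qed

lemma tmul_add_left: "(f + g) \<star> h = f \<star> h + g \<star> h"
proof -
  let ?U = "keys f \<union> keys g"
  have "keys (f + g) \<subseteq> ?U" by (rule keys_add)
  then show ?thesis
    using tmul_superset[of ?U "f + g" "keys h" h] tmul_superset[of ?U f "keys h" h]
      tmul_superset[of ?U g "keys h" h]
    by (simp add: sum.distrib[symmetric] single_add[symmetric] lookup_add algebra_simps)
qed

lemma tmul_add_right: "h \<star> (f + g) = h \<star> f + h \<star> g"
proof -
  let ?U = "keys f \<union> keys g"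
  have "keys (f + g) \<subseteq> ?U" by (rule keys_add)
  then show ?thesis
    using tmul_superset[of "keys h" h ?U "f + g"] tmul_superset[of "keys h" h ?U f]
      tmul_superset[of "keys h" h ?U g]
    by (simp add: sum.distrib[symmetric] single_add[symmetric] lookup_add algebra_simps)
qed

lemma tmul_zero [simp]: "0 \<star> f = 0" "f \<star> 0 = 0"
  by (simp_all add: tmul_def)

lemma tmul_minus: "(- f) \<star> g = - (f \<star> g)" "f \<star> (- g) = - (f \<star> g)"
  using tmul_add_left[of f "- f" g] tmul_add_right[of f g "- g"]
  by (simp_all add: eq_neg_iff_add_eq_0 add.commute)

lemma tmul_diff: "(f - h) \<star> g = f \<star> g - h \<star> g" "f \<star> (g - h) = f \<star> g - f \<star> h"
  using tmul_add_left[of f "- h" g] tmul_add_right[of f g "- h"] by (simp_all add: tmul_minus)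

lemma tmul_sum_left: "(\<Sum>i\<in>I. f i) \<star> g = (\<Sum>i\<in>I. f i \<star> g)"
  by (induction I rule: infinite_finite_induct) (simp_all add: tmul_add_left)

lemma tmul_sum_right: "g \<star> (\<Sum>i\<in>I. f i) = (\<Sum>i\<in>I. g \<star> f i)"
  by (induction I rule: infinite_finite_induct) (simp_all add: tmul_add_right)

lemma tmul_single: "single u a \<star> single v b = single (u + v) (\<chi> u v * a * b)"
  using tmul_superset[of "{u}" "single u a" "{v}" "single v b"]
  by (simp add: keys_single)

lemma tmul_assoc: "(f \<star> g) \<star> h = f \<star> (g \<star> h)"
proof -
  let ?S = "\<lambda>f. (\<Sum>u\<in>keys f. single u (lookup f u))"
  have "(?S f \<star> ?S g) \<star> ?S h = ?S f \<star> (?S g \<star> ?S h)"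
    by (simp add: tmul_sum_left tmul_sum_right tmul_single chi_add_left chi_add_right mult_ac add_ac)
  then show ?thesis by (simp add: poly_mapping_sum_single)
qed

abbreviation scal :: "'k \<Rightarrow> ('g \<Rightarrow>\<^sub>0 'k)" where
  "scal c \<equiv> single 0 c"

lemma lookup_tmul_single:
  "lookup (f \<star> single v c) u = \<chi> (u - v) v * lookup f (u - v) * c"
proof -
  have "f \<star> single v c = (\<Sum>w\<in>keys f. single w (lookup f w)) \<star> single v c"
    by (simp add: poly_mapping_sum_single)
  also have "\<dots> = (\<Sum>w\<in>keys f. single (w + v) (\<chi> w v * lookup f w * c))"
    by (simp add: tmul_sum_left tmul_single)
  finally have "lookup (f \<star> single v c) u =
    (\<Sum>w\<in>keys f. if w = u - v then \<chi> (u - v) v * lookup f (u - v) * c else 0)"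
    by (auto simp: lookup_sum lookup_single when_def algebra_simps intro!: sum.cong)
  then show ?thesis by (auto simp: in_keys_iff)
qed

lemma lookup_single_tmul:
  "lookup (single v c \<star> f) u = \<chi> v (u - v) * c * lookup f (u - v)"
proof -
  have "single v c \<star> f = single v c \<star> (\<Sum>w\<in>keys f. single w (lookup f w))"
    by (simp add: poly_mapping_sum_single)
  also have "\<dots> = (\<Sum>w\<in>keys f. single (v + w) (\<chi> v w * c * lookup f w))"
    by (simp add: tmul_sum_right tmul_single)
  finally have "lookup (single v c \<star> f) u =
    (\<Sum>w\<in>keys f. if w = u - v then \<chi> v (u - v) * c * lookup f (u - v) else 0)"
    by (auto simp: lookup_sum lookup_single when_def algebra_simps intro!: sum.cong)
  then show ?thesis by (auto simp: in_keys_iff)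
qed

lemma tmul_one [simp]: "1 \<star> f = f" "f \<star> 1 = f"
  by (rule poly_mapping_eqI, simp add: lookup_single_tmul lookup_tmul_single flip: single_one)+

lemma scal_commute: "f \<star> scal c = scal c \<star> f"
  by (rule poly_mapping_eqI) (simp add: lookup_single_tmul lookup_tmul_single mult_ac)

lemma lookup_scal [simp]: "lookup (scal c \<star> f) u = c * lookup f u"
  by (simp add: lookup_single_tmul)

lemma scal_mult: "scal a \<star> scal b = scal (a * b)"
  by (simp add: tmul_single)

lemma keys_tmul: "keys (f \<star> g) \<subseteq> {u + v | u v. u \<in> keys f \<and> v \<in> keys g}"
proof
  fix w assume "w \<in> keys (f \<star> g)"
  then have "lookup (f \<star> g) w \<noteq> 0" by (simp add: in_keys_iff)
  then obtain u where u: "u \<in> keys f"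
    "(\<Sum>v\<in>keys g. lookup (single (u + v) (\<chi> u v * lookup f u * lookup g v)) w) \<noteq> 0"
    unfolding tmul_def by (simp add: lookup_sum) (erule sum.not_neutral_contains_not_neutral)
  moreover from u(2) obtain v where "v \<in> keys g"
    "lookup (single (u + v) (\<chi> u v * lookup f u * lookup g v)) w \<noteq> 0"
    by (erule sum.not_neutral_contains_not_neutral)
  ultimately show "w \<in> {u + v | u v. u \<in> keys f \<and> v \<in> keys g}"
    by (auto simp: lookup_single when_def split: if_splits)
qed

text \<open>
  No cancellation can occur at an exponent that arises from only one pair of exponents of the factors;
  the extreme exponents below are of this kind.
\<close>

lemma lookup_tmul_unique:
  assumes "\<And>u' v'. u' \<in> keys f \<Longrightarrow> v' \<in> keys g \<Longrightarrow> u' + v' = u + v \<Longrightarrow> u' = u \<and> v' = v"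
    and "u \<in> keys f" "v \<in> keys g"
  shows "lookup (f \<star> g) (u + v) = \<chi> u v * lookup f u * lookup g v"
proof -
  have "lookup (f \<star> g) (u + v) = (\<Sum>u'\<in>keys f. \<Sum>v'\<in>keys g.
     if u' = u then if v' = v then \<chi> u v * lookup f u * lookup g v else 0 else 0)"
    unfolding tmul_def lookup_sum
    by (intro sum.cong refl) (auto simp: lookup_single when_def dest: assms(1))
  also have "\<dots> = (\<Sum>u'\<in>keys f. if u' = u then \<chi> u v * lookup f u * lookup g v else 0)"
    using assms(3) by (intro sum.cong refl) (auto simp: sum.delta)
  finally show ?thesis using assms(2) by (simp add: sum.delta)
qed

abbreviation lead :: "('g \<Rightarrow>\<^sub>0 'k) \<Rightarrow> 'g" where "lead f \<equiv> Max (keys f)"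
abbreviation trail :: "('g \<Rightarrow>\<^sub>0 'k) \<Rightarrow> 'g" where "trail f \<equiv> Min (keys f)"

lemma lead_tmul:
  assumes "f \<noteq> 0" "g \<noteq> 0"
  shows "f \<star> g \<noteq> 0" "lead (f \<star> g) = lead f + lead g" "trail (f \<star> g) = trail f + trail g"
    "lookup (f \<star> g) (lead f + lead g) = \<chi> (lead f) (lead g) * lookup f (lead f) * lookup g (lead g)"
proof -
  have ne: "keys f \<noteq> {}" "keys g \<noteq> {}"
    using assms by auto
  have mem: "lead f \<in> keys f" "lead g \<in> keys g"
    "trail f \<in> keys f" "trail g \<in> keys g"
    using ne by (auto intro: Max_in Min_in)
  have bnd: "\<And>u. u \<in> keys f \<Longrightarrow> trail f \<le> u \<and> u \<le> lead f"
    "\<And>u. u \<in> keys g \<Longrightarrow> trail g \<le> u \<and> u \<le> lead g" by auto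
  have hi: "lookup (f \<star> g) (lead f + lead g) = \<chi> (lead f) (lead g) * lookup f (lead f) * lookup g (lead g)"
    using mem by (intro lookup_tmul_unique)
      (smt (verit) bnd add_le_cancel_left add_le_cancel_right add_mono antisym order.trans)+
  have lo: "lookup (f \<star> g) (trail f + trail g) = \<chi> (trail f) (trail g) * lookup f (trail f) * lookup g (trail g)"
    using mem by (intro lookup_tmul_unique)
      (smt (verit) bnd add_le_cancel_left add_le_cancel_right add_mono antisym order.trans)+
  show "lookup (f \<star> g) (lead f + lead g) = \<chi> (lead f) (lead g) * lookup f (lead f) * lookup g (lead g)"
    by (rule hi)
  have hi': "lead f + lead g \<in> keys (f \<star> g)"
    using hi mem chi_nz by (auto simp: in_keys_iff)
  have lo': "trail f + trail g \<in> keys (f \<star> g)"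
    using lo mem chi_nz by (auto simp: in_keys_iff)
  show "f \<star> g \<noteq> 0" using hi' by auto
  show "lead (f \<star> g) = lead f + lead g"
    using hi' keys_tmul[of f g] bnd by (intro Max_eqI) (auto intro!: add_mono)
  show "trail (f \<star> g) = trail f + trail g"
    using lo' keys_tmul[of f g] bnd by (intro Min_eqI) (auto intro!: add_mono)
qed

lemma tmul_eq_0_iff: "f \<star> g = 0 \<longleftrightarrow> f = 0 \<or> g = 0"
  using lead_tmul(1) by auto

lemma tmul_right_cancel: "h \<noteq> 0 \<Longrightarrow> f \<star> h = g \<star> h \<Longrightarrow> f = g"
  using tmul_eq_0_iff[of "f - g" h] by (simp add: tmul_diff)

lemma tmul_commute_factor:
  assumes "\<And>u v. u \<in> keys f \<Longrightarrow> v \<in> keys g \<Longrightarrow> \<chi> u v = c * \<chi> v u"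
  shows "f \<star> g = scal c \<star> (g \<star> f)"
proof -
  have "g \<star> f = (\<Sum>u\<in>keys f. \<Sum>v\<in>keys g. single (v + u) (\<chi> v u * lookup g v * lookup f u))"
    unfolding tmul_def by (rule sum.swap)
  then show ?thesis
    unfolding tmul_def[of f g]
    by (simp add: tmul_sum_right tmul_single) (intro sum.cong refl, simp add: assms add.commute mult_ac)
qed

text \<open>
  Both the leading and the trailing exponent of \<open>h\<close> must be \<open>v\<close>, so \<open>h\<close> is a multiple of the monomial
  at \<open>v\<close>, and comparing coefficients at \<open>u + v\<close> shows that all monomials of \<open>f\<close> commute with it up to
  the same scalar. Knowing this for enough \<open>v\<close> pins down the exponents of \<open>f\<close>.
\<close>

lemma normalizes_monomial:
  assumes "f \<noteq> 0" "f \<star> single v 1 = h \<star> f"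
  obtains c where "h = single v c" "c \<noteq> 0" "\<And>u. u \<in> keys f \<Longrightarrow> \<chi> u v = c * \<chi> v u"
proof -
  have nz: "single v (1::'k) \<noteq> 0"
    by (metis lookup_single_eq lookup_zero zero_neq_one)
  have h: "h \<noteq> 0" using assms nz tmul_eq_0_iff by (metis)
  have "lead h = v" "trail h = v"
    using lead_tmul(2,3)[OF assms(1) nz] lead_tmul(2,3)[OF h assms(1)] assms(2) by (simp_all add: keys_single)
  then have "keys h \<subseteq> {v}"
    using Max_ge[OF finite_keys[of h]] Min_le[OF finite_keys[of h]] by (metis antisym singletonI subsetI)
  then have hs: "h = single v (lookup h v)"
    using poly_mapping_sum_single[of "{v}" h] by simp
  have "lookup h v \<noteq> 0" using h hs by (metis single_zero)
  moreover have "\<chi> u v = lookup h v * \<chi> v u" if "u \<in> keys f" for u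
  proof -
    have "lookup (f \<star> single v 1) (u + v) = lookup (single v (lookup h v) \<star> f) (u + v)"
      using assms(2) hs by metis
    then show ?thesis using that by (simp add: lookup_tmul_single lookup_single_tmul in_keys_iff)
  qed
  ultimately show thesis using that hs by blast
qed

end

section \<open>The quantum torus and the subalgebra containing the generators\<close>

text \<open>
  An exponent \<open>(k, b, c, d, e)\<close> stands for the monomial \<open>z^b x^k s^c t^d w^e\<close>. The order on exponents is
  lexicographic, starting with the \<open>x\<close>-degree \<open>k\<close> and then the \<open>z\<close>-degree \<open>b\<close>.
\<close>

type_synonym expo = "int \<times> int \<times> int \<times> int \<times> int"

type_synonym 'k torus = "expo \<Rightarrow>\<^sub>0 'k"

lemma powi_eq_1_iff:
  assumes "(z::'k::field) \<noteq> 0" "\<not> root_of_unity z"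
  shows "z powi n = 1 \<longleftrightarrow> n = 0"
proof
  assume h: "z powi n = 1"
  show "n = 0"
  proof (rule ccontr)
    assume "n \<noteq> 0"
    then have "nat \<bar>n\<bar> > 0" by simp
    moreover have "z ^ nat \<bar>n\<bar> = 1"
      using h by (cases "n \<ge> 0") (auto simp: power_int_def power_inverse inverse_eq_1_iff)
    ultimately show False using assms(2) unfolding root_of_unity_def by blast
  qed
qed simp

lemma powi_inj:
  assumes "(z::'k::field) \<noteq> 0" "\<not> root_of_unity z" "z powi a = z powi b"
  shows "a = b"
proof -
  have "z powi (a - b) = 1" using assms by (simp add: power_int_diff)
  then show ?thesis using powi_eq_1_iff[OF assms(1,2)] by simp
qed

locale qweyl_torus =
  fixes p q l m :: "'k::field"
  assumes p0: "p \<noteq> 0" and q0: "q \<noteq> 0" and l0: "l \<noteq> 0" and m0: "m \<noteq> 0"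
    and p_gen: "\<not> root_of_unity p" and q_gen: "\<not> root_of_unity q"
begin

text \<open>
  The factors come from sorting \<open>z^b x^k s^c t^d \<cdot> z^b' x^k' s^c' t^d'\<close> by means of \<open>x z = p z x\<close>,
  \<open>s x = l x s\<close>, \<open>t x = m x t\<close> and \<open>s t = q t s\<close>, where \<open>z\<close> commutes with \<open>s\<close> and \<open>t\<close>.
\<close>

fun chi :: "expo \<Rightarrow> expo \<Rightarrow> 'k" where
  "chi (k, b, c, d, e) (k', b', c', d', e') =
     p powi (k * b') * l powi (c * k') * m powi (d * k') * inverse q powi (d * c')"

sublocale twisted chi
proof
  fix u v w :: expo
  obtain k b c d e where u: "u = (k, b, c, d, e)" by (cases u)
  obtain k' b' c' d' e' where v: "v = (k', b', c', d', e')" by (cases v)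
  obtain k'' b'' c'' d'' e'' where w: "w = (k'', b'', c'', d'', e'')" by (cases w)
  note nz = p0 q0 l0 m0
  show "chi (u + v) w = chi u w * chi v w"
    unfolding u v w using nz by (simp add: distrib_right power_int_add)
  show "chi u (v + w) = chi u v * chi u w"
    unfolding u v w using nz by (simp add: distrib_left power_int_add)
  show "chi u v \<noteq> 0" unfolding u v using nz by (simp add: power_int_not_zero)
qed

notation tmul (infixl "\<star>" 70)

lemma p1: "p \<noteq> 1"
  using p_gen by (auto simp: root_of_unity_def)

lemmas p_powi = powi_eq_1_iff[OF p0 p_gen] and q_powi = powi_eq_1_iff[OF q0 q_gen]

definition monom1 :: "expo \<Rightarrow> expo \<Rightarrow>\<^sub>0 'k" where "monom1 u = single u 1"

text \<open>
  With \<open>z = x y - y x\<close> the relation \<open>x y - p y x = 1\<close> becomes \<open>(p - 1) y x = z - 1\<close>. As \<open>x\<close> is invertible in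
  the torus, this forces the value of \<open>tY\<close>.
\<close>

definition "tX = monom1 (1, 0, 0, 0, 0)"
definition "tZ = monom1 (0, 1, 0, 0, 0)"
definition "tS = monom1 (0, 0, 1, 0, 0)"
definition "tT = monom1 (0, 0, 0, 1, 0)"
definition "tW = monom1 (0, 0, 0, 0, 1)"
definition "tY = scal (inverse (p - 1)) \<star> (monom1 (-1, 1, 0, 0, 0) - monom1 (-1, 0, 0, 0, 0))"

lemma monom1_mult: "monom1 u \<star> monom1 v = scal (chi u v) \<star> monom1 (u + v)"
  by (simp add: monom1_def tmul_single)

lemma single_monom1: "single u c = scal c \<star> monom1 u"
  by (simp add: monom1_def tmul_single)

lemma monom1_nz [simp]: "monom1 u \<noteq> 0"
  unfolding monom1_def by (metis lookup_single_eq lookup_zero zero_neq_one)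

lemma monom1_0: "monom1 (0, 0, 0, 0, 0) = 1" by (simp add: monom1_def flip: zero_prod_def)

lemma scal_left_commute: "f \<star> (scal c \<star> g) = scal c \<star> (f \<star> g)"
  by (metis scal_commute tmul_assoc)

lemma scal_diff: "scal a \<star> f - scal b \<star> f = scal (a - b) \<star> f"
  by (simp add: single_diff tmul_diff)

lemma scal_scal: "scal a \<star> (scal b \<star> f) = scal (a * b) \<star> f"
  by (simp add: tmul_assoc[symmetric] scal_mult)

lemma scal_eq_0_iff [simp]: "scal c = (0 :: 'k torus) \<longleftrightarrow> c = 0"
  by (metis lookup_single_eq lookup_zero single_zero)

lemma YX: "tY \<star> tX = scal (inverse (p - 1)) \<star> (tZ - 1)"
  by (simp add: tX_def tY_def tZ_def tmul_diff tmul_assoc monom1_mult monom1_0)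

lemma XY: "tX \<star> tY = scal (inverse (p - 1)) \<star> (scal p \<star> tZ - 1)"
  by (simp add: tX_def tY_def tZ_def tmul_diff monom1_mult monom1_0 scal_left_commute[of "monom1 u" for u])

lemma lookup_tY:
  "lookup tY u = inverse (p - 1) * ((1 when u = (-1, 1, 0, 0, 0)) - (1 when u = (-1, 0, 0, 0, 0)))"
  unfolding tY_def lookup_scal lookup_minus monom1_def lookup_single by (auto simp: when_def)

lemma rel_XY: "tX \<star> tY - scal p \<star> (tY \<star> tX) = 1"
proof -
  have "tX \<star> tY - scal p \<star> (tY \<star> tX) = scal (inverse (p - 1)) \<star> (scal p \<star> tZ - 1 - scal p \<star> (tZ - 1))"
    unfolding YX XY by (simp add: tmul_diff scal_scal scal_mult mult.commute)
  also have "scal p \<star> tZ - 1 - scal p \<star> (tZ - 1) = scal (p - 1)"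
    by (simp add: tmul_diff single_diff)
  finally show ?thesis using p1 by (simp add: scal_mult)
qed

lemma tY_nz: "tY \<noteq> 0"
  using rel_XY by auto

lemma Z_eq: "tZ = tX \<star> tY - tY \<star> tX"
proof -
  have "tX \<star> tY - tY \<star> tX = scal (inverse (p - 1)) \<star> (scal p \<star> tZ - tZ)"
    unfolding YX XY by (simp add: tmul_diff)
  also have "scal p \<star> tZ - tZ = scal (p - 1) \<star> tZ"
    by (simp add: tmul_diff single_diff)
  finally show ?thesis using p1 by (simp add: scal_scal)
qed

lemma rel_ST: "tS \<star> tT = scal q \<star> (tT \<star> tS)"
  using q0 by (simp add: tS_def tT_def monom1_mult scal_scal power_int_minus)

lemma rel_SX: "tS \<star> tX = scal l \<star> (tX \<star> tS)"
  by (simp add: tS_def tX_def monom1_mult scal_scal power_int_minus)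

lemma rel_TX: "tT \<star> tX = scal m \<star> (tX \<star> tT)"
  by (simp add: tT_def tX_def monom1_mult scal_scal power_int_minus)

lemma rel_SY: "tS \<star> tY = scal (inverse l) \<star> (tY \<star> tS)"
  using l0 by (simp add: tS_def tY_def tmul_diff tmul_assoc scal_left_commute[of "monom1 u" for u] monom1_mult scal_scal power_int_minus mult_ac)

lemma rel_TY: "tT \<star> tY = scal (inverse m) \<star> (tY \<star> tT)"
  using m0 by (simp add: tT_def tY_def tmul_diff tmul_assoc scal_left_commute[of "monom1 u" for u] monom1_mult scal_scal power_int_minus mult_ac)

lemma rel_XZ: "tX \<star> tZ = scal p \<star> (tZ \<star> tX)"
  by (simp add: tX_def tZ_def monom1_mult scal_scal)

lemma rel_ZY: "tZ \<star> tY = scal p \<star> (tY \<star> tZ)"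
  using p0 by (simp add: tZ_def tY_def tmul_diff tmul_assoc scal_left_commute[of "monom1 u" for u] monom1_mult scal_scal power_int_minus mult_ac) (simp add: mult.assoc[symmetric])

lemma rel_SZ: "tS \<star> tZ = tZ \<star> tS"
  by (simp add: tS_def tZ_def monom1_mult)

lemma rel_TZ: "tT \<star> tZ = tZ \<star> tT"
  by (simp add: tT_def tZ_def monom1_mult)

lemma W_central: "tW \<star> f = f \<star> tW"
proof -
  have "tW \<star> f = scal 1 \<star> (f \<star> tW)"
    by (rule tmul_commute_factor) (auto simp: tW_def monom1_def)
  then show ?thesis by simp
qed

text \<open>
  The subalgebra generated by the images of \<open>x\<close>, \<open>y\<close>, \<open>s\<close>, \<open>t\<close> and \<open>w\<close>: the copy of \<open>A[w]\<close> in the torus.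
\<close>

inductive_set B :: "'k torus set" where
  B_scal: "scal c \<in> B"
| B_X: "tX \<in> B"
| B_Y: "tY \<in> B"
| B_S: "tS \<in> B"
| B_T: "tT \<in> B"
| B_W: "tW \<in> B"
| B_add: "f \<in> B \<Longrightarrow> g \<in> B \<Longrightarrow> f + g \<in> B"
| B_mult: "f \<in> B \<Longrightarrow> g \<in> B \<Longrightarrow> f \<star> g \<in> B"

lemma B_uminus: "f \<in> B \<Longrightarrow> - f \<in> B"
proof -
  assume "f \<in> B"
  then have "scal (-1) \<star> f \<in> B" by (intro B_mult B_scal)
  moreover have "scal (-1) \<star> f = - f" by (rule poly_mapping_eqI) simp
  ultimately show ?thesis by simp
qed

lemma B_diff: "f \<in> B \<Longrightarrow> g \<in> B \<Longrightarrow> f - g \<in> B"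
  using B_add[of f "- g"] B_uminus[of g] by simp

lemma B_one: "1 \<in> B" using B_scal[of 1] by simp

lemma B_0: "0 \<in> B" using B_scal[of 0] by simp

lemma B_sum: "(\<And>i. i \<in> I \<Longrightarrow> f i \<in> B) \<Longrightarrow> sum f I \<in> B"
  by (induction I rule: infinite_finite_induct) (auto simp: B_0 intro: B_add)

lemma B_Z: "tZ \<in> B"
  unfolding Z_eq by (intro B_diff B_mult B_X B_Y)

text \<open>
  The value at \<open>z = 1\<close> of the coefficient, a polynomial in \<open>z\<close>, of \<open>x^k s^c t^d w^e\<close>.
\<close>

definition eval_z1 :: "int \<Rightarrow> int \<Rightarrow> int \<Rightarrow> int \<Rightarrow> 'k torus \<Rightarrow> 'k" where
  "eval_z1 k c d e f = (\<Sum>b. lookup f (k, b, c, d, e))"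

lemma finite_slice: "finite {b. lookup f (k, b, c, d, e) \<noteq> (0::'k)}"
proof -
  have "finite ((\<lambda>b. (k, b, c, d, e)) -` {u. lookup f u \<noteq> 0})"
    by (rule finite_vimageI) (auto simp: inj_on_def)
  then show ?thesis by (simp add: vimage_def)
qed

lemma eval_z1_add: "eval_z1 k c d e (f + g) = eval_z1 k c d e f + eval_z1 k c d e g"
  unfolding eval_z1_def lookup_add by (rule Sum_any.distrib) (rule finite_slice)+

lemma eval_z1_scaled_shift: "(\<Sum>b. a * lookup f (k, b - i, c, d, e)) = a * eval_z1 k c d e f"
proof -
  have "(\<Sum>b. lookup f (k, b - i, c, d, e)) = eval_z1 k c d e f"
    unfolding eval_z1_def
    by (rule Sum_any.reindex_cong[of "\<lambda>b. b + i"]) (auto intro!: bijI' exI[of _ "_ - i"] simp: fun_eq_iff)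
  moreover have "finite {b. lookup f (k, b - i, c, d, e) \<noteq> 0}"
  proof -
    have "{b. lookup f (k, b - i, c, d, e) \<noteq> 0} = (\<lambda>b. b + i) ` {b. lookup f (k, b, c, d, e) \<noteq> 0}"
      by (auto intro!: image_eqI[of _ _ "_ - i"])
    then show ?thesis by (simp add: finite_slice)
  qed
  ultimately show ?thesis by (simp add: Sum_any_right_distrib[symmetric])
qed

text \<open>
  A condition satisfied by all of \<open>B\<close> that keeps it apart from the torus, where every monomial is a unit:
  the factor \<open>y\<close> that takes the \<open>x\<close>-degree below zero brings in a factor vanishing at \<open>z = 1\<close>.
\<close>

definition regular :: "'k torus \<Rightarrow> bool" where
  "regular f \<longleftrightarrow> (\<forall>(k, b, c, d, e)\<in>keys f. 0 \<le> b \<and> 0 \<le> c \<and> 0 \<le> d \<and> 0 \<le> e) \<and>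
     (\<forall>k c d e. k < 0 \<longrightarrow> eval_z1 k c d e f = 0)"

lemma regular_add: "regular f \<Longrightarrow> regular g \<Longrightarrow> regular (f + g)"
  unfolding regular_def using keys_add[of f g] by (fastforce simp: eval_z1_add)

lemma regular_single_mult:
  assumes "regular f" and v: "v = (k', b', c', d', e')" and "0 \<le> k'" "0 \<le> b'" "0 \<le> c'" "0 \<le> d'" "0 \<le> e'"
  shows "regular (f \<star> single v a)"
  unfolding regular_def
proof (intro conjI allI impI ballI)
  fix u assume "u \<in> keys (f \<star> single v a)"
  then have "u - v \<in> keys f" by (auto simp: in_keys_iff lookup_tmul_single)
  then show "case u of (k, b, c, d, e) \<Rightarrow> 0 \<le> b \<and> 0 \<le> c \<and> 0 \<le> d \<and> 0 \<le> e"
    using assms unfolding regular_def by (cases u) fastforce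
next
  fix k c d e :: int assume k: "k < 0"
  have "eval_z1 k c d e (f \<star> single v a) =
     (\<Sum>b. (chi (k - k', 0, c - c', d - d', e - e') v * a) * lookup f (k - k', b - b', c - c', d - d', e - e'))"
    unfolding eval_z1_def lookup_tmul_single v by (simp add: mult_ac)
  also have "\<dots> = chi (k - k', 0, c - c', d - d', e - e') v * a * eval_z1 (k - k') (c - c') (d - d') (e - e') f"
    by (rule eval_z1_scaled_shift)
  also have "\<dots> = 0" using assms k unfolding regular_def by auto
  finally show "eval_z1 k c d e (f \<star> single v a) = 0" .
qed

text \<open>
  Sorting gives \<open>x^k y = (p^k z - 1) x^(k - 1) / (p - 1)\<close>. For \<open>k = 0\<close> the new factor vanishes at \<open>z = 1\<close>,
  and for \<open>k < 0\<close> the old coefficient already does.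
\<close>

lemma regular_Y_mult:
  assumes "regular f"
  shows "regular (f \<star> tY)"
proof -
  have look: "lookup (f \<star> tY) (k, b, c, d, e) =
     inverse (p - 1) * l powi (-c) * m powi (-d) *
       (p powi (k + 1) * lookup f (k + 1, b - 1, c, d, e) - lookup f (k + 1, b, c, d, e))" for k b c d e
    unfolding tY_def scal_left_commute lookup_scal tmul_diff lookup_minus monom1_def lookup_tmul_single
    by (simp add: algebra_simps)
  show ?thesis
    unfolding regular_def
  proof (intro conjI allI impI ballI)
    fix u assume u: "u \<in> keys (f \<star> tY)"
    obtain k b c d e where [simp]: "u = (k, b, c, d, e)" by (cases u)
    have "lookup f (k + 1, b - 1, c, d, e) \<noteq> 0 \<or> lookup f (k + 1, b, c, d, e) \<noteq> 0"
      using u by (auto simp: in_keys_iff look)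
    then have "(k + 1, b - 1, c, d, e) \<in> keys f \<or> (k + 1, b, c, d, e) \<in> keys f"
      by (simp add: in_keys_iff)
    then show "case u of (k, b, c, d, e) \<Rightarrow> 0 \<le> b \<and> 0 \<le> c \<and> 0 \<le> d \<and> 0 \<le> e"
      using assms unfolding regular_def by fastforce
  next
    fix k c d e :: int assume k: "k < 0"
    let ?a = "inverse (p - 1) * l powi (-c) * m powi (-d)"
    have fin: "finite {b. a * lookup f (k + 1, b - i, c, d, e) \<noteq> 0}" for a i
    proof -
      have "{b. a * lookup f (k + 1, b - i, c, d, e) \<noteq> 0} \<subseteq> (\<lambda>b. b + i) ` {b. lookup f (k + 1, b, c, d, e) \<noteq> 0}"
        by (auto intro!: image_eqI[of _ _ "_ - i"])
      then show ?thesis by (rule finite_subset) (simp add: finite_slice)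
    qed
    have "eval_z1 k c d e (f \<star> tY) =
      (\<Sum>b. (?a * p powi (k + 1)) * lookup f (k + 1, b - 1, c, d, e) + (- ?a) * lookup f (k + 1, b - 0, c, d, e))"
      unfolding eval_z1_def look by (simp add: algebra_simps)
    also have "\<dots> = (\<Sum>b. (?a * p powi (k + 1)) * lookup f (k + 1, b - 1, c, d, e)) + (\<Sum>b. (- ?a) * lookup f (k + 1, b - 0, c, d, e))"
      by (rule Sum_any.distrib) (rule fin)+
    also have "\<dots> = ?a * (p powi (k + 1) - 1) * eval_z1 (k + 1) c d e f"
      unfolding eval_z1_scaled_shift by (simp add: algebra_simps)
    also have "\<dots> = 0"
    proof (cases "k = -1")
      case False
      then have "k + 1 < 0" using k by simp
      then show ?thesis using assms unfolding regular_def by simp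
    qed simp
    finally show "eval_z1 k c d e (f \<star> tY) = 0" .
  qed
qed

text \<open>
  The regular elements need not be closed under multiplication, but multiplying one of them on the
  right by a generator keeps it regular. Hence they form a right \<open>B\<close>-module, and it contains \<open>1\<close>.
\<close>

lemma B_regular: "f \<in> B \<Longrightarrow> regular f"
proof -
  have "regular g \<Longrightarrow> regular (g \<star> f)" if "f \<in> B" for f g
    using that
  proof (induction f arbitrary: g rule: B.induct)
    case (B_add f g)
    then show ?case by (simp add: tmul_add_right regular_add)
  next
    case (B_mult f g)
    then show ?case by (simp add: tmul_assoc[symmetric])
  next
    case (B_scal c)
    then show ?case by (rule regular_single_mult[where v = 0]) (auto simp: zero_prod_def)
  next
    case B_Y
    then show ?case by (rule regular_Y_mult)
  qed (unfold tX_def tS_def tT_def tW_def monom1_def, (erule regular_single_mult, (rule refl | simp)+)+)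
  moreover have "regular 1"
    unfolding regular_def eval_z1_def by (auto simp: lookup_one zero_prod_def when_def)
  ultimately show "f \<in> B \<Longrightarrow> regular f" by (metis tmul_one(1))
qed

lemma B_keysD:
  assumes "f \<in> B" "(k, b, c, d, e) \<in> keys f"
  shows "0 \<le> b" "0 \<le> c" "0 \<le> d" "0 \<le> e"
  using B_regular[OF assms(1)] assms(2) unfolding regular_def by auto

lemma B_eval_z1: "f \<in> B \<Longrightarrow> k < 0 \<Longrightarrow> eval_z1 k c d e f = 0"
  using B_regular unfolding regular_def by auto

end

section \<open>Center and normal elements\<close>

context qweyl_torus
begin

lemma expo_zero: "(0::expo) = (0, 0, 0, 0, 0)"
  by (simp add: zero_prod_def)

definition poly_in_w :: "'k torus \<Rightarrow> bool" where
  "poly_in_w f \<longleftrightarrow> (\<forall>u\<in>keys f. \<exists>e\<ge>0. u = (0, 0, 0, 0, e))"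

text \<open>
  The elements \<open>r(w) z^b s^c t^d\<close> with \<open>r \<noteq> 0\<close>. The normal elements of \<open>B\<close> have this form, and the
  exponents turn products into sums.
\<close>

definition has_expo :: "int \<Rightarrow> int \<Rightarrow> int \<Rightarrow> 'k torus \<Rightarrow> bool" where
  "has_expo b c d f \<longleftrightarrow> f \<noteq> 0 \<and> (\<forall>u\<in>keys f. \<exists>e\<ge>0. u = (0, b, c, d, e))"

lemma has_expo_poly_in_w: "has_expo 0 0 0 f \<longleftrightarrow> f \<noteq> 0 \<and> poly_in_w f"
  by (simp add: has_expo_def poly_in_w_def)

lemma has_expo_mult:
  assumes "has_expo b c d f" "has_expo b' c' d' g"
  shows "has_expo (b + b') (c + c') (d + d') (f \<star> g)"
proof -
  have "\<exists>e\<ge>0. w = (0, b + b', c + c', d + d', e)" if "w \<in> keys (f \<star> g)" for w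
  proof -
    from that obtain u v where w: "w = u + v" and uv: "u \<in> keys f" "v \<in> keys g"
      using keys_tmul[of f g] by auto
    then obtain e e' where "e \<ge> 0" "e' \<ge> 0" "u = (0, b, c, d, e)" "v = (0, b', c', d', e')"
      using assms unfolding has_expo_def by blast
    then show ?thesis using w by (auto intro!: exI[of _ "e + e'"])
  qed
  then show ?thesis
    using assms lead_tmul(1) unfolding has_expo_def by auto
qed

lemma has_expo_unique: "has_expo b c d f \<Longrightarrow> has_expo b' c' d' f \<Longrightarrow> b = b' \<and> c = c' \<and> d = d'"
proof -
  assume h: "has_expo b c d f" "has_expo b' c' d' f"
  then have "keys f \<noteq> {}" unfolding has_expo_def by simp
  then obtain u where u: "u \<in> keys f" by blast
  obtain e where "u = (0, b, c, d, e)" using h(1) u unfolding has_expo_def by blast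
  moreover obtain e' where "u = (0, b', c', d', e')" using h(2) u unfolding has_expo_def by blast
  ultimately show ?thesis by simp
qed

lemma has_expo_monom1: "has_expo b c d (monom1 (0, b, c, d, 0))"
proof -
  have "monom1 (0, b, c, d, 0) \<noteq> 0" by simp
  then show ?thesis by (auto simp: has_expo_def monom1_def)
qed

lemma has_expo_scal: "a \<noteq> 0 \<Longrightarrow> has_expo b c d f \<Longrightarrow> has_expo b c d (scal a \<star> f)"
proof -
  assume "a \<noteq> 0" and f: "has_expo b c d f"
  then have "has_expo 0 0 0 (scal a)"
    unfolding has_expo_def using expo_zero by auto
  from has_expo_mult[OF this f] show ?thesis by simp
qed

lemma has_expo_commute:
  assumes "has_expo b c d f" "has_expo b' c' d' g"
  shows "f \<star> g = scal (q powi (c * d' - d * c')) \<star> (g \<star> f)"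
proof (rule tmul_commute_factor)
  fix u v assume "u \<in> keys f" "v \<in> keys g"
  then obtain e e' where uv: "u = (0, b, c, d, e)" "v = (0, b', c', d', e')"
    using assms unfolding has_expo_def by blast
  show "chi u v = q powi (c * d' - d * c') * chi v u"
    unfolding uv using q0 by (simp add: power_int_diff power_int_inverse field_simps)
qed

lemma has_expo_decomp:
  assumes "has_expo b c d f"
  obtains r where "poly_in_w r" "r \<noteq> 0" "f = r \<star> monom1 (0, b, c, d, 0)"
proof -
  let ?r = "f \<star> monom1 (0, -b, -c, -d, 0)"
  have r: "has_expo 0 0 0 ?r"
    using has_expo_mult[OF assms has_expo_monom1[of "-b" "-c" "-d"]] by simp
  have f: "scal (chi (0, b, c, d, 0) (0, b, c, d, 0)) \<star> ?r \<star> monom1 (0, b, c, d, 0) = f"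
    by (simp add: tmul_assoc monom1_mult scal_left_commute[of f] scal_commute[of f] scal_scal monom1_0 power_int_minus power_int_inverse q0)
  have r': "has_expo 0 0 0 (scal (chi (0, b, c, d, 0) (0, b, c, d, 0)) \<star> ?r)"
    by (rule has_expo_scal[OF chi_nz r])
  show thesis
  proof (rule that)
    show "f = (scal (chi (0, b, c, d, 0) (0, b, c, d, 0)) \<star> ?r) \<star> monom1 (0, b, c, d, 0)"
      using f by simp
    show "poly_in_w (scal (chi (0, b, c, d, 0) (0, b, c, d, 0)) \<star> ?r)"
      "scal (chi (0, b, c, d, 0) (0, b, c, d, 0)) \<star> ?r \<noteq> 0"
      using r' unfolding has_expo_poly_in_w by (simp_all del: chi.simps)
  qed
qed

text \<open>
  Degrees in \<open>w\<close> are nonnegative and add up to zero.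
\<close>

lemma poly_in_w_unit:
  assumes "poly_in_w f" "poly_in_w g" "f \<star> g = 1"
  obtains a where "a \<noteq> 0" "f = scal a"
proof -
  have nz: "f \<noteq> 0" "g \<noteq> 0" using assms(3) by auto
  then have mem: "lead f \<in> keys f" "lead g \<in> keys g" by (auto intro: Max_in)
  then obtain e e' where e: "e \<ge> 0" "e' \<ge> 0" "lead f = (0, 0, 0, 0, e)" "lead g = (0, 0, 0, 0, e')"
    using assms unfolding poly_in_w_def by blast
  have "lead f + lead g = 0" using lead_tmul(2)[OF nz] assms(3) by simp
  then have "e + e' = 0" using e by (simp add: expo_zero)
  then have lf: "lead f = 0" using e by (simp add: expo_zero)
  have "keys f \<subseteq> {0}"
  proof
    fix u assume u: "u \<in> keys f"
    then obtain e1 where e1: "e1 \<ge> 0" "u = (0, 0, 0, 0, e1)" using assms unfolding poly_in_w_def by blast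
    have "u \<le> 0" using u lf Max_ge[of "keys f" u] by simp
    then show "u \<in> {0}" using e1 by (simp add: expo_zero)
  qed
  then have "f = scal (lookup f 0)" using poly_mapping_sum_single[of "{0}" f] by simp
  then show thesis using that nz by (metis single_zero)
qed

primrec wpow :: "nat \<Rightarrow> 'k torus" where
  "wpow 0 = 1" | "wpow (Suc n) = tW \<star> wpow n"

lemma wpow_eq: "wpow n = monom1 (0, 0, 0, 0, int n)"
  by (induction n) (simp_all add: monom1_0 tW_def monom1_mult)

lemma B_wpow: "wpow n \<in> B"
  by (induction n) (auto intro: B_one B_mult B_W)

definition eval_w :: "'k poly \<Rightarrow> 'k torus" where
  "eval_w P = fold_coeffs (\<lambda>a f. scal a + tW \<star> f) P 0"

lemma eval_w_0 [simp]: "eval_w 0 = 0" by (simp add: eval_w_def)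

lemma eval_w_pCons [simp]: "eval_w (pCons a P) = scal a + tW \<star> eval_w P"
  by (cases "P = 0 \<and> a = 0") (auto simp: eval_w_def fold_coeffs_pCons_not_0_0_eq)

lemma eval_w_add: "eval_w (P + Q) = eval_w P + eval_w Q"
proof (induction P arbitrary: Q)
  case (pCons a P)
  then show ?case by (cases Q) (simp add: single_add tmul_add_right)
qed simp

lemma eval_w_smult: "eval_w (smult a P) = scal a \<star> eval_w P"
  by (induction P) (simp_all add: tmul_add_right scal_mult scal_left_commute[of tW])

lemma eval_w_mult: "eval_w (P * Q) = eval_w P \<star> eval_w Q"
  by (induction P) (simp_all add: eval_w_add eval_w_smult tmul_add_left tmul_assoc)

lemma lookup_eval_w: "lookup (eval_w P) (k, b, c, d, e) =
   (if k = 0 \<and> b = 0 \<and> c = 0 \<and> d = 0 \<and> e \<ge> 0 then coeff P (nat e) else 0)"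
proof (induction P arbitrary: e)
  case (pCons a P)
  show ?case
  proof (cases "e > 0")
    case True
    then have "nat e = Suc (nat (e - 1))" by simp
    then show ?thesis using True
      by (simp add: lookup_add lookup_single when_def expo_zero tW_def monom1_def lookup_single_tmul pCons.IH)
  next
    case False
    then show ?thesis
      by (auto simp: lookup_add lookup_single when_def expo_zero tW_def monom1_def lookup_single_tmul pCons.IH)
  qed
qed simp

lemma eval_w_inj: "eval_w P = eval_w Q \<Longrightarrow> P = Q"
proof (rule poly_eqI)
  fix n assume "eval_w P = eval_w Q"
  then have "lookup (eval_w P) (0, 0, 0, 0, int n) = lookup (eval_w Q) (0, 0, 0, 0, int n)" by simp
  then show "coeff P n = coeff Q n" by (simp add: lookup_eval_w)
qed

lemma poly_in_w_eval_w: assumes "poly_in_w f" obtains P where "f = eval_w P"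
proof -
  let ?g = "\<lambda>n. lookup f (0, 0, 0, 0, int n)"
  have "finite ((\<lambda>n::nat. (0::int, 0::int, 0::int, 0::int, int n)) -` keys f)"
    by (rule finite_vimageI) (auto simp: inj_on_def)
  then have "finite {n. ?g n \<noteq> 0}" by (simp add: vimage_def in_keys_iff)
  then have "\<forall>\<^sub>\<infinity>n. ?g n = 0" by (simp add: MOST_iff_cofinite)
  then have co: "coeff (Abs_poly ?g) = ?g" by (simp add: Abs_poly_inverse)
  have "f = eval_w (Abs_poly ?g)"
  proof (rule poly_mapping_eqI)
    fix u :: expo
    obtain k b c d e where u: "u = (k, b, c, d, e)" by (cases u)
    show "lookup f u = lookup (eval_w (Abs_poly ?g)) u"
    proof (cases "u \<in> keys f")
      case True
      then obtain e' where "e' \<ge> 0" "u = (0, 0, 0, 0, e')" using assms unfolding poly_in_w_def by blast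
      then show ?thesis by (simp add: lookup_eval_w co)
    next
      case False
      then show ?thesis unfolding u by (auto simp: lookup_eval_w co in_keys_iff)
    qed
  qed
  then show thesis by (rule that)
qed

lemma poly_in_w_central: "poly_in_w f \<Longrightarrow> f \<star> g = g \<star> f"
  using tmul_commute_factor[of f g 1] unfolding poly_in_w_def by fastforce

lemma eval_w_B: "eval_w P \<in> B"
  by (induction P) (auto simp: B_0 intro: B_add B_mult B_W B_scal)

lemma poly_in_w_B: "poly_in_w f \<Longrightarrow> f \<in> B"
  using poly_in_w_eval_w eval_w_B by metis

text \<open>
  A monomial commuting with \<open>z\<close>, \<open>s\<close>, \<open>t\<close> and \<open>x\<close> has, in this order, \<open>x\<close>-degree, \<open>t\<close>-degree,
  \<open>s\<close>-degree and \<open>z\<close>-degree zero, since \<open>p\<close> and \<open>q\<close> have infinite order.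
\<close>

lemma central_poly_in_w:
  assumes "f \<in> B" "\<And>g. g \<in> B \<Longrightarrow> f \<star> g = g \<star> f"
  shows "poly_in_w f"
  unfolding poly_in_w_def
proof
  fix u assume u: "u \<in> keys f"
  then have f: "f \<noteq> 0" by auto
  obtain k b c d e where ue: "u = (k, b, c, d, e)" by (cases u)
  have e: "e \<ge> 0" using B_keysD[OF assms(1)] u ue by auto
  have ex: "chi u v = chi v u" if "monom1 v \<in> B" for v
  proof -
    have "f \<star> single v 1 = single v 1 \<star> f"
      using assms(2)[OF that] by (simp add: monom1_def)
    from normalizes_monomial[OF f this] obtain c' where
      "single v 1 = single v c'" "chi u v = c' * chi v u" using u by metis
    then show ?thesis by (metis lookup_single_eq mult_1)
  qed
  have k: "k = 0" using ex[of "(0, 1, 0, 0, 0)"] B_Z by (simp add: tZ_def ue p_powi)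
  have d: "d = 0" using ex[of "(0, 0, 1, 0, 0)"] B_S k 
    by (simp add: tS_def ue q_powi power_int_inverse)
  have c: "c = 0" using ex[of "(0, 0, 0, 1, 0)"] B_T k 
    by (simp add: tT_def ue q_powi power_int_inverse)
  have b: "b = 0" using ex[of "(1, 0, 0, 0, 0)"] B_X k c d by (simp add: tX_def ue p_powi)
  show "\<exists>e\<ge>0. u = (0, 0, 0, 0, e)" using ue k b c d e by simp
qed

text \<open>
  The condition \<open>n B \<subseteq> B n\<close>, which is preserved by automorphisms, determines the shape of \<open>n\<close>.
\<close>

definition normal_elt :: "'k torus \<Rightarrow> bool" where
  "normal_elt n \<longleftrightarrow> n \<in> B \<and> n \<noteq> 0 \<and> (\<forall>u\<in>B. \<exists>v\<in>B. n \<star> u = v \<star> n)"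

lemma normal_eltI_gens:
  assumes "n \<in> B" "n \<noteq> 0"
    and "\<exists>v\<in>B. n \<star> tX = v \<star> n" "\<exists>v\<in>B. n \<star> tY = v \<star> n"
    and "\<exists>v\<in>B. n \<star> tS = v \<star> n" "\<exists>v\<in>B. n \<star> tT = v \<star> n"
  shows "normal_elt n"
proof -
  have "\<exists>v\<in>B. n \<star> u = v \<star> n" if "u \<in> B" for u
    using that
  proof induction
    case (B_scal c)
    then show ?case using B.B_scal scal_commute by metis
  next
    case (B_add f g)
    then show ?case using B.B_add tmul_add_left tmul_add_right by metis
  next
    case (B_mult f g)
    then show ?case using B.B_mult tmul_assoc by metis
  next
    case B_W
    then show ?case using W_central B.B_W by metis
  qed (use assms in auto)
  then show ?thesis using assms(1,2) unfolding normal_elt_def by blast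
qed

text \<open>
  Commuting with \<open>z\<close>, \<open>s\<close>, \<open>t\<close> and \<open>x\<close> up to scalars leaves \<open>n = r(w) z^b x^k s^c t^d\<close> for one tuple of
  exponents. If \<open>k < 0\<close> then \<open>n\<close> does not vanish at \<open>z = 1\<close>. If \<open>k > 0\<close> then \<open>n y = y' n\<close> forces \<open>y'\<close> to be a
  multiple of \<open>(p^k z - 1) x^{-1}\<close>, which does not vanish at \<open>z = 1\<close> either. So \<open>k = 0\<close>.
\<close>

lemma normal_elt_structure:
  assumes "normal_elt n"
  obtains b c d where "b \<ge> 0" "c \<ge> 0" "d \<ge> 0" "has_expo b c d n"
proof -
  have n: "n \<in> B" "n \<noteq> 0" and sw: "\<And>u. u \<in> B \<Longrightarrow> \<exists>v\<in>B. n \<star> u = v \<star> n"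
    using assms unfolding normal_elt_def by auto
  have "keys n \<noteq> {}" using n(2) by simp
  then obtain u0 where u0: "u0 \<in> keys n" by blast
  obtain k b c d e where ue: "u0 = (k, b, c, d, e)" by (cases u0)
  have com: "\<exists>a. \<forall>u\<in>keys n. chi u v = a * chi v u" if v: "monom1 v \<in> B" for v
  proof -
    obtain h where "n \<star> single v 1 = h \<star> n" using sw[OF v] unfolding monom1_def by auto
    from normalizes_monomial[OF n(2) this] show ?thesis by metis
  qed
  have same: "k' = k \<and> b' = b \<and> c' = c \<and> d' = d \<and> 0 \<le> e'" if u: "(k', b', c', d', e') \<in> keys n" for k' b' c' d' e'
  proof -
    have e: "e' \<ge> 0" using B_keysD[OF n(1) u] by auto
    have k: "k' = k"
    proof -
      obtain a where "\<forall>u\<in>keys n. chi u (0, 1, 0, 0, 0) = a * chi (0, 1, 0, 0, 0) u"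
        using com[of "(0, 1, 0, 0, 0)"] B_Z unfolding tZ_def by blast
      from bspec[OF this u] bspec[OF this u0] have "p powi k' = p powi k" by (simp add: ue)
      then show ?thesis by (rule powi_inj[OF p0 p_gen])
    qed
    have d: "d' = d"
    proof -
      obtain a where "\<forall>u\<in>keys n. chi u (0, 0, 1, 0, 0) = a * chi (0, 0, 1, 0, 0) u"
        using com[of "(0, 0, 1, 0, 0)"] B_S unfolding tS_def by blast
      from bspec[OF this u] bspec[OF this u0]
      have "inverse (q powi d') = inverse (q powi d)" using k
        by (simp add: ue power_int_inverse)
      then have "q powi d' = q powi d" by simp
      then show ?thesis by (rule powi_inj[OF q0 q_gen])
    qed
    have c: "c' = c"
    proof -
      obtain a where "\<forall>u\<in>keys n. chi u (0, 0, 0, 1, 0) = a * chi (0, 0, 0, 1, 0) u"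
        using com[of "(0, 0, 0, 1, 0)"] B_T unfolding tT_def by blast
      from bspec[OF this u] bspec[OF this u0]
      have a: "1 = a * (m powi k * inverse q powi c')" "1 = a * (m powi k * inverse q powi c)" using k
        by (simp_all add: ue)
      then have "m powi k * inverse q powi c' = m powi k * inverse q powi c"
        by (metis mult_cancel_left zero_neq_one mult_zero_left)
      then have "q powi c' = q powi c" using m0 by (simp add: power_int_inverse power_int_not_zero)
      then show ?thesis by (rule powi_inj[OF q0 q_gen])
    qed
    have b: "b' = b"
    proof -
      obtain a where "\<forall>u\<in>keys n. chi u (1, 0, 0, 0, 0) = a * chi (1, 0, 0, 0, 0) u"
        using com[of "(1, 0, 0, 0, 0)"] B_X unfolding tX_def by blast
      from bspec[OF this u] bspec[OF this u0]
      have a: "l powi c * m powi d = a * p powi b'" "l powi c * m powi d = a * p powi b" using c d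
        by (simp_all add: ue)
      moreover have "l powi c * m powi d \<noteq> 0" using l0 m0 by (simp add: power_int_not_zero)
      ultimately have "p powi b' = p powi b"
        by (metis mult_cancel_left mult_zero_left)
      then show ?thesis by (rule powi_inj[OF p0 p_gen])
    qed
    show ?thesis using k b c d e by simp
  qed
  have nonneg: "0 \<le> b" "0 \<le> c" "0 \<le> d" using B_keysD[OF n(1)] u0 ue by auto
  have "\<not> k < 0"
  proof
    assume "k < 0"
    then have "eval_z1 k c d e n = 0" using B_eval_z1[OF n(1)] by blast
    moreover have "eval_z1 k c d e n = (\<Sum>b'. (lookup n (k, b, c, d, e) when b' = b))"
      unfolding eval_z1_def
    proof (rule Sum_any.cong)
      fix b'
      show "lookup n (k, b', c, d, e) = (lookup n (k, b, c, d, e) when b' = b)"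
        using same[of k b' c d e] by (cases "b' = b") (auto simp: in_keys_iff)
    qed
    ultimately have "lookup n (k, b, c, d, e) = 0" by simp
    then show False using u0 ue by (simp add: in_keys_iff)
  qed
  moreover have "\<not> k > 0"
  proof
    assume k: "k > 0"
    obtain v where v: "v \<in> B" "n \<star> tY = v \<star> n" using sw[OF B_Y] by blast
    \<comment> \<open>As \<open>w\<close> is central, its exponent may be dropped from the commutation factor of \<open>n\<close> with a monomial.\<close>
    let ?f = "\<lambda>v. chi (k, b, c, d, 0) v / chi v (k, b, c, d, 0)"
    let ?u = "(-1, 1, 0, 0, 0) :: expo" and ?u' = "(-1, 0, 0, 0, 0) :: expo"
    have swap: "n \<star> monom1 u = scal (?f u) \<star> (monom1 u \<star> n)" for u
    proof (rule tmul_commute_factor)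
      fix x y assume x: "x \<in> keys n" and y: "y \<in> keys (monom1 u)"
      obtain e' where x': "x = (k, b, c, d, e')" using same x by (cases x) auto
      have "y = u" using y by (simp add: monom1_def split: if_splits)
      moreover have "chi x u = chi (k, b, c, d, 0) u" "chi u x = chi u (k, b, c, d, 0)"
        unfolding x' by (cases u; simp)+
      ultimately show "chi x y = ?f u * chi y x" by (simp add: chi_nz)
    qed
    let ?v = "scal (inverse (p - 1)) \<star> (scal (?f ?u) \<star> monom1 ?u - scal (?f ?u') \<star> monom1 ?u')"
    have "n \<star> tY = ?v \<star> n"
      unfolding tY_def scal_left_commute[of n] tmul_diff swap by (simp add: tmul_assoc tmul_diff)
    then have "v = ?v" using tmul_right_cancel[OF n(2)] v(2) by metis
    then have "eval_z1 (-1) 0 0 0 ?v = 0" using B_eval_z1[OF v(1)] by simp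
    moreover have "lookup ?v (-1, b', 0, 0, 0) =
      ((inverse (p - 1) * ?f ?u) when b' = 1) + ((- inverse (p - 1) * ?f ?u') when b' = 0)" for b'
      by (auto simp: lookup_minus monom1_def lookup_single when_def)
    ultimately have "(\<Sum>b'::int. ((inverse (p - 1) * ?f ?u) when b' = 1) + ((- inverse (p - 1) * ?f ?u') when b' = 0)) = 0"
      unfolding eval_z1_def by simp
    moreover have "(\<Sum>b'::int. ((inverse (p - 1) * ?f ?u) when b' = 1) + ((- inverse (p - 1) * ?f ?u') when b' = 0)) =
       (inverse (p - 1) * ?f ?u) + (- inverse (p - 1) * ?f ?u')"
      by (subst Sum_any.distrib) auto
    ultimately have "inverse (p - 1) * (?f ?u - ?f ?u') = 0" by (simp add: algebra_simps)
    then have "?f ?u = ?f ?u'" using p1 by simp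
    moreover have "?f ?u = p powi k * ?f ?u'" by simp
    moreover have "?f ?u' \<noteq> 0" by (simp add: chi_nz del: chi.simps)
    ultimately have "p powi k = 1" using p0 l0 m0 by auto
    then show False using p_powi k by simp
  qed
  ultimately have "k = 0" by simp
  have "has_expo b c d n"
    unfolding has_expo_def
  proof (intro conjI ballI)
    fix u assume "u \<in> keys n"
    then show "\<exists>e\<ge>0. u = (0, b, c, d, e)" using same \<open>k = 0\<close> by (cases u) auto
  qed (rule n(2))
  then show thesis using that nonneg by blast
qed

end

section \<open>Automorphisms in the torus\<close>

text \<open>
  The arithmetic of an automorphism acting on exponents of \<open>z\<close>, \<open>s\<close>, \<open>t\<close>: a matrix over the natural
  numbers whose inverse is also one over the natural numbers is a permutation matrix, and the
  determinant excludes the exchange of \<open>s\<close> and \<open>t\<close>. The primed numbers belong to the inverse.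
\<close>

lemma nonneg_unimodular:
  fixes c1 d1 c2 d2 :: int
  assumes nn: "c1 \<ge> 0" "d1 \<ge> 0" "c2 \<ge> 0" "d2 \<ge> 0" "b1 \<ge> 0" "b2 \<ge> 0"
    "c1' \<ge> 0" "d1' \<ge> 0" "c2' \<ge> 0" "d2' \<ge> 0" "b1' \<ge> 0" "b2' \<ge> 0" "b0 \<ge> 0"
    and det: "c1 * d2 - d1 * c2 = 1"
    and s: "b1' * b0 + c1' * b1 + d1' * b2 = 0" "c1' * c1 + d1' * c2 = 1" "c1' * d1 + d1' * d2 = 0"
    and t: "b2' * b0 + c2' * b1 + d2' * b2 = 0" "c2' * c1 + d2' * c2 = 0" "c2' * d1 + d2' * d2 = (1::int)"
  shows "b1 = 0 \<and> c1 = 1 \<and> d1 = 0 \<and> b2 = 0 \<and> c2 = 0 \<and> d2 = 1"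
proof -
  have pos: "c1 > 0" "d2 > 0"
  proof -
    have "c1 * d2 > 0" using det nn mult_nonneg_nonneg[of d1 c2] by linarith
    then show "c1 > 0" "d2 > 0" using nn by (auto simp: zero_less_mult_iff)
  qed
  have zero: "x = 0" "y = 0" if "x + y = 0" "x \<ge> 0" "y \<ge> 0" for x y :: int
    using that by auto
  have "c2' * c1 = 0" "d2' * c2 = 0" "c1' * d1 = 0" "d1' * d2 = 0"
    using zero[OF t(2)] zero[OF s(3)] nn by simp_all
  then have z: "c2' = 0" "d1' = 0" using pos by auto
  then have e: "c1' * c1 = 1" "d2' * d2 = 1" using s t by auto
  then have one: "c1 = 1" "c1' = 1" "d2 = 1" "d2' = 1"
    using nn by (auto simp: zmult_eq_1_iff)
  have "d1 = 0" "c2 = 0" using \<open>d2' * c2 = 0\<close> \<open>c1' * d1 = 0\<close> one by auto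
  moreover have "b1 = 0" "b2 = 0"
  proof -
    have "b1' * b0 \<ge> 0" "b2' * b0 \<ge> 0" using nn by simp_all
    moreover have "b1' * b0 + b1 = 0" "b2' * b0 + b2 = 0" using s(1) t(1) z one by simp_all
    ultimately show "b1 = 0" "b2 = 0" using nn by linarith+
  qed
  ultimately show ?thesis using one by simp
qed

context qweyl_torus
begin

definition B_aut :: "('k torus \<Rightarrow> 'k torus) \<Rightarrow> bool" where
  "B_aut \<phi> \<longleftrightarrow> bij_betw \<phi> B B \<and> (\<forall>f\<in>B. \<forall>g\<in>B. \<phi> (f + g) = \<phi> f + \<phi> g) \<and>
     (\<forall>f\<in>B. \<forall>g\<in>B. \<phi> (f \<star> g) = \<phi> f \<star> \<phi> g) \<and> (\<forall>c. \<phi> (scal c) = scal c)"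

lemma B_aut_inv:
  assumes "B_aut \<phi>"
  shows "B_aut (inv_into B \<phi>)"
proof -
  have bij: "bij_betw \<phi> B B" using assms unfolding B_aut_def by blast
  let ?\<psi> = "inv_into B \<phi>"
  have inB: "?\<psi> f \<in> B" if "f \<in> B" for f
    using bij that by (metis bij_betw_def inv_into_into)
  have r: "\<phi> (?\<psi> f) = f" if "f \<in> B" for f
    using bij that by (metis bij_betw_inv_into_right)
  have l: "?\<psi> (\<phi> f) = f" if "f \<in> B" for f
    using bij that by (metis bij_betw_inv_into_left)
  have "?\<psi> (f + g) = ?\<psi> f + ?\<psi> g" if "f \<in> B" "g \<in> B" for f g
    proof -
    have "\<phi> (?\<psi> f + ?\<psi> g) = f + g"
      using assms inB that r unfolding B_aut_def by simp
    then show ?thesis using l[OF B_add[OF inB[OF that(1)] inB[OF that(2)]]] by simp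
  qed
  moreover have "?\<psi> (f \<star> g) = ?\<psi> f \<star> ?\<psi> g" if "f \<in> B" "g \<in> B" for f g
    proof -
    have "\<phi> (?\<psi> f \<star> ?\<psi> g) = f \<star> g"
      using assms inB that r unfolding B_aut_def by simp
    then show ?thesis using l[OF B_mult[OF inB[OF that(1)] inB[OF that(2)]]] by simp
  qed
  moreover have "?\<psi> (scal c) = scal c" for c
    using assms l[OF B_scal] unfolding B_aut_def by metis
  ultimately show ?thesis
    using bij_betw_inv_into[OF bij] unfolding B_aut_def by blast
qed

context
  fixes \<phi> assumes aut: "B_aut \<phi>"
begin

lemma aut_B: "f \<in> B \<Longrightarrow> \<phi> f \<in> B"
  using aut unfolding B_aut_def bij_betw_def by blast

lemma aut_inj: "f \<in> B \<Longrightarrow> g \<in> B \<Longrightarrow> \<phi> f = \<phi> g \<Longrightarrow> f = g"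
  using aut unfolding B_aut_def bij_betw_def inj_on_def by blast

lemma aut_surj: assumes "g \<in> B" obtains f where "f \<in> B" "g = \<phi> f"
  using aut assms unfolding B_aut_def bij_betw_def by (metis imageE)

lemma aut_add: "f \<in> B \<Longrightarrow> g \<in> B \<Longrightarrow> \<phi> (f + g) = \<phi> f + \<phi> g"
  and aut_mult: "f \<in> B \<Longrightarrow> g \<in> B \<Longrightarrow> \<phi> (f \<star> g) = \<phi> f \<star> \<phi> g"
  and aut_scal: "\<phi> (scal c) = scal c"
  using aut unfolding B_aut_def by blast+

lemma aut_0: "\<phi> 0 = 0" and aut_1: "\<phi> 1 = 1"
  using aut_scal[of 0] aut_scal[of 1] by simp_all

lemma aut_diff: "f \<in> B \<Longrightarrow> g \<in> B \<Longrightarrow> \<phi> (f - g) = \<phi> f - \<phi> g"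
  using aut_add[of "f - g" g] by (simp add: B_diff)

lemma aut_nz: "f \<in> B \<Longrightarrow> f \<noteq> 0 \<Longrightarrow> \<phi> f \<noteq> 0"
  using aut_inj[of f 0] B_0 aut_0 by auto

lemma aut_poly_in_w:
  assumes "poly_in_w f" shows "poly_in_w (\<phi> f)"
proof (rule central_poly_in_w)
  have f: "f \<in> B" using assms by (rule poly_in_w_B)
  then show "\<phi> f \<in> B" by (rule aut_B)
  fix g assume "g \<in> B"
  then obtain h where h: "h \<in> B" "g = \<phi> h" by (rule aut_surj)
  then show "\<phi> f \<star> g = g \<star> \<phi> f"
    using poly_in_w_central[OF assms, of h] aut_mult[OF f h(1)] aut_mult[OF h(1) f] by simp
qed

lemma aut_normal_elt:
  assumes "normal_elt n" shows "normal_elt (\<phi> n)"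
  unfolding normal_elt_def
proof (intro conjI ballI)
  have n: "n \<in> B" "n \<noteq> 0" using assms unfolding normal_elt_def by auto
  show "\<phi> n \<in> B" "\<phi> n \<noteq> 0" using n by (auto intro: aut_B dest: aut_nz)
  fix u assume "u \<in> B"
  then obtain h where h: "h \<in> B" "u = \<phi> h" by (rule aut_surj)
  obtain v where "v \<in> B" "n \<star> h = v \<star> n" using assms h unfolding normal_elt_def by blast
  then show "\<exists>v\<in>B. \<phi> n \<star> u = v \<star> \<phi> n"
    using h n aut_mult aut_B by metis
qed

lemma aut_eval_w:
  assumes "\<phi> tW = eval_w P"
  shows "\<phi> (eval_w Q) = eval_w (pcompose Q P)"
proof (induction Q)
  case (pCons a Q)
  then show ?case
    using assms by (simp add: aut_add aut_mult B_scal B_mult B_W eval_w_B aut_scal pcompose_pCons eval_w_add eval_w_mult)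
qed (simp add: aut_0)

end

lemma poly_in_w_tW: "poly_in_w tW" by (simp add: poly_in_w_def tW_def monom1_def)

lemma eval_w_X: "eval_w [:0, 1:] = tW" by simp

text \<open>
  The center is preserved, so \<open>\<phi>(w) = P(w)\<close> and \<open>\<phi>^{-1}(w) = Q(w)\<close> for polynomials with \<open>Q \<circ> P = w\<close>; their
  degrees multiply to one.
\<close>

lemma aut_W:
  assumes "B_aut \<phi>"
  obtains a b where "a \<noteq> 0" "\<phi> tW = scal a \<star> tW + scal b"
proof -
  let ?\<psi> = "inv_into B \<phi>"
  have inv: "B_aut ?\<psi>" using assms by (rule B_aut_inv)
  obtain P where P: "\<phi> tW = eval_w P" using aut_poly_in_w[OF assms poly_in_w_tW] poly_in_w_eval_w by metis
  obtain Q where Q: "?\<psi> tW = eval_w Q" using aut_poly_in_w[OF inv poly_in_w_tW] poly_in_w_eval_w by metis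
  have "\<phi> (?\<psi> tW) = tW"
    using assms B_W unfolding B_aut_def by (metis bij_betw_inv_into_right)
  then have "eval_w (pcompose Q P) = eval_w [:0, 1:]"
    using aut_eval_w[OF assms P, of Q] Q eval_w_X by simp
  then have "pcompose Q P = [:0, 1:]" by (rule eval_w_inj)
  then have "degree Q * degree P = 1" by (metis degree_pcompose degree_pCons_eq_if degree_0 one_neq_zero pCons_eq_0_iff One_nat_def)
  then have "degree P = 1" by simp
  moreover obtain b P' where P': "P = pCons b P'" by (cases P)
  ultimately have "degree P' = 0" "P' \<noteq> 0" by (auto split: if_splits)
  then obtain a where "P = [:b, a:]" "a \<noteq> 0"
    using P' by (metis degree_eq_zeroE pCons_eq_0_iff)
  then show thesis
    using that[of a b] P by (simp add: scal_commute[of tW] add.commute)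
qed

lemma tX_nz: "tX \<noteq> 0" and tZ_nz: "tZ \<noteq> 0" and tS_nz: "tS \<noteq> 0" and tT_nz: "tT \<noteq> 0"
  by (simp_all add: tX_def tZ_def tS_def tT_def)

lemma normal_elt_tS: "normal_elt tS"
proof (rule normal_eltI_gens)
  show "\<exists>v\<in>B. tS \<star> tX = v \<star> tS"
    using rel_SX by (intro bexI[of _ "scal l \<star> tX"]) (auto simp: tmul_assoc intro: B_mult B_scal B_X)
  show "\<exists>v\<in>B. tS \<star> tY = v \<star> tS"
    using rel_SY by (intro bexI[of _ "scal (inverse l) \<star> tY"]) (auto simp: tmul_assoc intro: B_mult B_scal B_Y)
  show "\<exists>v\<in>B. tS \<star> tT = v \<star> tS"
    using rel_ST by (intro bexI[of _ "scal q \<star> tT"]) (auto simp: tmul_assoc intro: B_mult B_scal B_T)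
qed (auto simp: tS_nz B_S)

lemma normal_elt_tT: "normal_elt tT"
proof (rule normal_eltI_gens)
  show "\<exists>v\<in>B. tT \<star> tX = v \<star> tT"
    using rel_TX by (intro bexI[of _ "scal m \<star> tX"]) (auto simp: tmul_assoc intro: B_mult B_scal B_X)
  show "\<exists>v\<in>B. tT \<star> tY = v \<star> tT"
    using rel_TY by (intro bexI[of _ "scal (inverse m) \<star> tY"]) (auto simp: tmul_assoc intro: B_mult B_scal B_Y)
  have "tT \<star> tS = (scal (inverse q) \<star> tS) \<star> tT"
    using rel_ST q0 by (simp add: tmul_assoc scal_scal)
  then show "\<exists>v\<in>B. tT \<star> tS = v \<star> tT"
    by (intro bexI[of _ "scal (inverse q) \<star> tS"]) (auto intro: B_mult B_scal B_S)
qed (auto simp: tT_nz B_T)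

lemma normal_elt_tZ: "normal_elt tZ"
proof (rule normal_eltI_gens)
  have "tZ \<star> tX = (scal (inverse p) \<star> tX) \<star> tZ"
    using rel_XZ p0 by (simp add: tmul_assoc scal_scal)
  then show "\<exists>v\<in>B. tZ \<star> tX = v \<star> tZ"
    by (intro bexI[of _ "scal (inverse p) \<star> tX"]) (auto intro: B_mult B_scal B_X)
  show "\<exists>v\<in>B. tZ \<star> tY = v \<star> tZ"
    using rel_ZY by (intro bexI[of _ "scal p \<star> tY"]) (auto simp: tmul_assoc intro: B_mult B_scal B_Y)
  show "\<exists>v\<in>B. tZ \<star> tS = v \<star> tZ" using rel_SZ B_S by metis
  show "\<exists>v\<in>B. tZ \<star> tT = v \<star> tZ" using rel_TZ B_T by metis
qed (auto simp: tZ_nz B_Z)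

lemma monom1_B: "monom1 (0, int i, int j, int k, 0) \<in> B"
proof -
  have 1: "monom1 (0, 0, 0, int k, 0) \<in> B"
  proof (induction k)
    case (Suc k)
    have "tT \<star> monom1 (0, 0, 0, int k, 0) = monom1 (0, 0, 0, int (Suc k), 0)"
      by (simp add: tT_def monom1_mult)
    then show ?case using B_mult[OF B_T Suc] by simp
  qed (simp add: monom1_0 B_one)
  have 2: "monom1 (0, 0, int j, int k, 0) \<in> B"
  proof (induction j)
    case (Suc j)
    have "tS \<star> monom1 (0, 0, int j, int k, 0) = monom1 (0, 0, int (Suc j), int k, 0)"
      by (simp add: tS_def monom1_mult)
    then show ?case using B_mult[OF B_S Suc] by simp
  qed (simp add: 1)
  show ?thesis
  proof (induction i)
    case (Suc i)
    have "tZ \<star> monom1 (0, int i, int j, int k, 0) = monom1 (0, int (Suc i), int j, int k, 0)"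
      by (simp add: tZ_def monom1_mult)
    then show ?case using B_mult[OF B_Z Suc] by simp
  qed (simp add: 2)
qed

lemma aut_expo_monom1:
  assumes aut: "B_aut \<phi>"
    and Z: "has_expo b0 c0 d0 (\<phi> tZ)" and S: "has_expo b1 c1 d1 (\<phi> tS)" and T: "has_expo b2 c2 d2 (\<phi> tT)"
  shows "has_expo (int i * b0 + int j * b1 + int k * b2) (int i * c0 + int j * c1 + int k * c2)
     (int i * d0 + int j * d1 + int k * d2) (\<phi> (monom1 (0, int i, int j, int k, 0)))"
proof -
  have 1: "has_expo (int k * b2) (int k * c2) (int k * d2) (\<phi> (monom1 (0, 0, 0, int k, 0)))"
  proof (induction k)
    case 0
    then show ?case using has_expo_monom1[of 0 0 0] by (simp add: monom1_0 aut_1[OF aut])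
  next
    case (Suc k)
    have "tT \<star> monom1 (0, 0, 0, int k, 0) = monom1 (0, 0, 0, int (Suc k), 0)"
      by (simp add: tT_def monom1_mult)
    then have "\<phi> (monom1 (0, 0, 0, int (Suc k), 0)) = \<phi> tT \<star> \<phi> (monom1 (0, 0, 0, int k, 0))"
      using aut_mult[OF aut B_T monom1_B[of 0 0 k]] by simp
    then show ?case using has_expo_mult[OF T Suc] by (simp add: algebra_simps)
  qed
  have 2: "has_expo (int j * b1 + int k * b2) (int j * c1 + int k * c2) (int j * d1 + int k * d2)
    (\<phi> (monom1 (0, 0, int j, int k, 0)))"
  proof (induction j)
    case (Suc j)
    have "tS \<star> monom1 (0, 0, int j, int k, 0) = monom1 (0, 0, int (Suc j), int k, 0)"
      by (simp add: tS_def monom1_mult)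
    then have "\<phi> (monom1 (0, 0, int (Suc j), int k, 0)) = \<phi> tS \<star> \<phi> (monom1 (0, 0, int j, int k, 0))"
      using aut_mult[OF aut B_S monom1_B[of 0 j k]] by simp
    then show ?case using has_expo_mult[OF S Suc] by (simp add: algebra_simps)
  qed (simp add: 1)
  show ?thesis
  proof (induction i)
    case (Suc i)
    have "tZ \<star> monom1 (0, int i, int j, int k, 0) = monom1 (0, int (Suc i), int j, int k, 0)"
      by (simp add: tZ_def monom1_mult)
    then have "\<phi> (monom1 (0, int (Suc i), int j, int k, 0)) = \<phi> tZ \<star> \<phi> (monom1 (0, int i, int j, int k, 0))"
      using aut_mult[OF aut B_Z monom1_B[of i j k]] by simp
    then show ?case using has_expo_mult[OF Z Suc] by (simp add: algebra_simps)
  qed (simp add: 2)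
qed

text \<open>
  On the elements \<open>r(w) z^b s^c t^d\<close> an automorphism acts linearly on exponents, because it maps \<open>r(w)\<close> to a
  polynomial in \<open>w\<close>.
\<close>

lemma aut_expo:
  assumes aut: "B_aut \<phi>"
    and Z: "has_expo b0 c0 d0 (\<phi> tZ)" and S: "has_expo b1 c1 d1 (\<phi> tS)" and T: "has_expo b2 c2 d2 (\<phi> tT)"
    and n: "has_expo b c d n" "b \<ge> 0" "c \<ge> 0" "d \<ge> 0"
  shows "has_expo (b * b0 + c * b1 + d * b2) (b * c0 + c * c1 + d * c2) (b * d0 + c * d1 + d * d2) (\<phi> n)"
proof -
  obtain r where r: "poly_in_w r" "r \<noteq> 0" "n = r \<star> monom1 (0, b, c, d, 0)" using n(1) by (rule has_expo_decomp)
  obtain i j k where ijk: "b = int i" "c = int j" "d = int k" using n by (metis nonneg_int_cases)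
  have mB: "monom1 (0, b, c, d, 0) \<in> B" unfolding ijk by (rule monom1_B)
  have "has_expo 0 0 0 (\<phi> r)"
    unfolding has_expo_poly_in_w using aut_poly_in_w[OF aut r(1)] aut_nz[OF aut poly_in_w_B[OF r(1)] r(2)] by simp
  from has_expo_mult[OF this aut_expo_monom1[OF aut Z S T, of i j k]] show ?thesis
    unfolding r(3) aut_mult[OF aut poly_in_w_B[OF r(1)] mB] by (simp add: ijk)
qed

text \<open>
  Here \<open>\<phi>(n) = r n\<close> and \<open>\<phi>^{-1}(n) = r' n\<close> with polynomials \<open>r\<close>, \<open>r'\<close> in \<open>w\<close>. Applying \<open>\<phi>\<close> to the second
  equation gives \<open>\<phi>(r') r = 1\<close>, so \<open>r\<close> is a constant.
\<close>

lemma aut_scale_single: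
  assumes aut: "B_aut \<phi>" and n_eq: "n = monom1 (0, b, c, d, 0)" and nB: "n \<in> B"
    and n: "has_expo b c d (\<phi> n)" and n': "has_expo b c d (inv_into B \<phi> n)"
  obtains a where "a \<noteq> 0" "\<phi> n = scal a \<star> n"
proof -
  have inv: "B_aut (inv_into B \<phi>)" using aut by (rule B_aut_inv)
  have rt: "\<phi> (inv_into B \<phi> n) = n" using aut nB unfolding B_aut_def by (metis bij_betw_inv_into_right)
  obtain r where r: "poly_in_w r" "\<phi> n = r \<star> n" using n n_eq has_expo_decomp by metis
  obtain r' where r': "poly_in_w r'" "inv_into B \<phi> n = r' \<star> n" using n' n_eq has_expo_decomp by metis
  have "(\<phi> r' \<star> r) \<star> n = n"
    using rt unfolding r'(2) aut_mult[OF aut poly_in_w_B[OF r'(1)] nB] r(2) by (simp add: tmul_assoc)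
  moreover have "n \<noteq> 0" using n_eq by simp
  ultimately have "\<phi> r' \<star> r = 1" using tmul_right_cancel[of n "\<phi> r' \<star> r" 1] by simp
  then have "r \<star> \<phi> r' = 1" using poly_in_w_central[OF r(1)] by simp
  from poly_in_w_unit[OF r(1) aut_poly_in_w[OF aut r'(1)] this] show thesis using that r(2) by metis
qed

text \<open>
  The images of \<open>z\<close>, \<open>s\<close>, \<open>t\<close> are normal, so each has an exponent vector. From \<open>s t = q t s\<close> the
  \<open>(s, t)\<close>-exponents of \<open>\<phi>(s)\<close> and \<open>\<phi>(t)\<close> have determinant one, and as \<open>\<phi>(z)\<close> commutes with both, its
  \<open>(s, t)\<close>-exponents vanish. The same holds for the inverse, and the composition being the identity
  leaves only scalings.
\<close>

lemma aut_ZST: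
  assumes aut: "B_aut \<phi>"
  obtains \<beta> \<gamma> \<zeta> where "\<beta> \<noteq> 0" "\<gamma> \<noteq> 0" "\<zeta> \<noteq> 0" "\<phi> tS = scal \<beta> \<star> tS" "\<phi> tT = scal \<gamma> \<star> tT" "\<phi> tZ = scal \<zeta> \<star> tZ"
proof -
  let ?\<psi> = "inv_into B \<phi>"
  have inv: "B_aut ?\<psi>" using aut by (rule B_aut_inv)
  have *: "\<exists>b0 b1 c1 d1 b2 c2 d2. has_expo b0 0 0 (\<theta> tZ) \<and> has_expo b1 c1 d1 (\<theta> tS) \<and> has_expo b2 c2 d2 (\<theta> tT) \<and>
     b0 \<ge> 0 \<and> b1 \<ge> 0 \<and> c1 \<ge> 0 \<and> d1 \<ge> 0 \<and> b2 \<ge> 0 \<and> c2 \<ge> 0 \<and> d2 \<ge> 0 \<and> c1 * d2 - d1 * c2 = 1"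
    if \<theta>: "B_aut \<theta>" for \<theta>
  proof -
    obtain b0 c0 d0 where 0: "b0 \<ge> 0" "c0 \<ge> 0" "d0 \<ge> 0" "has_expo b0 c0 d0 (\<theta> tZ)"
      using aut_normal_elt[OF \<theta> normal_elt_tZ] by (rule normal_elt_structure)
    obtain b1 c1 d1 where 1: "b1 \<ge> 0" "c1 \<ge> 0" "d1 \<ge> 0" "has_expo b1 c1 d1 (\<theta> tS)"
      using aut_normal_elt[OF \<theta> normal_elt_tS] by (rule normal_elt_structure)
    obtain b2 c2 d2 where 2: "b2 \<ge> 0" "c2 \<ge> 0" "d2 \<ge> 0" "has_expo b2 c2 d2 (\<theta> tT)"
      using aut_normal_elt[OF \<theta> normal_elt_tT] by (rule normal_elt_structure)
    have fac: "a = q powi n" if "scal a \<star> f = scal (q powi n) \<star> f" "f \<noteq> 0" for a n f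
    proof -
      have "scal (a - q powi n) \<star> f = 0" using that(1) by (simp flip: scal_diff)
      then show ?thesis using that(2) by (simp add: tmul_eq_0_iff)
    qed
    have nz: "\<theta> tT \<star> \<theta> tS \<noteq> 0" "\<theta> tZ \<star> \<theta> tS \<noteq> 0" "\<theta> tZ \<star> \<theta> tT \<noteq> 0"
      using aut_nz[OF \<theta>] B_Z B_S B_T tZ_nz tS_nz tT_nz by (simp_all add: tmul_eq_0_iff)
    have "\<theta> tS \<star> \<theta> tT = scal q \<star> (\<theta> tT \<star> \<theta> tS)"
      using arg_cong[OF rel_ST, of \<theta>] by (simp add: aut_mult[OF \<theta>] aut_scal[OF \<theta>] B_mult B_scal B_S B_T)
    then have "q = q powi (c1 * d2 - d1 * c2)"
      using has_expo_commute[OF 1(4) 2(4)] fac nz(1) by metis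
    then have det: "c1 * d2 - d1 * c2 = 1" using powi_inj[OF q0 q_gen, of 1 "c1 * d2 - d1 * c2"] by simp
    have "\<theta> tS \<star> \<theta> tZ = scal 1 \<star> (\<theta> tZ \<star> \<theta> tS)"
      using arg_cong[OF rel_SZ, of \<theta>] by (simp add: aut_mult[OF \<theta>] B_Z B_S)
    then have "1 = q powi (c1 * d0 - d1 * c0)"
      using has_expo_commute[OF 1(4) 0(4)] fac nz(2) by metis
    then have e1: "c1 * d0 = d1 * c0" using q_powi[of "c1 * d0 - d1 * c0"] by simp
    have "\<theta> tT \<star> \<theta> tZ = scal 1 \<star> (\<theta> tZ \<star> \<theta> tT)"
      using arg_cong[OF rel_TZ, of \<theta>] by (simp add: aut_mult[OF \<theta>] B_Z B_T)
    then have "1 = q powi (c2 * d0 - d2 * c0)"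
      using has_expo_commute[OF 2(4) 0(4)] fac nz(3) by metis
    then have e2: "c2 * d0 = d2 * c0" using q_powi[of "c2 * d0 - d2 * c0"] by simp
    have "c0 * (c1 * d2 - d1 * c2) = 0" "d0 * (c1 * d2 - d1 * c2) = 0"
    proof -
      have "c0 * (c1 * d2 - d1 * c2) = c1 * (d2 * c0) - c2 * (d1 * c0)" by (simp add: algebra_simps)
      also have "\<dots> = c1 * (c2 * d0) - c2 * (c1 * d0)" unfolding e1 e2 ..
      finally show "c0 * (c1 * d2 - d1 * c2) = 0" by (simp add: algebra_simps)
      have "d0 * (c1 * d2 - d1 * c2) = d2 * (c1 * d0) - d1 * (c2 * d0)" by (simp add: algebra_simps)
      also have "\<dots> = d2 * (d1 * c0) - d1 * (d2 * c0)" unfolding e1 e2 ..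
      finally show "d0 * (c1 * d2 - d1 * c2) = 0" by (simp add: algebra_simps)
    qed
    then have "c0 = 0" "d0 = 0" using det by simp_all
    then show ?thesis using 0 1 2 det by blast
  qed
  obtain b0 b1 c1 d1 b2 c2 d2 where F: "has_expo b0 0 0 (\<phi> tZ)" "has_expo b1 c1 d1 (\<phi> tS)" "has_expo b2 c2 d2 (\<phi> tT)"
    and Fn: "b0 \<ge> 0" "b1 \<ge> 0" "c1 \<ge> 0" "d1 \<ge> 0" "b2 \<ge> 0" "c2 \<ge> 0" "d2 \<ge> 0" and Fd: "c1 * d2 - d1 * c2 = 1"
    using *[OF aut] by blast
  obtain b0' b1' c1' d1' b2' c2' d2' where G: "has_expo b0' 0 0 (?\<psi> tZ)" "has_expo b1' c1' d1' (?\<psi> tS)" "has_expo b2' c2' d2' (?\<psi> tT)"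
    and Gn: "b0' \<ge> 0" "b1' \<ge> 0" "c1' \<ge> 0" "d1' \<ge> 0" "b2' \<ge> 0" "c2' \<ge> 0" "d2' \<ge> 0" and Gd: "c1' * d2' - d1' * c2' = 1"
    using *[OF inv] by blast
  have rt: "\<phi> (?\<psi> f) = f" "?\<psi> (\<phi> f) = f" if "f \<in> B" for f
    using aut that unfolding B_aut_def by (metis bij_betw_inv_into_right, metis bij_betw_inv_into_left)
  have eZ: "has_expo 1 0 0 tZ" and eS: "has_expo 0 1 0 tS" and eT: "has_expo 0 0 1 tT"
    unfolding tZ_def tS_def tT_def by (rule has_expo_monom1)+
  have eZf: "has_expo 1 0 0 (\<phi> (?\<psi> tZ))" and eSf: "has_expo 0 1 0 (\<phi> (?\<psi> tS))" and eTf: "has_expo 0 0 1 (\<phi> (?\<psi> tT))"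
    and eSg: "has_expo 0 1 0 (?\<psi> (\<phi> tS))" and eTg: "has_expo 0 0 1 (?\<psi> (\<phi> tT))"
    using eZ eS eT by (simp_all add: rt B_Z B_S B_T)
  have "b0' * b0 = 1"
    using has_expo_unique[OF aut_expo[OF aut F G(1)] eZf] Gn by simp
  then have b0: "b0 = 1" "b0' = 1" using Fn Gn by (auto simp: zmult_eq_1_iff)
  have s: "b1' * b0 + c1' * b1 + d1' * b2 = 0" "c1' * c1 + d1' * c2 = 1" "c1' * d1 + d1' * d2 = 0"
    using has_expo_unique[OF aut_expo[OF aut F G(2)] eSf] Gn by simp_all
  have t: "b2' * b0 + c2' * b1 + d2' * b2 = 0" "c2' * c1 + d2' * c2 = 0" "c2' * d1 + d2' * d2 = 1"
    using has_expo_unique[OF aut_expo[OF aut F G(3)] eTf] Gn by simp_all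
  have s': "b1 * b0' + c1 * b1' + d1 * b2' = 0" "c1 * c1' + d1 * c2' = 1" "c1 * d1' + d1 * d2' = 0"
    using has_expo_unique[OF aut_expo[OF inv G F(2)] eSg] Fn by simp_all
  have t': "b2 * b0' + c2 * b1' + d2 * b2' = 0" "c2 * c1' + d2 * c2' = 0" "c2 * d1' + d2 * d2' = 1"
    using has_expo_unique[OF aut_expo[OF inv G F(3)] eTg] Fn by simp_all
  have f: "b1 = 0 \<and> c1 = 1 \<and> d1 = 0 \<and> b2 = 0 \<and> c2 = 0 \<and> d2 = 1"
    using Fn Gn Fd s t by (intro nonneg_unimodular[of c1 d1 c2 d2 b1 b2 c1' d1' c2' d2' b1' b2' b0]) auto
  have g: "b1' = 0 \<and> c1' = 1 \<and> d1' = 0 \<and> b2' = 0 \<and> c2' = 0 \<and> d2' = 1"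
    using Fn Gn Gd s' t' by (intro nonneg_unimodular[of c1' d1' c2' d2' b1' b2' c1 d1 c2 d2 b1 b2 b0']) auto
  obtain \<zeta> where 1: "\<zeta> \<noteq> 0" "\<phi> tZ = scal \<zeta> \<star> tZ"
    using F(1) G(1) unfolding b0 by (rule aut_scale_single[OF aut tZ_def B_Z])
  have FG: "has_expo 0 1 0 (\<phi> tS)" "has_expo 0 0 1 (\<phi> tT)" "has_expo 0 1 0 (?\<psi> tS)" "has_expo 0 0 1 (?\<psi> tT)"
    using F(2,3) G(2,3) f g by simp_all
  obtain \<beta> where 2: "\<beta> \<noteq> 0" "\<phi> tS = scal \<beta> \<star> tS"
    using FG(1,3) by (rule aut_scale_single[OF aut tS_def B_S])
  obtain \<gamma> where 3: "\<gamma> \<noteq> 0" "\<phi> tT = scal \<gamma> \<star> tT"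
    using FG(2,4) by (rule aut_scale_single[OF aut tT_def B_T])
  show thesis using that 1 2 3 by blast
qed

lemma factor_keys:
  assumes "f \<star> monom1 v = scal a \<star> (monom1 v \<star> f)" "u \<in> keys f"
  shows "chi u v = a * chi v u"
proof -
  have "lookup (f \<star> monom1 v) (u + v) = lookup (scal a \<star> (monom1 v \<star> f)) (u + v)" using assms(1) by simp
  then show ?thesis using assms(2) unfolding monom1_def by (simp add: lookup_tmul_single lookup_single_tmul in_keys_iff)
qed

text \<open>
  Commutation with \<open>z\<close>, \<open>s\<close>, \<open>t\<close> shows \<open>\<phi>(x) = f(z, w) x\<close> and \<open>\<phi>(y) = g(z, w) x^{-1}\<close>. Since \<open>\<phi>(y) \<phi>(x)\<close> is
  \<open>(\<zeta> z - 1) / (p - 1)\<close>, the leading exponents of \<open>f\<close> and \<open>g\<close> add up to that of \<open>z\<close>. But \<open>g\<close> vanishes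
  at \<open>z = 1\<close>, so it has \<open>z\<close>-degree at least one. Hence \<open>f\<close> is a constant and \<open>g\<close> a multiple of \<open>z - 1\<close>.
\<close>

lemma aut_XY:
  assumes aut: "B_aut \<phi>"
  obtains \<alpha> where "\<alpha> \<noteq> 0" "\<phi> tX = scal \<alpha> \<star> tX" "\<phi> tY = scal (inverse \<alpha>) \<star> tY"
proof -
  obtain \<beta> \<gamma> \<zeta> where nz: "\<beta> \<noteq> 0" "\<gamma> \<noteq> 0" "\<zeta> \<noteq> 0"
    and S: "\<phi> tS = scal \<beta> \<star> tS" and T: "\<phi> tT = scal \<gamma> \<star> tT" and Z: "\<phi> tZ = scal \<zeta> \<star> tZ"
    using aut by (rule aut_ZST)
  let ?X = "\<phi> tX" and ?Y = "\<phi> tY"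
  have XB: "?X \<in> B" and YB: "?Y \<in> B" using aut_B[OF aut] B_X B_Y by auto
  \<comment> \<open>As \<open>\<phi>(n)\<close> is a multiple of \<open>n\<close>, the image of \<open>f\<close> commutes with \<open>n\<close> in the same way as \<open>f\<close>.\<close>
  have push: "\<phi> f \<star> n = scal a \<star> (n \<star> \<phi> f)"
    if f: "f \<in> B" and n: "n \<in> B" "\<phi> n = scal \<nu> \<star> n" "\<nu> \<noteq> 0" and r: "f \<star> n = scal a \<star> (n \<star> f)" for f n \<nu> a
  proof -
    have "\<phi> f \<star> (scal \<nu> \<star> n) = scal a \<star> ((scal \<nu> \<star> n) \<star> \<phi> f)"
      using arg_cong[OF r, of \<phi>] f n by (simp add: aut_mult[OF aut] aut_scal[OF aut] B_mult B_scal)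
    then have "scal \<nu> \<star> (\<phi> f \<star> n) = scal \<nu> \<star> (scal a \<star> (n \<star> \<phi> f))"
      by (simp add: scal_left_commute[of "\<phi> f"] tmul_assoc scal_scal mult.commute)
    then have "scal (inverse \<nu>) \<star> (scal \<nu> \<star> (\<phi> f \<star> n)) = scal (inverse \<nu>) \<star> (scal \<nu> \<star> (scal a \<star> (n \<star> \<phi> f)))"
      by (rule arg_cong)
    then show ?thesis using n(3) by (simp add: scal_scal mult.assoc[symmetric])
  qed
  have rel: "tX \<star> tS = scal (inverse l) \<star> (tS \<star> tX)" "tX \<star> tT = scal (inverse m) \<star> (tT \<star> tX)"
    "tY \<star> tZ = scal (inverse p) \<star> (tZ \<star> tY)" "tY \<star> tS = scal l \<star> (tS \<star> tY)" "tY \<star> tT = scal m \<star> (tT \<star> tY)"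
    unfolding rel_SX rel_TX rel_ZY rel_SY rel_TY using l0 m0 p0 by (simp_all add: scal_scal)
  have shapeX: "\<exists>b\<ge>0. \<exists>e\<ge>0. u = (1, b, 0, 0, e)" if u: "u \<in> keys ?X" for u
  proof -
    obtain k b c d e where ue: "u = (k, b, c, d, e)" by (cases u)
    have "b \<ge> 0" "e \<ge> 0" using B_keysD[OF XB] u ue by auto
    moreover have k: "k = 1"
      using factor_keys[OF push[OF B_X B_Z Z nz(3) rel_XZ, unfolded tZ_def] u] powi_inj[OF p0 p_gen, of k 1] by (simp add: ue)
    moreover have "d = 0"
      using factor_keys[OF push[OF B_X B_S S nz(1) rel(1), unfolded tS_def] u] q_powi k l0 by (simp add: ue power_int_inverse)
    moreover have "c = 0"
      using factor_keys[OF push[OF B_X B_T T nz(2) rel(2), unfolded tT_def] u] q_powi k m0 by (simp add: ue power_int_inverse mult.assoc[symmetric])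
    ultimately show ?thesis using ue by blast
  qed
  have shapeY: "\<exists>b\<ge>0. \<exists>e\<ge>0. u = (-1, b, 0, 0, e)" if u: "u \<in> keys ?Y" for u
  proof -
    obtain k b c d e where ue: "u = (k, b, c, d, e)" by (cases u)
    have "b \<ge> 0" "e \<ge> 0" using B_keysD[OF YB] u ue by auto
    moreover have k: "k = -1"
      using factor_keys[OF push[OF B_Y B_Z Z nz(3) rel(3), unfolded tZ_def] u] powi_inj[OF p0 p_gen, of k "-1"]
      by (simp add: ue power_int_minus)
    moreover have "d = 0"
      using factor_keys[OF push[OF B_Y B_S S nz(1) rel(4), unfolded tS_def] u] q_powi k l0 by (simp add: ue power_int_inverse power_int_minus)
    moreover have "c = 0"
      using factor_keys[OF push[OF B_Y B_T T nz(2) rel(5), unfolded tT_def] u] q_powi k m0 by (simp add: ue power_int_inverse power_int_minus mult.assoc[symmetric])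
    ultimately show ?thesis using ue by blast
  qed
  have X0: "?X \<noteq> 0" "?Y \<noteq> 0" using aut_nz[OF aut] B_X B_Y tX_nz tY_nz by auto
  have YX: "?Y \<star> ?X = scal (inverse (p - 1)) \<star> (scal \<zeta> \<star> tZ - 1)"
    using arg_cong[OF YX, of \<phi>] Z B_X B_Y B_Z B_one B_scal
    by (simp add: aut_mult[OF aut] aut_scal[OF aut] aut_diff[OF aut] aut_1[OF aut] B_diff)
  have "lead (?Y \<star> ?X) = (0, 1, 0, 0, 0)"
  proof (rule Max_eqI)
    have look: "lookup (?Y \<star> ?X) u = inverse (p - 1) * (\<zeta> * (1 when u = (0, 1, 0, 0, 0)) - (1 when u = (0, 0, 0, 0, 0)))" for u
    proof -
      have "lookup tZ u = (1 when u = (0, 1, 0, 0, 0))" by (auto simp: tZ_def monom1_def lookup_single when_def)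
      moreover have "lookup (1 :: 'k torus) u = (1 when u = (0, 0, 0, 0, 0))" by (simp add: lookup_one expo_zero)
      ultimately show ?thesis unfolding YX lookup_scal lookup_minus by simp
    qed
    show "(0, 1, 0, 0, 0) \<in> keys (?Y \<star> ?X)"
      using nz p1 by (simp add: in_keys_iff look)
    fix u assume "u \<in> keys (?Y \<star> ?X)"
    then show "u \<le> (0, 1, 0, 0, 0)" by (auto simp: in_keys_iff look when_def split: if_splits)
  qed simp
  then have lead: "lead ?Y + lead ?X = (0, 1, 0, 0, 0)"
    using lead_tmul(2)[OF X0(2) X0(1)] by simp
  have mem: "lead ?X \<in> keys ?X" "lead ?Y \<in> keys ?Y" using X0 by (auto intro: Max_in)
  obtain bx ex where X: "bx \<ge> 0" "ex \<ge> 0" "lead ?X = (1, bx, 0, 0, ex)" using shapeX[OF mem(1)] by blast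
  obtain by' ey where Y: "by' \<ge> 0" "ey \<ge> 0" "lead ?Y = (-1, by', 0, 0, ey)" using shapeY[OF mem(2)] by blast
  have e0: "ex = 0" "ey = 0" and b1: "bx + by' = 1" using lead X Y by auto
  have leX: "u \<le> (1, bx, 0, 0, 0)" if "u \<in> keys ?X" for u using Max_ge[OF finite_keys that] X e0 by simp
  have leY: "u \<le> (-1, by', 0, 0, 0)" if "u \<in> keys ?Y" for u using Max_ge[OF finite_keys that] Y e0 by simp
  have at1Y: "(\<Sum>b. lookup ?Y (-1, b, 0, 0, e)) = 0" for e
    using B_eval_z1[OF YB, of "-1" 0 0 e] unfolding eval_z1_def by simp
  have lookY: "lookup ?Y (-1, b, 0, 0, e) = (lookup ?Y (-1, 0, 0, 0, e) when b = 0) + (lookup ?Y (-1, 1, 0, 0, e) when b = 1)" for b e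
  proof (cases "(-1, b, 0, 0, e) \<in> keys ?Y")
    case True
    then have "b \<ge> 0" "b \<le> by'" using leY[OF True] shapeY[OF True] by auto
    then have "b = 0 \<or> b = 1" using b1 X by auto
    then show ?thesis by auto
  next
    case False
    then show ?thesis by (auto simp: in_keys_iff when_def)
  qed
  have sumY: "lookup ?Y (-1, 0, 0, 0, e) + lookup ?Y (-1, 1, 0, 0, e) = 0" for e
  proof -
    have "(\<Sum>b::int. (lookup ?Y (-1, 0, 0, 0, e) when b = 0) + (lookup ?Y (-1, 1, 0, 0, e) when b = 1)) =
       lookup ?Y (-1, 0, 0, 0, e) + lookup ?Y (-1, 1, 0, 0, e)"
      by (subst Sum_any.distrib) auto
    moreover have "(\<Sum>b. lookup ?Y (-1, b, 0, 0, e)) =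
       (\<Sum>b::int. (lookup ?Y (-1, 0, 0, 0, e) when b = 0) + (lookup ?Y (-1, 1, 0, 0, e) when b = 1))"
      by (rule Sum_any.cong) (rule lookY)
    ultimately show ?thesis using at1Y[of e] by simp
  qed
  \<comment> \<open>Otherwise \<open>\<phi>(y)\<close> would have no positive power of \<open>z\<close> to cancel its constant term at \<open>z = 1\<close>.\<close>
  have by1: "by' = 1"
  proof (rule ccontr)
    assume "by' \<noteq> 1"
    then have "by' = 0" using b1 X Y by auto
    then have "lookup ?Y (-1, 1, 0, 0, ey) = 0" using leY by (force simp: in_keys_iff)
    then have "lookup ?Y (-1, 0, 0, 0, ey) = 0" using sumY[of ey] by simp
    then show False using mem(2) Y \<open>by' = 0\<close> by (simp add: in_keys_iff)
  qed
  then have bx0: "bx = 0" using b1 by simp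
  have "keys ?X \<subseteq> {(1, 0, 0, 0, 0)}"
    using shapeX leX bx0 by fastforce
  then have Xe: "?X = scal (lookup ?X (1, 0, 0, 0, 0)) \<star> tX"
    using poly_mapping_sum_single[of "{(1, 0, 0, 0, 0)}" ?X] by (simp add: tX_def flip: single_monom1)
  let ?a = "lookup ?X (1, 0, 0, 0, 0)" and ?b = "lookup ?Y (-1, 1, 0, 0, 0)"
  have Y1: "lookup ?Y (-1, 1, 0, 0, e) = 0" if "e \<noteq> 0" for e
  proof (rule ccontr)
    assume "lookup ?Y (-1, 1, 0, 0, e) \<noteq> 0"
    then have k: "(-1, 1, 0, 0, e) \<in> keys ?Y" by (simp add: in_keys_iff)
    show False using leY[OF k] shapeY[OF k] by1 that by auto
  qed
  have Ye: "?Y = scal (?b * (p - 1)) \<star> tY"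
  proof (rule poly_mapping_eqI)
    fix u :: expo
    obtain k b c d e where u: "u = (k, b, c, d, e)" by (cases u)
    show "lookup ?Y u = lookup (scal (?b * (p - 1)) \<star> tY) u"
    proof (cases "k = -1 \<and> c = 0 \<and> d = 0")
      case True
      have "lookup ?Y (-1, 0, 0, 0, e) = - lookup ?Y (-1, 1, 0, 0, e)"
        using sumY[of e] by (simp add: eq_neg_iff_add_eq_0)
      then show ?thesis using True Y1[of e] p1 lookY[of b e]
        unfolding u lookup_scal lookup_tY by (cases "e = 0"; cases "b = 0"; cases "b = 1") auto
    next
      case False
      then have "u \<notin> keys ?Y" using shapeY[of u] u by auto
      then show ?thesis using False unfolding u lookup_scal lookup_tY by (auto simp: in_keys_iff)
    qed
  qed
  have "scal (?a * (?b * (p - 1))) = (1 :: 'k torus)"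
  proof -
    have "?X \<star> ?Y - scal p \<star> (?Y \<star> ?X) = 1"
      using arg_cong[OF rel_XY, of \<phi>] B_X B_Y B_scal B_mult
      by (simp add: aut_mult[OF aut] aut_scal[OF aut] aut_diff[OF aut] aut_1[OF aut])
    moreover have "?X \<star> ?Y = scal (?a * (?b * (p - 1))) \<star> (tX \<star> tY)"
      by (subst Xe, subst Ye) (simp add: tmul_assoc scal_left_commute[of tX] scal_scal)
    moreover have "?Y \<star> ?X = scal (?a * (?b * (p - 1))) \<star> (tY \<star> tX)"
      by (subst Xe, subst Ye) (simp add: tmul_assoc scal_left_commute[of tY] scal_scal mult_ac)
    ultimately have "scal (?a * (?b * (p - 1))) \<star> (tX \<star> tY - scal p \<star> (tY \<star> tX)) = 1"
      by (simp add: tmul_diff scal_scal mult_ac)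
    then show ?thesis by (simp add: rel_XY)
  qed
  then have ab: "?a * (?b * (p - 1)) = 1"
    by (metis lookup_one_zero lookup_single_eq)
  then have "?a \<noteq> 0" "?b * (p - 1) = inverse ?a" by (auto simp: inverse_unique)
  then show thesis using that Xe Ye by metis
qed

end

section \<open>The presented algebra and its monomial basis\<close>

lemma ring_of_type_algebra_ring: "ring (ring_of_type_algebra :: 'a::ring_1 ring)"
proof -
  have "\<exists>y. x + y = 0" for x :: 'a
    using add.right_inverse by blast
  thus ?thesis
    unfolding ring_of_type_algebra_def using add.right_inverse
    by unfold_locales (auto simp: algebra_simps Units_def)
qed

lemma ring_of_type_algebra_simps [simp]:
  "carrier (ring_of_type_algebra :: 'a::ring_1 ring) = UNIV"
  "x \<otimes>\<^bsub>(ring_of_type_algebra :: 'a::ring_1 ring)\<^esub> y = x * y"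
  "x \<oplus>\<^bsub>(ring_of_type_algebra :: 'a::ring_1 ring)\<^esub> y = x + y"
  "\<one>\<^bsub>(ring_of_type_algebra :: 'a::ring_1 ring)\<^esub> = 1"
  "\<zero>\<^bsub>(ring_of_type_algebra :: 'a::ring_1 ring)\<^esub> = 0"
  by (simp_all add: ring_of_type_algebra_def)

lemma rel_ideal_ideal: "ideal (rel_ideal R) (ring_of_type_algebra :: ('g, 'k::field) free_alg ring)"
  unfolding rel_ideal_def by (rule ring.genideal_ideal[OF ring_of_type_algebra_ring]) simp

context
  fixes R :: "('g, 'k::field) free_alg set"
begin

interpretation ideal "rel_ideal R" "ring_of_type_algebra :: ('g, 'k) free_alg ring"
  by (rule rel_ideal_ideal)

lemma rel_ideal_subset: "R \<subseteq> rel_ideal R"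
  unfolding rel_ideal_def by (rule genideal_self) simp

lemma rel_ideal_0: "0 \<in> rel_ideal R"
  using additive_subgroup.zero_closed[OF additive_subgroup_axioms] by simp

lemma rel_ideal_add: "f \<in> rel_ideal R \<Longrightarrow> g \<in> rel_ideal R \<Longrightarrow> f + g \<in> rel_ideal R"
  using additive_subgroup.a_closed[OF additive_subgroup_axioms, of f g] by simp

lemma rel_ideal_mult_left: "f \<in> rel_ideal R \<Longrightarrow> h * f \<in> rel_ideal R"
  using I_l_closed[of f h] by simp

lemma rel_ideal_mult_right: "f \<in> rel_ideal R \<Longrightarrow> f * h \<in> rel_ideal R"
  using I_r_closed[of f h] by simp

lemma rel_ideal_diff: "f \<in> rel_ideal R \<Longrightarrow> g \<in> rel_ideal R \<Longrightarrow> f - g \<in> rel_ideal R"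
  using rel_ideal_add[of f "(- 1) * g"] rel_ideal_mult_left[of g "- 1"] by simp

lemma pres_class_eq: "pres_class R f = pres_class R g \<longleftrightarrow> f - g \<in> rel_ideal R"
proof
  assume "pres_class R f = pres_class R g"
  then have "f \<in> pres_class R g"
    using a_rcos_self[of f] by (simp add: pres_class_def)
  then obtain h where "h \<in> rel_ideal R" "f = h + g"
    unfolding pres_class_def by (auto simp: a_r_coset_def')
  then show "f - g \<in> rel_ideal R" by simp
next
  assume *: "f - g \<in> rel_ideal R"
  have "f \<in> pres_class R g"
    unfolding pres_class_def a_r_coset_def' by (auto intro!: bexI[OF _ *])
  then show "pres_class R f = pres_class R g"
    unfolding pres_class_def using a_repr_independence'[of f g] by simp
qed

lemma pres_alg_simps:
  "carrier (pres_alg R) = range (pres_class R)"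
  "pres_class R f \<otimes>\<^bsub>pres_alg R\<^esub> pres_class R g = pres_class R (f * g)"
  "pres_class R f \<oplus>\<^bsub>pres_alg R\<^esub> pres_class R g = pres_class R (f + g)"
  "\<one>\<^bsub>pres_alg R\<^esub> = pres_class R 1"
  "\<zero>\<^bsub>pres_alg R\<^esub> = pres_class R 0"
  "c \<odot>\<^bsub>pres_alg R\<^esub> pres_class R f = pres_class R (free_scalar c * f)"
proof -
  show "carrier (pres_alg R) = range (pres_class R)"
    by (auto simp: pres_alg_def Let_def FactRing_def A_RCOSETS_def' pres_class_def)
  show "pres_class R f \<otimes>\<^bsub>pres_alg R\<^esub> pres_class R g = pres_class R (f * g)" for f g
    using rcoset_mult_add[of f g] by (simp add: pres_alg_def Let_def FactRing_def pres_class_def)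
  then show "c \<odot>\<^bsub>pres_alg R\<^esub> pres_class R f = pres_class R (free_scalar c * f)"
    by (simp add: pres_alg_def Let_def)
  show "pres_class R f \<oplus>\<^bsub>pres_alg R\<^esub> pres_class R g = pres_class R (f + g)"
    using a_rcos_sum[of f g] by (simp add: pres_alg_def Let_def FactRing_def pres_class_def)
  show "\<one>\<^bsub>pres_alg R\<^esub> = pres_class R 1"
    by (simp add: pres_alg_def Let_def FactRing_def pres_class_def)
  have "rel_ideal R +>\<^bsub>ring_of_type_algebra\<^esub> 0 = rel_ideal R"
    by (auto simp: a_r_coset_def')
  then show "\<zero>\<^bsub>pres_alg R\<^esub> = pres_class R 0"
    by (simp add: pres_alg_def Let_def FactRing_def pres_class_def)
qed

lemma pres_alg_ring: "ring (pres_alg R)"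
proof (rule ringI)
  show "abelian_group (pres_alg R)"
  proof (rule abelian_groupI)
    fix u assume "u \<in> carrier (pres_alg R)"
    then obtain f where "u = pres_class R f" by (auto simp: pres_alg_simps)
    then show "\<exists>v\<in>carrier (pres_alg R). v \<oplus>\<^bsub>pres_alg R\<^esub> u = \<zero>\<^bsub>pres_alg R\<^esub>"
      by (intro bexI[of _ "pres_class R (- f)"]) (auto simp: pres_alg_simps)
  qed (auto simp: pres_alg_simps add_ac)
  show "Group.monoid (pres_alg R)"
    by (rule monoidI) (auto simp: pres_alg_simps mult.assoc)
qed (auto simp: pres_alg_simps algebra_simps)

end

lemma free_scalar_central: "free_scalar c * f = f * free_scalar c"
proof -
  have "(\<Sum>w\<in>keys f. free_scalar c * single w (lookup f w)) = (\<Sum>w\<in>keys f. single w (lookup f w) * free_scalar c)"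
    by (simp add: free_scalar_def mult_single mult.commute)
  then show ?thesis
    by (simp add: sum_distrib_left[symmetric] sum_distrib_right[symmetric] poly_mapping_sum_single)
qed

lemma free_scalar_mult: "free_scalar a * free_scalar b = free_scalar (a * b)"
  by (simp add: free_scalar_def mult_single)

lemma free_scalar_add: "free_scalar a + free_scalar b = free_scalar (a + b)"
  by (simp add: free_scalar_def single_add)

lemma free_scalar_1: "free_scalar 1 = 1" and free_scalar_0: "free_scalar 0 = 0"
  by (simp_all add: free_scalar_def)

text \<open>
  Words are built by prefixing generators, so left multiplication by generators is enough.
\<close>

lemma free_alg_induct [case_names scalar gen add]:
  fixes f :: "('g, 'k::field) free_alg"
  assumes "\<And>c. P (free_scalar c)" "\<And>g f. P f \<Longrightarrow> P (free_gen g * f)" "\<And>f g. P f \<Longrightarrow> P g \<Longrightarrow> P (f + g)"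
  shows "P f"
proof -
  have w: "P (single w c)" for w :: "'g word" and c
  proof (cases w)
    case (Word gs)
    have "P (single (Word gs) c)"
    proof (induction gs)
      case Nil
      then show ?case using assms(1)[of c] by (simp add: free_scalar_def zero_word_def)
    next
      case (Cons g gs)
      have "free_gen g * single (Word gs) c = single (Word (g # gs)) c"
        by (simp add: free_gen_def mult_single plus_word_def)
      then show ?case using assms(2)[OF Cons, of g] by simp
    qed
    then show ?thesis using Word by simp
  qed
  have "P (\<Sum>w\<in>K. single w (lookup f w))" if "finite K" for K
    using that
  proof induction
    case empty
    then show ?case using assms(1)[of 0] by (simp add: free_scalar_0)
  qed (simp add: assms(3) w)
  from this[of "keys f"] show ?thesis by (simp add: poly_mapping_sum_single)
qed

context qweyl_torus
begin

fun gen_im :: "gen \<Rightarrow> 'k torus" where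
  "gen_im Gx = tX" | "gen_im Gy = tY" | "gen_im Gs = tS" | "gen_im Gt = tT"

primrec word_im :: "gen list \<Rightarrow> 'k torus" where
  "word_im [] = 1" | "word_im (g # gs) = gen_im g \<star> word_im gs"

lemma word_im_append: "word_im (u @ v) = word_im u \<star> word_im v"
  by (induction u) (simp_all add: tmul_assoc)

definition torus_hom :: "(gen, 'k) free_alg \<Rightarrow> 'k torus" where
  "torus_hom f = (\<Sum>w\<in>keys f. scal (lookup f w) \<star> word_im (letters w))"

lemma torus_hom_superset: "finite K \<Longrightarrow> keys f \<subseteq> K \<Longrightarrow> torus_hom f = (\<Sum>w\<in>K. scal (lookup f w) \<star> word_im (letters w))"
  unfolding torus_hom_def by (rule sum.mono_neutral_left) (auto simp: in_keys_iff)

lemma torus_hom_0 [simp]: "torus_hom 0 = 0" by (simp add: torus_hom_def)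

lemma torus_hom_add: "torus_hom (f + g) = torus_hom f + torus_hom g"
  using torus_hom_superset[of "keys f \<union> keys g" f] torus_hom_superset[of "keys f \<union> keys g" g]
    torus_hom_superset[of "keys f \<union> keys g" "f + g"] keys_add[of f g]
  by (simp add: lookup_add single_add tmul_add_left sum.distrib)

lemma torus_hom_sum: "torus_hom (sum f K) = (\<Sum>i\<in>K. torus_hom (f i))"
  by (induction K rule: infinite_finite_induct) (simp_all add: torus_hom_add)

lemma torus_hom_single: "torus_hom (single w c) = scal c \<star> word_im (letters w)"
  using torus_hom_superset[of "{w}" "single w c"] by simp

lemma torus_hom_mult: "torus_hom (f * g) = torus_hom f \<star> torus_hom g"
proof -
  let ?S = "\<lambda>f :: (gen, 'k) free_alg. (\<Sum>w\<in>keys f. single w (lookup f w))"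
  have "torus_hom (?S f * ?S g) = torus_hom (?S f) \<star> torus_hom (?S g)"
    unfolding sum_product torus_hom_sum tmul_sum_left tmul_sum_right
    by (rule trans[OF sum.swap], intro sum.cong refl)
      (simp add: mult_single torus_hom_single plus_word_def word_im_append tmul_assoc
        scal_left_commute[of "word_im u" for u] scal_scal[symmetric] flip: scal_mult)
  then show ?thesis by (simp add: poly_mapping_sum_single)
qed

lemma torus_hom_scalar: "torus_hom (free_scalar c) = scal c"
  by (simp add: free_scalar_def torus_hom_single zero_word_def)

lemma torus_hom_gen: "torus_hom (free_gen g) = gen_im g"
  by (simp add: free_gen_def torus_hom_single)

lemma torus_hom_1: "torus_hom 1 = 1"
  using torus_hom_scalar[of 1] by (simp add: free_scalar_1)

lemma torus_hom_diff: "torus_hom (f - g) = torus_hom f - torus_hom g"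
  using torus_hom_add[of "f - g" g] by simp

abbreviation "rels \<equiv> qweyl_rels p l m q"

lemma torus_hom_rel_ideal: "f \<in> rel_ideal rels \<Longrightarrow> torus_hom f = 0"
proof -
  let ?F = "ring_of_type_algebra :: (gen, 'k) free_alg ring"
  have F: "ring ?F" by (rule ring_of_type_algebra_ring)
  have inv: "\<ominus>\<^bsub>?F\<^esub> f = - f" for f
    using ring.ring_simprules(17)[OF F] by (intro abelian_group.minus_equality[OF ring.is_abelian_group[OF F]]) auto
  have "ideal {f. torus_hom f = 0} ?F"
  proof (rule idealI[OF F])
    show "subgroup {f. torus_hom f = 0} (add_monoid ?F)"
    proof (rule group.subgroupI)
      show "Group.group (add_monoid ?F)"
        using abelian_group.a_group[OF ring.is_abelian_group[OF F]] .
      show "inv\<^bsub>add_monoid ?F\<^esub> a \<in> {f. torus_hom f = 0}" if "a \<in> {f. torus_hom f = 0}" for a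
        using that inv[of a] torus_hom_diff[of 0 a] by (simp add: a_inv_def)
    qed (auto simp: torus_hom_add intro: exI[of _ 0])
  qed (auto simp: torus_hom_mult)
  moreover have "rels \<subseteq> {f. torus_hom f = 0}"
    using rel_XY rel_ST rel_SX rel_SY rel_TX rel_TY
    by (auto simp: qweyl_rels_def Let_def torus_hom_diff torus_hom_mult torus_hom_gen torus_hom_scalar torus_hom_1 tmul_assoc)
  ultimately have "rel_ideal rels \<subseteq> {f. torus_hom f = 0}"
    unfolding rel_ideal_def by (rule ring.genideal_minimal[OF F])
  then show "f \<in> rel_ideal rels \<Longrightarrow> torus_hom f = 0" by blast
qed

text \<open>
  Equality in \<open>A\<close>, expressed on representatives so that calculations take place in the free algebra.
\<close>

definition cong :: "(gen, 'k) free_alg \<Rightarrow> (gen, 'k) free_alg \<Rightarrow> bool" (infix "\<doteq>" 50) where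
  "f \<doteq> g \<longleftrightarrow> f - g \<in> rel_ideal rels"

lemma cong_refl: "f \<doteq> f" by (simp add: cong_def rel_ideal_0)

lemma cong_trans [trans]: "f \<doteq> g \<Longrightarrow> g \<doteq> h \<Longrightarrow> f \<doteq> h"
  unfolding cong_def using rel_ideal_add[of "f - g" rels "g - h"] by simp

lemma cong_add: "f \<doteq> g \<Longrightarrow> f' \<doteq> g' \<Longrightarrow> f + f' \<doteq> g + g'"
  unfolding cong_def using rel_ideal_add[of "f - g" rels "f' - g'"] by (simp add: algebra_simps)

lemma cong_left: "f \<doteq> g \<Longrightarrow> h * f \<doteq> h * g"
  unfolding cong_def using rel_ideal_mult_left[of "f - g" rels h] by (simp add: algebra_simps)

lemma cong_right: "f \<doteq> g \<Longrightarrow> f * h \<doteq> g * h"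
  unfolding cong_def using rel_ideal_mult_right[of "f - g" rels h] by (simp add: algebra_simps)

abbreviation "gx \<equiv> free_gen Gx :: (gen, 'k) free_alg"
abbreviation "gy \<equiv> free_gen Gy :: (gen, 'k) free_alg"
abbreviation "gs \<equiv> free_gen Gs :: (gen, 'k) free_alg"
abbreviation "gt \<equiv> free_gen Gt :: (gen, 'k) free_alg"

lemma cong_rels:
  "gx * gy \<doteq> free_scalar p * gy * gx + 1"
  "gs * gt \<doteq> free_scalar q * gt * gs"
  "gs * gx \<doteq> free_scalar l * gx * gs"
  "gs * gy \<doteq> free_scalar (inverse l) * gy * gs"
  "gt * gx \<doteq> free_scalar m * gx * gt"
  "gt * gy \<doteq> free_scalar (inverse m) * gy * gt"
  using rel_ideal_subset[of rels] unfolding cong_def qweyl_rels_def Let_def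
  by (auto simp: algebra_simps)

lemma cong_ts: "gt * gs \<doteq> free_scalar (inverse q) * gs * gt"
proof -
  have "free_scalar (inverse q) * (free_scalar q * gt * gs - gs * gt) \<in> rel_ideal rels"
    using rel_ideal_diff[OF rel_ideal_0 cong_rels(2)[unfolded cong_def]]
    by (intro rel_ideal_mult_left) simp
  moreover have "free_scalar (inverse q) * (free_scalar q * gt * gs - gs * gt) = gt * gs - free_scalar (inverse q) * gs * gt"
    using q0 by (simp add: right_diff_distrib mult.assoc[symmetric] free_scalar_mult free_scalar_1)
  ultimately show ?thesis by (simp add: cong_def)
qed

lemma cong_power:
  assumes "g * u \<doteq> free_scalar c * u * g"
  shows "g * u ^ n \<doteq> free_scalar (c ^ n) * u ^ n * g"
proof (induction n)
  case (Suc n)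
  have "g * u ^ Suc n = (g * u) * u ^ n" by (simp add: mult.assoc)
  also have "\<dots> \<doteq> (free_scalar c * u * g) * u ^ n" by (rule cong_right[OF assms])
  also have "\<dots> = free_scalar c * u * (g * u ^ n)" by (simp add: mult.assoc)
  also have "\<dots> \<doteq> free_scalar c * u * (free_scalar (c ^ n) * u ^ n * g)" by (rule cong_left[OF Suc])
  also have "\<dots> = free_scalar c * (u * free_scalar (c ^ n)) * u ^ n * g" by (simp add: mult.assoc)
  also have "\<dots> = free_scalar (c ^ Suc n) * u ^ Suc n * g"
    unfolding free_scalar_central[of "c ^ n" u, symmetric] by (simp add: mult.assoc[symmetric] free_scalar_mult)
  finally show ?case .
qed (simp add: cong_refl free_scalar_1)

text \<open>
  The scalar \<open>a\<close> is \<open>1 + p + \<dots> + p^(n - 1)\<close>. For \<open>n = 0\<close> it is zero, which makes the truncated exponent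
  harmless.
\<close>

lemma cong_xy: "\<exists>a. gx * gy ^ n \<doteq> free_scalar (p ^ n) * gy ^ n * gx + free_scalar a * gy ^ (n - 1)"
proof (induction n)
  case 0
  then show ?case by (intro exI[of _ 0]) (simp add: cong_refl free_scalar_1 free_scalar_0)
next
  case (Suc n)
  then obtain a where a: "gx * gy ^ n \<doteq> free_scalar (p ^ n) * gy ^ n * gx + free_scalar a * gy ^ (n - 1)" by blast
  have "gx * gy ^ Suc n = (gx * gy) * gy ^ n" by (simp add: mult.assoc)
  also have "\<dots> \<doteq> (free_scalar p * gy * gx + 1) * gy ^ n" by (rule cong_right[OF cong_rels(1)])
  also have "\<dots> = free_scalar p * gy * (gx * gy ^ n) + gy ^ n" by (simp add: algebra_simps)
  also have "\<dots> \<doteq> free_scalar p * gy * (free_scalar (p ^ n) * gy ^ n * gx + free_scalar a * gy ^ (n - 1)) + gy ^ n"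
    by (intro cong_add cong_left a cong_refl)
  also have "\<dots> = free_scalar p * (gy * free_scalar (p ^ n)) * gy ^ n * gx + free_scalar p * (gy * free_scalar a) * gy ^ (n - 1) + gy ^ n"
    by (simp add: algebra_simps)
  also have "\<dots> = free_scalar (p ^ Suc n) * gy ^ Suc n * gx + free_scalar (p * a) * (gy * gy ^ (n - 1)) + gy ^ n"
    unfolding free_scalar_central[of _ gy, symmetric] by (simp add: mult.assoc[symmetric] free_scalar_mult)
  also have "\<dots> = free_scalar (p ^ Suc n) * gy ^ Suc n * gx + free_scalar (if n = 0 then 1 else p * a + 1) * gy ^ n
     + (if n = 0 then free_scalar (p * a) * gy else 0)"
    by (cases n) (simp_all add: free_scalar_1 free_scalar_add[symmetric] algebra_simps)
  finally have step: "gx * gy ^ Suc n \<doteq> free_scalar (p ^ Suc n) * gy ^ Suc n * gx + free_scalar (if n = 0 then 1 else p * a + 1) * gy ^ n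
     + (if n = 0 then free_scalar (p * a) * gy else 0)" .
  show ?case
  proof (cases "n = 0")
    case True
    then show ?thesis using cong_rels(1) by (intro exI[of _ 1]) (simp add: free_scalar_1)
  next
    case False
    then show ?thesis using step by (intro exI[of _ "p * a + 1"]) simp
  qed
qed

fun pbw_mon :: "nat \<times> nat \<times> nat \<times> nat \<Rightarrow> (gen, 'k) free_alg" where
  "pbw_mon (i, j, a, b) = gy ^ i * gx ^ j * gs ^ a * gt ^ b"

definition pbw_comb :: "(nat \<times> nat \<times> nat \<times> nat \<Rightarrow>\<^sub>0 'k) \<Rightarrow> (gen, 'k) free_alg" where
  "pbw_comb c = (\<Sum>v\<in>keys c. free_scalar (lookup c v) * pbw_mon v)"

lemma pbw_comb_superset: "finite K \<Longrightarrow> keys c \<subseteq> K \<Longrightarrow> pbw_comb c = (\<Sum>v\<in>K. free_scalar (lookup c v) * pbw_mon v)"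
  unfolding pbw_comb_def by (rule sum.mono_neutral_left) (auto simp: in_keys_iff free_scalar_0)

lemma pbw_comb_add: "pbw_comb (c + d) = pbw_comb c + pbw_comb d"
  using pbw_comb_superset[of "keys c \<union> keys d" c] pbw_comb_superset[of "keys c \<union> keys d" d]
    pbw_comb_superset[of "keys c \<union> keys d" "c + d"] keys_add[of c d]
  by (simp add: lookup_add free_scalar_add[symmetric] distrib_right sum.distrib)

lemma pbw_comb_single: "pbw_comb (single v c) = free_scalar c * pbw_mon v"
  using pbw_comb_superset[of "{v}" "single v c"] by simp

definition spanned :: "(gen, 'k) free_alg \<Rightarrow> bool" where
  "spanned f \<longleftrightarrow> (\<exists>c. f \<doteq> pbw_comb c)"

lemma spanned_add: "spanned f \<Longrightarrow> spanned g \<Longrightarrow> spanned (f + g)"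
  unfolding spanned_def using cong_add pbw_comb_add by metis

lemma spanned_cong: "f \<doteq> g \<Longrightarrow> spanned g \<Longrightarrow> spanned f"
  unfolding spanned_def using cong_trans by blast

lemma spanned_mon: "spanned (free_scalar c * pbw_mon v)"
  unfolding spanned_def using pbw_comb_single cong_refl by metis

lemma spanned_sum: "(\<And>i. i \<in> K \<Longrightarrow> spanned (f i)) \<Longrightarrow> spanned (sum f K)"
proof (induction K rule: infinite_finite_induct)
  case empty
  then show ?case using spanned_mon[of 0] by (simp add: free_scalar_0)
next
  case (infinite K)
  then show ?case using spanned_mon[of 0] by (simp add: free_scalar_0)
qed (simp add: spanned_add)

text \<open>
  Moving a generator past the powers to its left only produces scalars, except for \<open>x\<close> past \<open>y^i\<close>, where
  a second monomial appears. So the span of the monomials \<open>y^i x^j s^a t^b\<close> is a left ideal modulo the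
  relations.
\<close>

lemma gen_mon: "\<exists>c. free_gen g * pbw_mon v \<doteq> pbw_comb c"
proof -
  obtain i j a b where v: "v = (i, j, a, b)" by (cases v)
  have move: "h * (u ^ n * r) \<doteq> free_scalar (c ^ n) * (u ^ n * (h * r))" if "h * u \<doteq> free_scalar c * u * h" for h u n r c
    using cong_right[OF cong_power[OF that, of n], of r] by (simp add: mult.assoc)
  have pull: "u * (free_scalar c * f) = free_scalar c * (u * f)" for u f c
    by (metis free_scalar_central mult.assoc)
  have "spanned (free_gen g * pbw_mon v)"
  proof (cases g)
    case Gy
    then have "free_gen g * pbw_mon v = free_scalar 1 * pbw_mon (Suc i, j, a, b)"
      by (simp add: v mult.assoc free_scalar_1)
    then show ?thesis using spanned_mon by metis
  next
    case Gx
    obtain e where e: "gx * gy ^ i \<doteq> free_scalar (p ^ i) * gy ^ i * gx + free_scalar e * gy ^ (i - 1)"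
      using cong_xy by blast
    have "free_gen g * pbw_mon v = gx * gy ^ i * (gx ^ j * gs ^ a * gt ^ b)"
      by (simp add: v Gx mult.assoc)
    also have "\<dots> \<doteq> (free_scalar (p ^ i) * gy ^ i * gx + free_scalar e * gy ^ (i - 1)) * (gx ^ j * gs ^ a * gt ^ b)"
      by (rule cong_right[OF e])
    also have "\<dots> = free_scalar (p ^ i) * pbw_mon (i, Suc j, a, b) + free_scalar e * pbw_mon (i - 1, j, a, b)"
      by (simp add: mult.assoc distrib_right)
    finally show ?thesis using spanned_cong spanned_add spanned_mon by blast
  next
    case Gs
    have "free_gen g * pbw_mon v = gs * (gy ^ i * (gx ^ j * (gs ^ a * gt ^ b)))"
      by (simp add: v Gs mult.assoc)
    also have "\<dots> \<doteq> free_scalar (inverse l ^ i) * (gy ^ i * (gs * (gx ^ j * (gs ^ a * gt ^ b))))"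
      by (rule move[OF cong_rels(4)])
    also have "\<dots> \<doteq> free_scalar (inverse l ^ i) * (gy ^ i * (free_scalar (l ^ j) * (gx ^ j * (gs * (gs ^ a * gt ^ b)))))"
      by (intro cong_left move cong_rels(3))
    also have "\<dots> = free_scalar (inverse l ^ i) * (free_scalar (l ^ j) * pbw_mon (i, j, Suc a, b))"
      by (simp add: pull[of "gy ^ i"] mult.assoc)
    also have "\<dots> = free_scalar (inverse l ^ i * l ^ j) * pbw_mon (i, j, Suc a, b)"
      by (simp only: mult.assoc[symmetric] free_scalar_mult)
    finally show ?thesis using spanned_cong spanned_mon by blast
  next
    case Gt
    have "free_gen g * pbw_mon v = gt * (gy ^ i * (gx ^ j * (gs ^ a * gt ^ b)))"
      by (simp add: v Gt mult.assoc)
    also have "\<dots> \<doteq> free_scalar (inverse m ^ i) * (gy ^ i * (gt * (gx ^ j * (gs ^ a * gt ^ b))))"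
      by (rule move[OF cong_rels(6)])
    also have "\<dots> \<doteq> free_scalar (inverse m ^ i) * (gy ^ i * (free_scalar (m ^ j) * (gx ^ j * (gt * (gs ^ a * gt ^ b)))))"
      by (intro cong_left move cong_rels(5))
    also have "\<dots> \<doteq> free_scalar (inverse m ^ i) * (gy ^ i * (free_scalar (m ^ j) * (gx ^ j * (free_scalar (inverse q ^ a) * (gs ^ a * (gt * gt ^ b))))))"
      by (intro cong_left move cong_ts)
    also have "\<dots> = free_scalar (inverse m ^ i) * (free_scalar (m ^ j) * (free_scalar (inverse q ^ a) * pbw_mon (i, j, a, Suc b)))"
      by (simp add: pull[of "gy ^ i"] pull[of "gx ^ j"] mult.assoc)
    also have "\<dots> = free_scalar (inverse m ^ i * (m ^ j * inverse q ^ a)) * pbw_mon (i, j, a, Suc b)"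
      by (simp only: mult.assoc[symmetric] free_scalar_mult)
    finally show ?thesis using spanned_cong spanned_mon by blast
  qed
  then show ?thesis by (simp add: spanned_def)
qed

lemma all_spanned: "spanned f"
proof (induction f rule: free_alg_induct)
  case (scalar c)
  then show ?case using spanned_mon[of c "(0, 0, 0, 0)"] by simp
next
  case (add f g)
  then show ?case by (rule spanned_add)
next
  case (gen g f)
  then obtain c where "f \<doteq> pbw_comb c" by (auto simp: spanned_def)
  then have "free_gen g * f \<doteq> free_gen g * pbw_comb c" by (rule cong_left)
  moreover have "spanned (free_gen g * pbw_comb c)"
    unfolding pbw_comb_def sum_distrib_left
  proof (rule spanned_sum)
    fix v
    obtain d where d: "free_gen g * pbw_mon v \<doteq> pbw_comb d" using gen_mon by blast
    have "free_gen g * (free_scalar (lookup c v) * pbw_mon v) = free_scalar (lookup c v) * (free_gen g * pbw_mon v)"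
      by (metis free_scalar_central mult.assoc)
    also have "\<dots> \<doteq> free_scalar (lookup c v) * pbw_comb d" by (rule cong_left[OF d])
    also have "\<dots> = (\<Sum>u\<in>keys d. free_scalar (lookup c v * lookup d u) * pbw_mon u)"
      by (simp add: pbw_comb_def sum_distrib_left mult.assoc[symmetric] free_scalar_mult)
    finally show "spanned (free_gen g * (free_scalar (lookup c v) * pbw_mon v))"
      by (rule spanned_cong) (intro spanned_sum spanned_mon)
  qed
  ultimately show ?case by (rule spanned_cong)
qed

lemma lead_tY: "lead tY = (-1, 1, 0, 0, 0)"
proof (rule Max_eqI)
  show "(-1, 1, 0, 0, 0) \<in> keys tY" using p1 by (simp add: in_keys_iff lookup_tY)
  fix u assume "u \<in> keys tY"
  then show "u \<le> (-1, 1, 0, 0, 0)" by (auto simp: in_keys_iff lookup_tY when_def split: if_splits)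
qed simp

lemma lead_monom1: "lead (monom1 u) = u"
  by (simp add: monom1_def)

lemma lead_pbw_mon: "torus_hom (pbw_mon (i, j, a, b)) \<noteq> 0 \<and> lead (torus_hom (pbw_mon (i, j, a, b))) = (int j - int i, int i, int a, int b, 0)"
proof -
  have pow: "torus_hom (free_gen g ^ n) \<noteq> 0 \<and> lead (torus_hom (free_gen g ^ n)) = (int n * k, int n * b, int n * c, int n * d, 0)"
    if "gen_im g \<noteq> 0" "lead (gen_im g) = (k, b, c, d, 0)" for g n k b c d
  proof (induction n)
    case 0
    have "lead (1 :: 'k torus) = (0, 0, 0, 0, 0)" by (simp add: expo_zero)
    then show ?case by (simp add: torus_hom_1)
  next
    case (Suc n)
    then show ?case
      using that lead_tmul(1,2)[of "gen_im g" "torus_hom (free_gen g ^ n)"] by (simp add: torus_hom_mult torus_hom_gen algebra_simps)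
  qed
  note P = pow[of Gy "-1" 1 0 0 i] pow[of Gx 1 0 0 0 j] pow[of Gs 0 0 1 0 a] pow[of Gt 0 0 0 1 b]
  have "torus_hom (gy ^ i) \<noteq> 0 \<and> lead (torus_hom (gy ^ i)) = (- int i, int i, 0, 0, 0)"
    "torus_hom (gx ^ j) \<noteq> 0 \<and> lead (torus_hom (gx ^ j)) = (int j, 0, 0, 0, 0)"
    "torus_hom (gs ^ a) \<noteq> 0 \<and> lead (torus_hom (gs ^ a)) = (0, 0, int a, 0, 0)"
    "torus_hom (gt ^ b) \<noteq> 0 \<and> lead (torus_hom (gt ^ b)) = (0, 0, 0, int b, 0)"
    using P by (simp_all add: tY_nz lead_tY tX_def tS_def tT_def lead_monom1)
  then show ?thesis by (simp add: torus_hom_mult lead_tmul)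
qed

text \<open>
  The leading exponent of \<open>y^i x^j s^a t^b\<close> in the torus is \<open>(j - i, i, a, b, 0)\<close>, which determines \<open>i, j, a, b\<close>.
  Hence the largest of these exponents occurs in only one term and cannot cancel.
\<close>

lemma torus_hom_pbw_comb_inj: "torus_hom (pbw_comb c) = 0 \<Longrightarrow> c = 0"
proof (rule ccontr)
  assume r: "torus_hom (pbw_comb c) = 0" and c: "c \<noteq> 0"
  let ?L = "\<lambda>v. lead (torus_hom (pbw_mon v))"
  have fin: "finite (?L ` keys c)" and ne: "?L ` keys c \<noteq> {}" using c by auto
  obtain v where v: "v \<in> keys c" "?L v = Max (?L ` keys c)" using Max_in[OF fin ne] by auto
  have inj: "u = v" if "?L u = ?L v" for u
    using that lead_pbw_mon by (cases u; cases v) auto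
  have nz: "torus_hom (pbw_mon u) \<noteq> 0" for u using lead_pbw_mon by (cases u) auto
  have "lookup (torus_hom (pbw_comb c)) (?L v) = (\<Sum>u\<in>keys c. lookup c u * lookup (torus_hom (pbw_mon u)) (?L v))"
    by (simp add: pbw_comb_def torus_hom_sum torus_hom_mult torus_hom_scalar lookup_sum)
  also have "\<dots> = (\<Sum>u\<in>keys c. if u = v then lookup c v * lookup (torus_hom (pbw_mon v)) (?L v) else 0)"
  proof (intro sum.cong refl)
    fix u assume u: "u \<in> keys c"
    show "lookup c u * lookup (torus_hom (pbw_mon u)) (?L v) = (if u = v then lookup c v * lookup (torus_hom (pbw_mon v)) (?L v) else 0)"
    proof (cases "u = v")
      case False
      then have "?L u < ?L v" using inj[of u] Max_ge[OF fin, of "?L u"] u v(2) by (simp add: order.strict_iff_order) metis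
      then have "?L v \<notin> keys (torus_hom (pbw_mon u))" by (metis Max_ge finite_keys leD)
      then show ?thesis using False by (simp add: in_keys_iff)
    qed simp
  qed
  also have "\<dots> = lookup c v * lookup (torus_hom (pbw_mon v)) (?L v)" using v(1) by (simp add: sum.delta)
  finally have "lookup c v * lookup (torus_hom (pbw_mon v)) (?L v) = 0" using r by simp
  moreover have "?L v \<in> keys (torus_hom (pbw_mon v))" using nz[of v] by (intro Max_in) auto
  ultimately show False using v(1) by (simp add: in_keys_iff)
qed

text \<open>
  Modulo the relations every element is a combination of the monomials, and the torus sees the
  coefficients: \<open>A\<close> embeds into the torus.
\<close>

lemma torus_hom_kernel: "torus_hom f = 0 \<longleftrightarrow> f \<in> rel_ideal rels"
proof
  assume f: "torus_hom f = 0"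
  obtain c where c: "f \<doteq> pbw_comb c" using all_spanned unfolding spanned_def by blast
  then have "torus_hom (f - pbw_comb c) = 0" unfolding cong_def by (rule torus_hom_rel_ideal)
  then have "c = 0" using f by (intro torus_hom_pbw_comb_inj) (simp add: torus_hom_diff)
  then show "f \<in> rel_ideal rels" using c by (simp add: cong_def pbw_comb_def)
qed (rule torus_hom_rel_ideal)

lemma pres_class_eq_iff: "pres_class rels f = pres_class rels g \<longleftrightarrow> torus_hom f = torus_hom g"
  unfolding pres_class_eq torus_hom_kernel[symmetric] by (simp add: torus_hom_diff)

end

section \<open>Embedding the polynomial extension into the torus\<close>

context twisted
begin

lemma cauchy_product:
  fixes a b :: "nat \<Rightarrow> 'g \<Rightarrow>\<^sub>0 'k" and N M :: nat
  assumes "\<And>i. i > N \<Longrightarrow> a i = 0" "\<And>j. j > M \<Longrightarrow> b j = 0"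
  shows "(\<Sum>n\<le>N + M. \<Sum>i\<le>n. a i \<star> b (n - i)) = (\<Sum>i\<le>N. a i) \<star> (\<Sum>j\<le>M. b j)"
proof -
  have "(\<Sum>n\<le>N + M. \<Sum>i\<le>n. a i \<star> b (n - i)) = (\<Sum>(i, j)\<in>{(i, j). i + j \<le> N + M}. a i \<star> b j)"
    by (rule sum.triangle_reindex_eq[symmetric])
  also have "\<dots> = (\<Sum>(i, j)\<in>{..N} \<times> {..M}. a i \<star> b j)"
  proof (rule sum.mono_neutral_right)
    show "finite {(i, j). i + j \<le> N + M}"
      by (rule finite_subset[of _ "{..N + M} \<times> {..N + M}"]) auto
    show "\<forall>x\<in>{(i, j). i + j \<le> N + M} - {..N} \<times> {..M}. (case x of (i, j) \<Rightarrow> a i \<star> b j) = 0"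
    proof
      fix x assume x: "x \<in> {(i, j). i + j \<le> N + M} - {..N} \<times> {..M}"
      obtain i j where ij: "x = (i, j)" by (cases x)
      then have "i > N \<or> j > M" using x by auto
      then show "(case x of (i, j) \<Rightarrow> a i \<star> b j) = 0" using assms ij by auto
    qed
  qed auto
  also have "\<dots> = (\<Sum>i\<le>N. a i) \<star> (\<Sum>j\<le>M. b j)"
    by (simp add: sum.cartesian_product[symmetric] tmul_sum_left tmul_sum_right) (rule sum.swap)
  finally show ?thesis .
qed

end

context qweyl_torus
begin

abbreviation "A \<equiv> qweyl p l m q"

definition embed :: "(gen, 'k) free_alg set \<Rightarrow> 'k torus" where
  "embed U = torus_hom (SOME f. U = pres_class rels f)"

lemma embed_class: "embed (pres_class rels f) = torus_hom f"
proof -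
  have "pres_class rels f = pres_class rels (SOME g. pres_class rels f = pres_class rels g)"
    by (rule someI[of "\<lambda>g. pres_class rels f = pres_class rels g"]) simp
  then show ?thesis unfolding embed_def using pres_class_eq_iff by metis
qed

lemma A_ring: "ring A"
  unfolding qweyl_def by (rule pres_alg_ring)

lemma A_carrier: "carrier A = range (pres_class rels)"
  by (simp add: qweyl_def pres_alg_simps)

lemma embed_hom:
  assumes "u \<in> carrier A" "v \<in> carrier A"
  shows "embed (u \<otimes>\<^bsub>A\<^esub> v) = embed u \<star> embed v" "embed (u \<oplus>\<^bsub>A\<^esub> v) = embed u + embed v"
  using assms by (auto simp: qweyl_def pres_alg_simps embed_class torus_hom_mult torus_hom_add)

lemma embed_smult: "u \<in> carrier A \<Longrightarrow> embed (c \<odot>\<^bsub>A\<^esub> u) = scal c \<star> embed u"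
  by (auto simp: qweyl_def pres_alg_simps embed_class torus_hom_mult torus_hom_scalar)

lemma A_smult_closed: "u \<in> carrier A \<Longrightarrow> c \<odot>\<^bsub>A\<^esub> u \<in> carrier A"
  by (auto simp: qweyl_def pres_alg_simps)

lemma embed_0: "embed \<zero>\<^bsub>A\<^esub> = 0" and embed_1: "embed \<one>\<^bsub>A\<^esub> = 1"
  by (simp_all add: qweyl_def pres_alg_simps embed_class torus_hom_1)

lemma embed_inj:
  assumes "u \<in> carrier A" "v \<in> carrier A" "embed u = embed v"
  shows "u = v"
proof -
  obtain f g where "u = pres_class rels f" "v = pres_class rels g" using assms A_carrier by auto
  then show ?thesis using assms(3) by (simp add: embed_class pres_class_eq_iff)
qed

lemma embed_gen: "embed (qweyl_gen p l m q g) = gen_im g"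
  by (simp add: qweyl_gen_def embed_class torus_hom_gen)

lemma gen_carrier: "qweyl_gen p l m q g \<in> carrier A"
  by (simp add: qweyl_gen_def A_carrier)

lemma embed_finsum:
  assumes "finite K" "\<And>i. i \<in> K \<Longrightarrow> f i \<in> carrier A"
  shows "embed (finsum A f K) = (\<Sum>i\<in>K. embed (f i))"
proof -
  interpret A: ring A by (rule A_ring)
  show ?thesis using assms
  proof (induction K rule: finite_induct)
    case (insert i K)
    then have "finsum A f (insert i K) = f i \<oplus>\<^bsub>A\<^esub> finsum A f K"
      by (intro A.finsum_insert) auto
    moreover have "finsum A f K \<in> carrier A" using insert by (intro A.finsum_closed) auto
    ultimately show ?case using insert by (simp add: embed_hom)
  qed (simp add: embed_0)
qed

text \<open>
  No \<open>w\<close> occurs. Among the elements of \<open>B\<close> this singles out the copy of \<open>A\<close>.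
\<close>

definition flat :: "'k torus \<Rightarrow> bool" where
  "flat f \<longleftrightarrow> (\<forall>(k, b, c, d, e)\<in>keys f. e = 0)"

lemma flatD:
  assumes "flat f" "e \<noteq> 0"
  shows "lookup f (k, b, c, d, e) = 0"
proof (rule ccontr)
  assume "lookup f (k, b, c, d, e) \<noteq> 0"
  then have "(k, b, c, d, e) \<in> keys f" by (simp add: in_keys_iff)
  from bspec[OF assms(1)[unfolded flat_def] this] show False using assms(2) by simp
qed

lemma flat_add: "flat f \<Longrightarrow> flat g \<Longrightarrow> flat (f + g)"
  unfolding flat_def by (meson Un_iff keys_add subsetD)

lemma flat_mult:
  assumes "flat f" "flat g"
  shows "flat (f \<star> g)"
  unfolding flat_def
proof
  fix w assume "w \<in> keys (f \<star> g)"
  then obtain u v where uv: "u \<in> keys f" "v \<in> keys g" "w = u + v" using keys_tmul[of f g] by blast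
  have "case u of (k, b, c, d, e) \<Rightarrow> e = 0" "case v of (k, b, c, d, e) \<Rightarrow> e = 0"
    using bspec[OF assms(1)[unfolded flat_def] uv(1)] bspec[OF assms(2)[unfolded flat_def] uv(2)] .
  then show "case w of (k, b, c, d, e) \<Rightarrow> e = 0"
    unfolding uv(3) by (cases u; cases v) auto
qed

lemma flat_scal: "flat (scal c)"
  unfolding flat_def
proof
  fix u assume "u \<in> keys (scal c)"
  then have "u = 0" by (simp split: if_splits)
  then have u: "u = (0, 0, 0, 0, 0)" by (rule trans[OF _ expo_zero])
  show "case u of (k, b, c, d, e) \<Rightarrow> e = 0" unfolding u by simp
qed

lemma flat_gen: "flat (gen_im g)"
proof -
  have m: "flat (monom1 (k, b, c, d, 0))" for k b c d by (simp add: flat_def monom1_def)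
  have "flat (scal (inverse (p - 1)) \<star> (monom1 (-1, 1, 0, 0, 0) + scal (-1) \<star> monom1 (-1, 0, 0, 0, 0)))"
    by (intro flat_mult flat_add flat_scal m)
  moreover have "scal (-1) \<star> f = - f" for f :: "expo \<Rightarrow>\<^sub>0 'k" by (rule poly_mapping_eqI) simp
  ultimately have "flat tY" by (simp add: tY_def)
  then show ?thesis using m by (cases g) (simp_all add: tX_def tS_def tT_def)
qed

lemma gen_im_B: "gen_im g \<in> B"
  by (cases g) (auto intro: B.intros)

lemma flat_torus_hom: "flat (torus_hom f)" and torus_hom_B: "torus_hom f \<in> B"
proof -
  have "flat (torus_hom f) \<and> torus_hom f \<in> B"
    by (induction f rule: free_alg_induct)
      (auto simp: torus_hom_scalar torus_hom_mult torus_hom_gen torus_hom_add flat_scal flat_gen gen_im_B intro: flat_mult flat_add B_scal B_mult B_add)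
  then show "flat (torus_hom f)" "torus_hom f \<in> B" by auto
qed

lemma flat_embed: "u \<in> carrier A \<Longrightarrow> flat (embed u)" and embed_B: "u \<in> carrier A \<Longrightarrow> embed u \<in> B"
  by (auto simp: A_carrier embed_class flat_torus_hom torus_hom_B)

lemma lookup_flat_wpow:
  assumes "flat f"
  shows "lookup (f \<star> wpow n) (k, b, c, d, e) = (if e = int n then lookup f (k, b, c, d, 0) else 0)"
proof -
  have "lookup (f \<star> wpow n) (k, b, c, d, e) = lookup f (k, b, c, d, e - int n)"
    unfolding wpow_eq monom1_def lookup_tmul_single by simp
  moreover have "lookup f (k, b, c, d, e - int n) = 0" if "e \<noteq> int n"
  proof (rule ccontr)
    assume "lookup f (k, b, c, d, e - int n) \<noteq> 0"
    then have "(k, b, c, d, e - int n) \<in> keys f" by (simp add: in_keys_iff)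
    then show False using assms that unfolding flat_def by auto
  qed
  ultimately show ?thesis by simp
qed

lemma wpow_central: "wpow n \<star> f = f \<star> wpow n"
  by (induction n) (simp_all add: tmul_assoc, metis W_central tmul_assoc)

lemma wpow_add: "wpow (i + j) = wpow i \<star> wpow j"
  by (induction i) (simp_all add: tmul_assoc)

abbreviation "Aw \<equiv> poly_alg A"

lemma Aw_carrier: "carrier Aw = up A"
  by (simp add: poly_alg_def UP_def)

lemma Aw_add: "F \<in> up A \<Longrightarrow> G \<in> up A \<Longrightarrow> F \<oplus>\<^bsub>Aw\<^esub> G = (\<lambda>i. F i \<oplus>\<^bsub>A\<^esub> G i)"
  by (simp add: poly_alg_def UP_def)

lemma Aw_mult: "F \<in> up A \<Longrightarrow> G \<in> up A \<Longrightarrow>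
    F \<otimes>\<^bsub>Aw\<^esub> G = (\<lambda>n. finsum A (\<lambda>i. F i \<otimes>\<^bsub>A\<^esub> G (n - i)) {..n})"
  by (simp add: poly_alg_def UP_def)

lemma Aw_one: "\<one>\<^bsub>Aw\<^esub> = (\<lambda>i. if i = 0 then \<one>\<^bsub>A\<^esub> else \<zero>\<^bsub>A\<^esub>)"
  by (simp add: poly_alg_def UP_def)

lemma Aw_zero: "\<zero>\<^bsub>Aw\<^esub> = (\<lambda>i. \<zero>\<^bsub>A\<^esub>)"
  by (simp add: poly_alg_def UP_def)

lemma Aw_smult: "F \<in> up A \<Longrightarrow> c \<odot>\<^bsub>Aw\<^esub> F = (\<lambda>i. (c \<odot>\<^bsub>A\<^esub> \<one>\<^bsub>A\<^esub>) \<otimes>\<^bsub>A\<^esub> F i)"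
  using ring.ring_simprules(6)[OF A_ring] by (simp add: poly_alg_def UP_def A_smult_closed)

lemma poly_const_eq: "u \<in> carrier A \<Longrightarrow> poly_const A u = (\<lambda>i. if i = 0 then u else \<zero>\<^bsub>A\<^esub>)"
  by (simp add: poly_const_def UP_def)

lemma poly_var_eq: "poly_var A = (\<lambda>i. if i = 1 then \<one>\<^bsub>A\<^esub> else \<zero>\<^bsub>A\<^esub>)"
  using ring.ring_simprules(6)[OF A_ring] by (simp add: poly_var_def UP_def)

lemma A_zero_closed: "\<zero>\<^bsub>A\<^esub> \<in> carrier A" and A_one_closed: "\<one>\<^bsub>A\<^esub> \<in> carrier A"
  using ring.ring_simprules(2,6)[OF A_ring] .

lemma Aw_ring: "ring Aw"
proof -
  interpret UP_ring A "UP A" by (intro UP_ring.intro A_ring) 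
  interpret P: ring "UP A" by (rule UP_ring)
  have eq: "carrier Aw = carrier (UP A)" "monoid.mult Aw = monoid.mult (UP A)" "one Aw = one (UP A)"
    "ring.zero Aw = ring.zero (UP A)" "add Aw = add (UP A)"
    by (simp_all add: poly_alg_def)
  show ?thesis
  proof (rule ringI)
    show "abelian_group Aw"
      by (rule abelian_groupI) (auto simp: eq P.a_ac intro: P.l_neg)
    show "Group.monoid Aw"
      by (rule monoidI) (auto simp: eq P.m_assoc)
  qed (auto simp: eq P.l_distr P.r_distr)
qed

lemma poly_const_closed: "u \<in> carrier A \<Longrightarrow> poly_const A u \<in> carrier Aw"
  by (auto simp: Aw_carrier poly_const_eq A_zero_closed intro!: mem_upI exI[of _ 0])

lemma poly_var_closed: "poly_var A \<in> carrier Aw"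
  by (auto simp: Aw_carrier poly_var_eq A_zero_closed A_one_closed intro!: mem_upI exI[of _ 1])

definition embed_poly :: "(nat \<Rightarrow> (gen, 'k) free_alg set) \<Rightarrow> 'k torus" where
  "embed_poly F = (\<Sum>i\<in>{i. F i \<noteq> \<zero>\<^bsub>A\<^esub>}. embed (F i) \<star> wpow i)"

lemma up_finite: "F \<in> up A \<Longrightarrow> finite {i. F i \<noteq> \<zero>\<^bsub>A\<^esub>}"
proof -
  assume "F \<in> up A"
  then obtain N where "bound \<zero>\<^bsub>A\<^esub> N F" by (auto simp: up_def)
  then have "{i. F i \<noteq> \<zero>\<^bsub>A\<^esub>} \<subseteq> {..N}" by (auto dest: bound_below)
  then show ?thesis by (rule finite_subset) simp
qed

lemma up_bound: assumes "F \<in> up A" obtains N where "\<And>i. i > N \<Longrightarrow> F i = \<zero>\<^bsub>A\<^esub>"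
  using assms unfolding up_def bound_def by blast

lemma embed_poly_bound:
  assumes "\<And>i. i > N \<Longrightarrow> F i = \<zero>\<^bsub>A\<^esub>"
  shows "embed_poly F = (\<Sum>i\<le>N. embed (F i) \<star> wpow i)"
  unfolding embed_poly_def by (rule sum.mono_neutral_left) (use assms in \<open>auto simp: embed_0 not_le[symmetric]\<close>)

lemma up_closed: "F \<in> up A \<Longrightarrow> F i \<in> carrier A"
  by (rule mem_upD)

lemma lookup_embed_poly:
  assumes "F \<in> up A"
  shows "lookup (embed_poly F) (k, b, c, d, e) = (if e \<ge> 0 then lookup (embed (F (nat e))) (k, b, c, d, 0) else 0)"
proof -
  have "lookup (embed_poly F) (k, b, c, d, e) = (\<Sum>i\<in>{i. F i \<noteq> \<zero>\<^bsub>A\<^esub>}. if i = nat e \<and> e \<ge> 0 then lookup (embed (F (nat e))) (k, b, c, d, 0) else 0)"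
    unfolding embed_poly_def lookup_sum
    by (intro sum.cong refl) (auto simp: lookup_flat_wpow[OF flat_embed[OF up_closed[OF assms]]])
  also have "\<dots> = (if e \<ge> 0 then lookup (embed (F (nat e))) (k, b, c, d, 0) else 0)"
    using up_finite[OF assms] by (cases "e \<ge> 0") (auto simp: sum.delta embed_0)
  finally show ?thesis .
qed

lemma embed_poly_inj: "F \<in> up A \<Longrightarrow> G \<in> up A \<Longrightarrow> embed_poly F = embed_poly G \<Longrightarrow> F = G"
proof
  fix i assume F: "F \<in> up A" and G: "G \<in> up A" and eq: "embed_poly F = embed_poly G"
  have "embed (F i) = embed (G i)"
  proof (rule poly_mapping_eqI)
    fix u :: expo
    obtain k b c d e where u: "u = (k, b, c, d, e)" by (cases u)
    show "lookup (embed (F i)) u = lookup (embed (G i)) u"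
    proof (cases "e = 0")
      case True
      then show ?thesis
        using lookup_embed_poly[OF F, of k b c d "int i"] lookup_embed_poly[OF G, of k b c d "int i"] eq u by simp
    next
      case False
      then have "u \<notin> keys (embed (F i))" "u \<notin> keys (embed (G i))"
        using flat_embed[OF up_closed[OF F, of i]] flat_embed[OF up_closed[OF G, of i]] u unfolding flat_def by auto
      then show ?thesis by (simp add: in_keys_iff)
    qed
  qed
  then show "F i = G i" using embed_inj up_closed[OF F] up_closed[OF G] by blast
qed

lemma embed_poly_add:
  assumes "F \<in> carrier Aw" "G \<in> carrier Aw"
  shows "embed_poly (F \<oplus>\<^bsub>Aw\<^esub> G) = embed_poly F + embed_poly G"
proof -
  have FG: "F \<in> up A" "G \<in> up A" using assms by (simp_all add: Aw_carrier)
  obtain N where N: "\<And>i. i > N \<Longrightarrow> F i = \<zero>\<^bsub>A\<^esub>" using up_bound[OF FG(1)] by blast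
  obtain M where M: "\<And>i. i > M \<Longrightarrow> G i = \<zero>\<^bsub>A\<^esub>" using up_bound[OF FG(2)] by blast
  interpret A: ring A by (rule A_ring)
  have "embed_poly (F \<oplus>\<^bsub>Aw\<^esub> G) = (\<Sum>i\<le>max N M. embed (F i \<oplus>\<^bsub>A\<^esub> G i) \<star> wpow i)"
    unfolding Aw_add[OF FG] by (rule embed_poly_bound) (simp add: N M)
  then show ?thesis
    using embed_poly_bound[of "max N M" F] embed_poly_bound[of "max N M" G] N M
    by (simp add: embed_hom up_closed[OF FG(1)] up_closed[OF FG(2)] tmul_add_left sum.distrib)
qed

lemma embed_poly_mult:
  assumes "F \<in> carrier Aw" "G \<in> carrier Aw"
  shows "embed_poly (F \<otimes>\<^bsub>Aw\<^esub> G) = embed_poly F \<star> embed_poly G"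
proof -
  have FG: "F \<in> up A" "G \<in> up A" using assms by (simp_all add: Aw_carrier)
  obtain N where N: "\<And>i. i > N \<Longrightarrow> F i = \<zero>\<^bsub>A\<^esub>" using up_bound[OF FG(1)] by blast
  obtain M where M: "\<And>i. i > M \<Longrightarrow> G i = \<zero>\<^bsub>A\<^esub>" using up_bound[OF FG(2)] by blast
  interpret A: ring A by (rule A_ring)
  note cl = up_closed[OF FG(1)] up_closed[OF FG(2)]
  have z: "F i \<otimes>\<^bsub>A\<^esub> G (n - i) = \<zero>\<^bsub>A\<^esub>" if "n > N + M" for n i
  proof (cases "i > N")
    case True
    then show ?thesis using N cl by simp
  next
    case False
    then have "n - i > M" using that by simp
    then show ?thesis using M cl by simp
  qed
  have "embed_poly (F \<otimes>\<^bsub>Aw\<^esub> G) = (\<Sum>n\<le>N + M. embed (finsum A (\<lambda>i. F i \<otimes>\<^bsub>A\<^esub> G (n - i)) {..n}) \<star> wpow n)"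
    unfolding Aw_mult[OF FG] by (rule embed_poly_bound) (simp add: z)
  also have "\<dots> = (\<Sum>n\<le>N + M. \<Sum>i\<le>n. (embed (F i) \<star> wpow i) \<star> (embed (G (n - i)) \<star> wpow (n - i)))"
  proof (intro sum.cong refl)
    fix n
    have "embed (F i) \<star> embed (G (n - i)) \<star> wpow n = (embed (F i) \<star> wpow i) \<star> (embed (G (n - i)) \<star> wpow (n - i))" if "i \<le> n" for i
    proof -
      have "wpow n = wpow i \<star> wpow (n - i)" using wpow_add[of i "n - i"] that by simp
      then show ?thesis by (metis tmul_assoc wpow_central)
    qed
    then show "embed (finsum A (\<lambda>i. F i \<otimes>\<^bsub>A\<^esub> G (n - i)) {..n}) \<star> wpow n = (\<Sum>i\<le>n. (embed (F i) \<star> wpow i) \<star> (embed (G (n - i)) \<star> wpow (n - i)))"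
      by (simp add: embed_finsum cl embed_hom tmul_sum_left)
  qed
  also have "\<dots> = (\<Sum>i\<le>N. embed (F i) \<star> wpow i) \<star> (\<Sum>j\<le>M. embed (G j) \<star> wpow j)"
    by (rule cauchy_product) (simp_all add: N M embed_0)
  also have "\<dots> = embed_poly F \<star> embed_poly G"
    using embed_poly_bound[of N F] embed_poly_bound[of M G] N M by simp
  finally show ?thesis .
qed

lemma embed_poly_const: "u \<in> carrier A \<Longrightarrow> embed_poly (poly_const A u) = embed u"
  using embed_poly_bound[of 0 "poly_const A u"] by (simp add: poly_const_eq)

lemma embed_poly_var: "embed_poly (poly_var A) = tW"
  using embed_poly_bound[of 1 "poly_var A"] by (simp add: poly_var_eq embed_0 embed_1)

lemma embed_poly_one: "embed_poly \<one>\<^bsub>Aw\<^esub> = 1"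
  using embed_poly_bound[of 0 "\<one>\<^bsub>Aw\<^esub>"] by (simp add: Aw_one embed_1)

lemma embed_poly_smult:
  assumes "F \<in> carrier Aw"
  shows "embed_poly (c \<odot>\<^bsub>Aw\<^esub> F) = scal c \<star> embed_poly F"
proof -
  have F: "F \<in> up A" using assms by (simp add: Aw_carrier)
  interpret A: ring A by (rule A_ring)
  obtain N where N: "\<And>i. i > N \<Longrightarrow> F i = \<zero>\<^bsub>A\<^esub>" using up_bound[OF F] by blast
  have "embed_poly (c \<odot>\<^bsub>Aw\<^esub> F) = (\<Sum>i\<le>N. embed ((c \<odot>\<^bsub>A\<^esub> \<one>\<^bsub>A\<^esub>) \<otimes>\<^bsub>A\<^esub> F i) \<star> wpow i)"
    unfolding Aw_smult[OF F] by (rule embed_poly_bound) (simp add: N A_smult_closed)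
  then show ?thesis
    using embed_poly_bound[of N F] N
    by (simp add: embed_hom A_smult_closed up_closed[OF F] embed_smult embed_1 tmul_sum_right tmul_assoc)
qed

lemma Aw_smult_closed: "F \<in> carrier Aw \<Longrightarrow> c \<odot>\<^bsub>Aw\<^esub> F \<in> carrier Aw"
proof -
  assume "F \<in> carrier Aw"
  then have F: "F \<in> up A" by (simp add: Aw_carrier)
  show ?thesis
    unfolding Aw_carrier Aw_smult[OF F] 
    by (rule ring.up_smult_closed[OF A_ring A_smult_closed[OF A_one_closed] F])
qed

lemma embed_poly_image: "embed_poly ` carrier Aw = B"
proof
  interpret P: ring Aw by (rule Aw_ring)
  show "embed_poly ` carrier Aw \<subseteq> B"
    by (auto simp: embed_poly_def Aw_carrier intro!: B_sum B_mult embed_B B_wpow dest: up_closed)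
  have gen: "gen_im g \<in> embed_poly ` carrier Aw" for g
    using embed_poly_const[OF gen_carrier[of g]] poly_const_closed[OF gen_carrier[of g]] embed_gen[of g] by force
  show "B \<subseteq> embed_poly ` carrier Aw"
  proof
    fix f assume "f \<in> B"
    then show "f \<in> embed_poly ` carrier Aw"
    proof induction
      case (B_scal c)
      have "embed_poly (c \<odot>\<^bsub>Aw\<^esub> \<one>\<^bsub>Aw\<^esub>) = scal c" by (simp add: embed_poly_smult embed_poly_one)
      then show ?case using Aw_smult_closed[OF P.one_closed, of c] by force
    next
      case (B_add f g)
      then obtain F G where "F \<in> carrier Aw" "G \<in> carrier Aw" "f = embed_poly F" "g = embed_poly G" by blast
      then show ?case using embed_poly_add[of F G] by (intro image_eqI[of _ _ "F \<oplus>\<^bsub>Aw\<^esub> G"]) simp_all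
    next
      case (B_mult f g)
      then obtain F G where "F \<in> carrier Aw" "G \<in> carrier Aw" "f = embed_poly F" "g = embed_poly G" by blast
      then show ?case using embed_poly_mult[of F G] by (intro image_eqI[of _ _ "F \<otimes>\<^bsub>Aw\<^esub> G"]) simp_all
    next
      case B_W
      show ?case using embed_poly_var poly_var_closed by force
    qed (use gen[of Gx] gen[of Gy] gen[of Gs] gen[of Gt] in simp_all)
  qed
qed

lemma embed_poly_inj_on: "inj_on embed_poly (carrier Aw)"
  using embed_poly_inj by (auto simp: inj_on_def Aw_carrier)

lemma embed_poly_bij: "bij_betw embed_poly (carrier Aw) B"
  using embed_poly_inj_on embed_poly_image by (simp add: bij_betw_def)

definition "embed_poly_inv = inv_into (carrier Aw) embed_poly"

lemma embed_poly_inv_closed: "f \<in> B \<Longrightarrow> embed_poly_inv f \<in> carrier Aw"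
  unfolding embed_poly_inv_def using embed_poly_image by (metis inv_into_into)

lemma embed_poly_embed_poly_inv: "f \<in> B \<Longrightarrow> embed_poly (embed_poly_inv f) = f"
  unfolding embed_poly_inv_def using embed_poly_image by (metis f_inv_into_f)

lemma embed_poly_inv_embed_poly: "F \<in> carrier Aw \<Longrightarrow> embed_poly_inv (embed_poly F) = F"
  unfolding embed_poly_inv_def by (rule inv_into_f_f[OF embed_poly_inj_on])

lemma embed_poly_B: "F \<in> carrier Aw \<Longrightarrow> embed_poly F \<in> B"
  using embed_poly_image by blast

text \<open>
  Conjugation by the isomorphism of \<open>A[w]\<close> with \<open>B\<close>.
\<close>

definition transport :: "((nat \<Rightarrow> (gen, 'k) free_alg set) \<Rightarrow> (nat \<Rightarrow> (gen, 'k) free_alg set)) \<Rightarrow> 'k torus \<Rightarrow> 'k torus" where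
  "transport \<phi> f = embed_poly (\<phi> (embed_poly_inv f))"

lemma transport_embed_poly: "F \<in> carrier Aw \<Longrightarrow> transport \<phi> (embed_poly F) = embed_poly (\<phi> F)"
  by (simp add: transport_def embed_poly_inv_embed_poly)

lemma B_aut_transport:
  assumes "\<phi> \<in> alg_aut Aw"
  shows "B_aut (transport \<phi>)"
proof -
  interpret P: ring Aw by (rule Aw_ring)
  have iso: "\<phi> \<in> ring_iso Aw Aw" and sm: "\<And>c u. u \<in> carrier Aw \<Longrightarrow> \<phi> (c \<odot>\<^bsub>Aw\<^esub> u) = c \<odot>\<^bsub>Aw\<^esub> \<phi> u"
    using assms by (auto simp: alg_aut_def)
  note E = ring_iso_memE[OF iso]
  have "bij_betw (embed_poly \<circ> (\<phi> \<circ> embed_poly_inv)) B B"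
    unfolding embed_poly_inv_def
    by (rule bij_betw_trans[OF bij_betw_trans[OF bij_betw_inv_into[OF embed_poly_bij] E(5)] embed_poly_bij])
  moreover have "embed_poly \<circ> (\<phi> \<circ> embed_poly_inv) = transport \<phi>" by (auto simp: transport_def)
  moreover have "transport \<phi> (f + g) = transport \<phi> f + transport \<phi> g"
    "transport \<phi> (f \<star> g) = transport \<phi> f \<star> transport \<phi> g" if fg: "f \<in> B" "g \<in> B" for f g
  proof -
    obtain F G where FG: "F \<in> carrier Aw" "G \<in> carrier Aw" "f = embed_poly F" "g = embed_poly G"
      using embed_poly_inv_closed[OF fg(1)] embed_poly_inv_closed[OF fg(2)] embed_poly_embed_poly_inv[OF fg(1)] embed_poly_embed_poly_inv[OF fg(2)] by metis
    show "transport \<phi> (f + g) = transport \<phi> f + transport \<phi> g"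
      using transport_embed_poly[of "F \<oplus>\<^bsub>Aw\<^esub> G" \<phi>] FG by (simp add: embed_poly_add transport_embed_poly E)
    show "transport \<phi> (f \<star> g) = transport \<phi> f \<star> transport \<phi> g"
      using transport_embed_poly[of "F \<otimes>\<^bsub>Aw\<^esub> G" \<phi>] FG by (simp add: embed_poly_mult transport_embed_poly E)
  qed
  moreover have "transport \<phi> (scal c) = scal c" for c
  proof -
    have "embed_poly (c \<odot>\<^bsub>Aw\<^esub> \<one>\<^bsub>Aw\<^esub>) = scal c" by (simp add: embed_poly_smult embed_poly_one)
    moreover have "\<phi> (c \<odot>\<^bsub>Aw\<^esub> \<one>\<^bsub>Aw\<^esub>) = c \<odot>\<^bsub>Aw\<^esub> \<one>\<^bsub>Aw\<^esub>" using sm E(4) by simp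
    ultimately show ?thesis using transport_embed_poly[OF Aw_smult_closed[OF P.one_closed], of \<phi> c] by simp
  qed
  ultimately show ?thesis unfolding B_aut_def by simp
qed

end

section \<open>Exponentials of locally nilpotent derivations\<close>

context qweyl_torus
begin

lemma gen_im_scaled:
  assumes "B_aut \<psi>"
  obtains \<nu> where "\<psi> (gen_im g) = scal \<nu> \<star> gen_im g"
proof -
  obtain \<alpha> where "\<psi> tX = scal \<alpha> \<star> tX" "\<psi> tY = scal (inverse \<alpha>) \<star> tY"
    using assms by (rule aut_XY)
  moreover obtain \<beta> \<gamma> where "\<psi> tS = scal \<beta> \<star> tS" "\<psi> tT = scal \<gamma> \<star> tT"
    using assms by (rule aut_ZST)
  ultimately show thesis using that by (cases g) simp_all
qed

text \<open>
  Locally nilpotent derivations of \<open>B\<close>; linearity over the ground field is stated by the vanishing on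
  constants, to which it is equivalent by the product rule.
\<close>

definition B_lnd :: "('k torus \<Rightarrow> 'k torus) \<Rightarrow> bool" where
  "B_lnd D \<longleftrightarrow> D \<in> B \<rightarrow> B \<and> (\<forall>f\<in>B. \<forall>g\<in>B. D (f + g) = D f + D g) \<and>
     (\<forall>f\<in>B. \<forall>g\<in>B. D (f \<star> g) = D f \<star> g + f \<star> D g) \<and> (\<forall>c. D (scal c) = 0) \<and>
     (\<forall>f\<in>B. \<exists>n. (D ^^ n) f = 0)"

context
  fixes D :: "'k torus \<Rightarrow> 'k torus"
  assumes lnd: "B_lnd D" and char0: "CHAR('k) = 0"
begin

lemma D_B: "f \<in> B \<Longrightarrow> D f \<in> B"
  and D_add: "f \<in> B \<Longrightarrow> g \<in> B \<Longrightarrow> D (f + g) = D f + D g"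
  and D_mult: "f \<in> B \<Longrightarrow> g \<in> B \<Longrightarrow> D (f \<star> g) = D f \<star> g + f \<star> D g"
  and D_scal: "D (scal c) = 0"
  and D_nilp: "f \<in> B \<Longrightarrow> \<exists>n. (D ^^ n) f = 0"
  using lnd by (simp_all add: B_lnd_def Pi_iff)

lemma of_nat_nz: "n > 0 \<Longrightarrow> (of_nat n :: 'k) \<noteq> 0"
  using char0 by (simp add: of_nat_eq_0_iff_char_dvd)

lemma D_smult: "f \<in> B \<Longrightarrow> D (scal c \<star> f) = scal c \<star> D f"
  by (simp add: D_mult B_scal D_scal)

lemma D_0: "D 0 = 0" using D_scal[of 0] by simp

lemma D_sum: "(\<And>i. i \<in> I \<Longrightarrow> f i \<in> B) \<Longrightarrow> D (sum f I) = (\<Sum>i\<in>I. D (f i))"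
  by (induction I rule: infinite_finite_induct) (simp_all add: D_0 D_add B_sum)

lemma Dn_B: "f \<in> B \<Longrightarrow> (D ^^ n) f \<in> B"
  by (induction n) (simp_all add: D_B)

lemma Dn_0: "(D ^^ n) 0 = 0"
  by (induction n) (simp_all add: D_0)

lemma Dn_zero_mono: "(D ^^ n) f = 0 \<Longrightarrow> n \<le> k \<Longrightarrow> (D ^^ k) f = 0"
proof -
  assume h: "(D ^^ n) f = 0" "n \<le> k"
  have "(D ^^ (k - n + n)) f = (D ^^ (k - n)) ((D ^^ n) f)" by (simp only: funpow_add comp_apply)
  then show ?thesis using h by (simp add: Dn_0)
qed

(* Otherwise scalars which are natural numbers are rewritten to numerals of the commutative
   group algebra and the rules for scalars no longer apply. *)
declare single_of_nat [simp del]

text \<open>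
  Divided powers absorb the binomial coefficients of the higher product rule.
\<close>

definition divpow :: "nat \<Rightarrow> 'k torus \<Rightarrow> 'k torus" where
  "divpow n f = scal (inverse (of_nat (fact n))) \<star> (D ^^ n) f"

lemma divpow_0: "divpow 0 f = f" by (simp add: divpow_def)

lemma divpow_B: "f \<in> B \<Longrightarrow> divpow n f \<in> B"
  unfolding divpow_def by (intro B_mult B_scal Dn_B)

lemma divpow_Suc: "f \<in> B \<Longrightarrow> D (divpow n f) = scal (of_nat (Suc n)) \<star> divpow (Suc n) f"
proof -
  assume f: "f \<in> B"
  have "of_nat (Suc n) * inverse (of_nat (fact (Suc n))) = inverse (of_nat (fact n) :: 'k)"
  proof -
    have "(of_nat (fact (Suc n)) :: 'k) = of_nat (Suc n) * of_nat (fact n)"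
      by (metis fact_Suc of_nat_id of_nat_mult)
    then show ?thesis using of_nat_nz[of "Suc n"] by (simp del: of_nat_Suc fact_Suc)
  qed
  then show ?thesis using f by (simp add: divpow_def D_smult Dn_B scal_scal del: of_nat_Suc fact_Suc)
qed

lemma scal_of_nat_cancel: "scal (of_nat (Suc n)) \<star> f = scal (of_nat (Suc n)) \<star> g \<Longrightarrow> f = g"
proof -
  assume "scal (of_nat (Suc n)) \<star> f = scal (of_nat (Suc n)) \<star> g"
  then have "scal (inverse (of_nat (Suc n))) \<star> (scal (of_nat (Suc n)) \<star> f) = scal (inverse (of_nat (Suc n))) \<star> (scal (of_nat (Suc n)) \<star> g)"
    by simp
  then show ?thesis using of_nat_nz[of "Suc n"] by (simp add: scal_scal del: of_nat_Suc)
qed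

lemma scal_of_nat_add: "scal (of_nat (a + b)) \<star> f = scal (of_nat a) \<star> f + scal (of_nat b) \<star> f"
  by (simp add: single_add tmul_add_left)

text \<open>
  By induction: applying \<open>D\<close> to the identity for \<open>n\<close> multiplies the term with index \<open>i\<close> by \<open>i + (n + 1 - i)\<close>
  after shifting, and the common factor \<open>n + 1\<close> is invertible in characteristic zero.
\<close>

lemma divpow_mult:
  assumes f: "f \<in> B" and g: "g \<in> B"
  shows "divpow n (f \<star> g) = (\<Sum>i\<le>n. divpow i f \<star> divpow (n - i) g)"
proof (induction n)
  case 0
  then show ?case by (simp add: divpow_0)
next
  case (Suc n)
  let ?t = "\<lambda>i. divpow i f \<star> divpow (Suc n - i) g"
  have "scal (of_nat (Suc n)) \<star> divpow (Suc n) (f \<star> g) = D (divpow n (f \<star> g))"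
    by (simp add: divpow_Suc B_mult f g)
  also have "\<dots> = (\<Sum>i\<le>n. D (divpow i f) \<star> divpow (n - i) g) + (\<Sum>i\<le>n. divpow i f \<star> D (divpow (n - i) g))"
    unfolding Suc by (simp add: D_sum D_mult B_mult divpow_B f g sum.distrib)
  also have "(\<Sum>i\<le>n. D (divpow i f) \<star> divpow (n - i) g) = (\<Sum>i\<le>n. scal (of_nat (Suc i)) \<star> ?t (Suc i))"
    by (simp add: divpow_Suc f tmul_assoc del: of_nat_Suc)
  also have "\<dots> = (\<Sum>i\<le>Suc n. scal (of_nat i) \<star> ?t i)"
    unfolding sum.atMost_Suc_shift by simp
  also have "(\<Sum>i\<le>n. divpow i f \<star> D (divpow (n - i) g)) = (\<Sum>i\<le>n. scal (of_nat (Suc n - i)) \<star> ?t i)"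
    by (intro sum.cong refl) (simp add: divpow_Suc g Suc_diff_le scal_left_commute[of "divpow i f" for i] del: of_nat_Suc)
  also have "\<dots> = (\<Sum>i\<le>Suc n. scal (of_nat (Suc n - i)) \<star> ?t i)"
    by simp
  also have "(\<Sum>i\<le>Suc n. scal (of_nat i) \<star> ?t i) + (\<Sum>i\<le>Suc n. scal (of_nat (Suc n - i)) \<star> ?t i)
     = (\<Sum>i\<le>Suc n. scal (of_nat (Suc n)) \<star> ?t i)"
    unfolding sum.distrib[symmetric] scal_of_nat_add[symmetric]
    by (intro sum.cong refl) simp
  also have "\<dots> = scal (of_nat (Suc n)) \<star> (\<Sum>i\<le>Suc n. ?t i)"
    by (simp only: tmul_sum_right)
  finally show ?case by (rule scal_of_nat_cancel)
qed

definition expD :: "'k torus \<Rightarrow> 'k torus" where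
  "expD f = (\<Sum>n\<in>{n. divpow n f \<noteq> 0}. divpow n f)"

lemma divpow_zero: "(D ^^ k) f = 0 \<Longrightarrow> n \<ge> k \<Longrightarrow> divpow n f = 0"
  using Dn_zero_mono[of k f n] by (simp add: divpow_def)

lemma expD_bound:
  assumes "\<And>n. n > N \<Longrightarrow> divpow n f = 0"
  shows "expD f = (\<Sum>n\<le>N. divpow n f)"
  unfolding expD_def by (rule sum.mono_neutral_left) (use assms in \<open>auto simp: not_le[symmetric]\<close>)

lemma divpow_bound: assumes "f \<in> B" obtains N where "\<And>n. n > N \<Longrightarrow> divpow n f = 0"
proof -
  obtain k where "(D ^^ k) f = 0" using D_nilp[OF assms] by blast
  then show thesis using divpow_zero that[of k] by simp
qed

lemma Dn_add: "f \<in> B \<Longrightarrow> g \<in> B \<Longrightarrow> (D ^^ n) (f + g) = (D ^^ n) f + (D ^^ n) g"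
  by (induction n) (simp_all add: D_add Dn_B)

lemma expD_add: "f \<in> B \<Longrightarrow> g \<in> B \<Longrightarrow> expD (f + g) = expD f + expD g"
proof -
  assume f: "f \<in> B" and g: "g \<in> B"
  obtain N where N: "\<And>n. n > N \<Longrightarrow> divpow n f = 0" using divpow_bound[OF f] by blast
  obtain M where M: "\<And>n. n > M \<Longrightarrow> divpow n g = 0" using divpow_bound[OF g] by blast
  have s: "divpow n (f + g) = divpow n f + divpow n g" for n
    by (simp add: divpow_def Dn_add f g tmul_add_right)
  show ?thesis
    using expD_bound[of "max N M" "f + g"] expD_bound[of "max N M" f] expD_bound[of "max N M" g] N M
    by (simp add: s sum.distrib)
qed

lemma expD_mult: "f \<in> B \<Longrightarrow> g \<in> B \<Longrightarrow> expD (f \<star> g) = expD f \<star> expD g"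
proof -
  assume f: "f \<in> B" and g: "g \<in> B"
  obtain N where N: "\<And>n. n > N \<Longrightarrow> divpow n f = 0" using divpow_bound[OF f] by blast
  obtain M where M: "\<And>n. n > M \<Longrightarrow> divpow n g = 0" using divpow_bound[OF g] by blast
  have "divpow n (f \<star> g) = 0" if "n > N + M" for n
    unfolding divpow_mult[OF f g]
  proof (rule sum.neutral, rule ballI)
    fix i assume "i \<in> {..n}"
    show "divpow i f \<star> divpow (n - i) g = 0"
      using N[of i] M[of "n - i"] that by (cases "i > N") auto
  qed
  then have "expD (f \<star> g) = (\<Sum>n\<le>N + M. \<Sum>i\<le>n. divpow i f \<star> divpow (n - i) g)"
    using expD_bound[of "N + M" "f \<star> g"] by (simp add: divpow_mult[OF f g])
  also have "\<dots> = (\<Sum>i\<le>N. divpow i f) \<star> (\<Sum>j\<le>M. divpow j g)"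
    by (rule cauchy_product) (simp_all add: N M)
  finally show ?thesis using expD_bound[of N f] expD_bound[of M g] N M by simp
qed

lemma divpow_const: "D f = 0 \<Longrightarrow> n > 0 \<Longrightarrow> divpow n f = 0"
  using divpow_zero[of 1 f n] by simp

lemma expD_const: "D f = 0 \<Longrightarrow> expD f = f"
  using expD_bound[of 0 f] divpow_const[of f] by (simp add: divpow_0)

lemma expD_B: "f \<in> B \<Longrightarrow> expD f \<in> B"
  unfolding expD_def by (intro B_sum divpow_B)

lemma expD_uminus: "f \<in> B \<Longrightarrow> expD (- f) = - expD f"
  using expD_add[of f "- f"] expD_const[OF D_0] by (simp add: B_uminus eq_neg_iff_add_eq_0 add.commute)

lemma divpow_D: "f \<in> B \<Longrightarrow> divpow n (D f) = D (divpow n f)"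
  by (simp add: divpow_def D_smult Dn_B) (metis funpow_swap1)

lemma expD_D: "f \<in> B \<Longrightarrow> expD (D f) = D (expD f)"
proof -
  assume f: "f \<in> B"
  obtain N where N: "\<And>n. n > N \<Longrightarrow> divpow n f = 0" using divpow_bound[OF f] by blast
  have "expD (D f) = (\<Sum>n\<le>N. divpow n (D f))"
    by (rule expD_bound) (simp add: divpow_D f N D_0)
  also have "\<dots> = D (expD f)"
    using expD_bound[of N f] N by (simp add: divpow_D f D_sum divpow_B)
  finally show ?thesis .
qed

text \<open>
  \<open>exp(D)\<close> fixes the kernel of \<open>D\<close> and commutes with \<open>D\<close>, so if it kills \<open>f\<close> it also kills the last nonzero
  \<open>D^k f\<close>, which it fixes.
\<close>

lemma expD_inj: "f \<in> B \<Longrightarrow> expD f = 0 \<Longrightarrow> f = 0"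
proof -
  have "f \<in> B \<Longrightarrow> expD f = 0 \<Longrightarrow> (D ^^ n) f = 0 \<Longrightarrow> f = 0" for n
  proof (induction n arbitrary: f)
    case (Suc n)
    have "D f = 0"
    proof (rule Suc.IH)
      show "D f \<in> B" using Suc.prems(1) by (rule D_B)
      show "expD (D f) = 0" using expD_D[OF Suc.prems(1)] Suc.prems(2) D_0 by simp
      show "(D ^^ n) (D f) = 0" using Suc.prems(3) by (simp only: funpow_Suc_right comp_apply)
    qed
    then show ?case using Suc.prems expD_const by metis
  qed simp
  then show "f \<in> B \<Longrightarrow> expD f = 0 \<Longrightarrow> f = 0" using D_nilp by blast
qed

text \<open>
  By induction on the order of nilpotency: \<open>f\<close> differs from \<open>exp(D) f\<close> by elements of smaller order.
\<close>

lemma expD_surj: "f \<in> B \<Longrightarrow> f \<in> expD ` B"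
proof -
  have sum: "(\<And>i. i \<in> I \<Longrightarrow> h i \<in> expD ` B) \<Longrightarrow> sum h I \<in> expD ` B" for h and I :: "nat set"
  proof (induction I rule: infinite_finite_induct)
    case (insert i I)
    then have "h i \<in> expD ` B" "sum h I \<in> expD ` B" by simp_all
    then obtain u v where "u \<in> B" "v \<in> B" "h i = expD u" "sum h I = expD v" by (elim imageE) 
    then show ?case using insert.hyps by (intro image_eqI[of _ _ "u + v"]) (simp_all add: expD_add B_add)
  qed (use expD_const[OF D_0] B_0 in \<open>auto intro!: image_eqI[of _ _ 0]\<close>)
  have "f \<in> B \<Longrightarrow> (D ^^ n) f = 0 \<Longrightarrow> f \<in> expD ` B" for n
  proof (induction n arbitrary: f)
    case 0
    then show ?case using sum[of "{}"] by simp
  next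
    case (Suc n)
    have zero: "divpow k f = 0" if "k > n" for k
      using divpow_zero[OF Suc.prems(2), of k] that by simp
    have "expD f = (\<Sum>k\<le>n. divpow k f)" using expD_bound[of n f] zero by simp
    also have "\<dots> = f + (\<Sum>k\<in>{1..n}. divpow k f)"
    proof -
      have "{..n} - {0} = {1..n}" by auto
      then show ?thesis using sum.remove[of "{..n}" 0 "\<lambda>k. divpow k f"] by (simp add: divpow_0)
    qed
    finally have f: "f = expD f + (- (\<Sum>k\<in>{1..n}. divpow k f))" by simp
    have "divpow k f \<in> expD ` B" if k: "k \<in> {1..n}" for k
    proof (rule Suc.IH)
      show B: "divpow k f \<in> B" by (rule divpow_B[OF Suc.prems(1)])
      have pull: "(D ^^ j) (scal c \<star> g) = scal c \<star> (D ^^ j) g" if "g \<in> B" for j c g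
        using that by (induction j) (simp_all add: D_smult Dn_B)
      have "(D ^^ (n + k)) f = 0" using Dn_zero_mono[OF Suc.prems(2)] k by simp
      then show "(D ^^ n) (divpow k f) = 0"
        by (simp add: divpow_def pull Dn_B Suc.prems funpow_add)
    qed
    then have "(\<Sum>k\<in>{1..n}. divpow k f) \<in> expD ` B" by (rule sum)
    then obtain g where g: "g \<in> B" "(\<Sum>k\<in>{1..n}. divpow k f) = expD g" by blast
    have "f = expD (f + (- g))"
      using f g Suc.prems by (simp add: expD_add B_uminus expD_uminus del: add_uminus_conv_diff)
    then show ?case using g Suc.prems B_add B_uminus by blast
  qed
  then show "f \<in> B \<Longrightarrow> f \<in> expD ` B" using D_nilp by blast
qed

lemma B_aut_expD: "B_aut expD"
proof -
  have "inj_on expD B"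
  proof (rule inj_onI)
    fix f g assume fg: "f \<in> B" "g \<in> B" "expD f = expD g"
    have "expD (f + (- g)) = 0" using fg by (simp add: expD_add B_uminus expD_uminus del: add_uminus_conv_diff)
    then have "f + (- g) = 0" by (rule expD_inj[OF B_add[OF fg(1) B_uminus[OF fg(2)]]])
    then show "f = g" by simp
  qed
  moreover have "expD ` B = B" using expD_B expD_surj by blast
  ultimately show ?thesis
    unfolding B_aut_def bij_betw_def by (auto simp: expD_add expD_mult expD_const D_scal)
qed

end

context
  fixes \<delta> assumes der: "alg_derivation A \<delta>" and nilp: "locally_nilpotent A \<delta>" and char0: "CHAR('k) = 0"
begin

interpretation A: ring A by (rule A_ring)
interpretation P: ring Aw by (rule Aw_ring)

lemma der_closed: "u \<in> carrier A \<Longrightarrow> \<delta> u \<in> carrier A"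
  and der_add: "u \<in> carrier A \<Longrightarrow> v \<in> carrier A \<Longrightarrow> \<delta> (u \<oplus>\<^bsub>A\<^esub> v) = \<delta> u \<oplus>\<^bsub>A\<^esub> \<delta> v"
  and der_smult: "u \<in> carrier A \<Longrightarrow> \<delta> (c \<odot>\<^bsub>A\<^esub> u) = c \<odot>\<^bsub>A\<^esub> \<delta> u"
  and der_mult: "u \<in> carrier A \<Longrightarrow> v \<in> carrier A \<Longrightarrow> \<delta> (u \<otimes>\<^bsub>A\<^esub> v) = (\<delta> u \<otimes>\<^bsub>A\<^esub> v) \<oplus>\<^bsub>A\<^esub> (u \<otimes>\<^bsub>A\<^esub> \<delta> v)"
  using der by (simp_all add: alg_derivation_def Pi_iff)

lemma der_0: "\<delta> \<zero>\<^bsub>A\<^esub> = \<zero>\<^bsub>A\<^esub>"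
proof -
  have "\<delta> \<zero>\<^bsub>A\<^esub> \<oplus>\<^bsub>A\<^esub> \<delta> \<zero>\<^bsub>A\<^esub> = \<delta> \<zero>\<^bsub>A\<^esub>"
    using der_add[of "\<zero>\<^bsub>A\<^esub>" "\<zero>\<^bsub>A\<^esub>"] by simp
  then show ?thesis using der_closed[OF A.zero_closed] A.add.r_cancel_one' by metis
qed

lemma der_1: "\<delta> \<one>\<^bsub>A\<^esub> = \<zero>\<^bsub>A\<^esub>"
proof -
  have "\<delta> \<one>\<^bsub>A\<^esub> \<oplus>\<^bsub>A\<^esub> \<delta> \<one>\<^bsub>A\<^esub> = \<delta> \<one>\<^bsub>A\<^esub>"
    using der_mult[of "\<one>\<^bsub>A\<^esub>" "\<one>\<^bsub>A\<^esub>"] der_closed[OF A.one_closed] by simp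
  then show ?thesis using der_closed[OF A.one_closed] A.add.r_cancel_one' by metis
qed

lemma dern_closed: "u \<in> carrier A \<Longrightarrow> (\<delta> ^^ n) u \<in> carrier A"
  by (induction n) (simp_all add: der_closed)

lemma dern_0: "(\<delta> ^^ n) \<zero>\<^bsub>A\<^esub> = \<zero>\<^bsub>A\<^esub>"
  by (induction n) (simp_all add: der_0)

lemma dern_zero_mono: "(\<delta> ^^ n) u = \<zero>\<^bsub>A\<^esub> \<Longrightarrow> n \<le> k \<Longrightarrow> (\<delta> ^^ k) u = \<zero>\<^bsub>A\<^esub>"
proof -
  assume h: "(\<delta> ^^ n) u = \<zero>\<^bsub>A\<^esub>" "n \<le> k"
  have "(\<delta> ^^ (k - n + n)) u = (\<delta> ^^ (k - n)) ((\<delta> ^^ n) u)" by (simp only: funpow_add comp_apply)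
  then show ?thesis using h by (simp add: dern_0)
qed

lemma der_finsum: "finite K \<Longrightarrow> (\<And>i. i \<in> K \<Longrightarrow> f i \<in> carrier A) \<Longrightarrow>
    \<delta> (finsum A f K) = finsum A (\<lambda>i. \<delta> (f i)) K"
proof (induction K rule: finite_induct)
  case (insert i K)
  have "finsum A f K \<in> carrier A" using insert by (intro A.finsum_closed) auto
  then show ?case using insert by (simp add: der_add der_closed Pi_def)
qed (simp add: der_0)

abbreviation (input) "\<Delta> F \<equiv> \<lambda>i::nat. \<delta> (F i)"

lemma Delta_closed: "F \<in> carrier Aw \<Longrightarrow> \<Delta> F \<in> carrier Aw"
proof -
  assume "F \<in> carrier Aw"
  then have F: "F \<in> up A" by (simp add: Aw_carrier)
  obtain N where "\<And>i. i > N \<Longrightarrow> F i = \<zero>\<^bsub>A\<^esub>" using up_bound[OF F] by blast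
  then have "bound \<zero>\<^bsub>A\<^esub> N (\<Delta> F)" by (auto simp: der_0)
  then show ?thesis unfolding Aw_carrier using der_closed[OF up_closed[OF F]] by (intro mem_upI) blast+
qed

lemma Delta_add: "F \<in> carrier Aw \<Longrightarrow> G \<in> carrier Aw \<Longrightarrow> \<Delta> (F \<oplus>\<^bsub>Aw\<^esub> G) = \<Delta> F \<oplus>\<^bsub>Aw\<^esub> \<Delta> G"
  using Delta_closed[of F] Delta_closed[of G]
  by (simp add: Aw_carrier Aw_add der_add up_closed)

lemma Delta_mult:
  assumes "F \<in> carrier Aw" "G \<in> carrier Aw"
  shows "\<Delta> (F \<otimes>\<^bsub>Aw\<^esub> G) = (\<Delta> F \<otimes>\<^bsub>Aw\<^esub> G) \<oplus>\<^bsub>Aw\<^esub> (F \<otimes>\<^bsub>Aw\<^esub> \<Delta> G)"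
proof
  fix n
  have FG: "F \<in> up A" "G \<in> up A" "\<Delta> F \<in> up A" "\<Delta> G \<in> up A"
    using assms Delta_closed by (simp_all add: Aw_carrier)
  have m: "\<Delta> F \<otimes>\<^bsub>Aw\<^esub> G \<in> up A" "F \<otimes>\<^bsub>Aw\<^esub> \<Delta> G \<in> up A"
    using P.m_closed assms Delta_closed by (simp_all add: Aw_carrier)
  note cl = up_closed[OF FG(1)] up_closed[OF FG(2)] up_closed[OF FG(3)] up_closed[OF FG(4)]
  have "\<Delta> (F \<otimes>\<^bsub>Aw\<^esub> G) n = finsum A (\<lambda>i. \<delta> (F i \<otimes>\<^bsub>A\<^esub> G (n - i))) {..n}"
    unfolding Aw_mult[OF FG(1,2)] by (rule der_finsum) (simp_all add: cl)
  also have "\<dots> = finsum A (\<lambda>i. (\<delta> (F i) \<otimes>\<^bsub>A\<^esub> G (n - i)) \<oplus>\<^bsub>A\<^esub> (F i \<otimes>\<^bsub>A\<^esub> \<delta> (G (n - i)))) {..n}"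
    by (simp add: der_mult cl)
  also have "\<dots> = finsum A (\<lambda>i. \<delta> (F i) \<otimes>\<^bsub>A\<^esub> G (n - i)) {..n} \<oplus>\<^bsub>A\<^esub> finsum A (\<lambda>i. F i \<otimes>\<^bsub>A\<^esub> \<delta> (G (n - i))) {..n}"
    by (rule A.finsum_addf) (auto simp: cl)
  finally show "\<Delta> (F \<otimes>\<^bsub>Aw\<^esub> G) n = ((\<Delta> F \<otimes>\<^bsub>Aw\<^esub> G) \<oplus>\<^bsub>Aw\<^esub> (F \<otimes>\<^bsub>Aw\<^esub> \<Delta> G)) n"
    unfolding Aw_add[OF m] unfolding Aw_mult[OF FG(3) FG(2)] Aw_mult[OF FG(1) FG(4)] .
qed

text \<open>
  The derivation \<open>w \<delta>\<close> of \<open>A[w]\<close>, where \<open>\<delta>\<close> is extended by \<open>\<delta>(w) = 0\<close>. The factor \<open>w\<close> separates the powers of \<open>\<delta>\<close> in the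
  exponential series.
\<close>

definition wD :: "'k torus \<Rightarrow> 'k torus" where
  "wD f = tW \<star> embed_poly (\<Delta> (embed_poly_inv f))"

lemma wD_embed_poly: "F \<in> carrier Aw \<Longrightarrow> wD (embed_poly F) = tW \<star> embed_poly (\<Delta> F)"
  by (simp add: wD_def embed_poly_inv_embed_poly)

lemma embed_poly_cases: assumes "f \<in> B" obtains F where "F \<in> carrier Aw" "f = embed_poly F"
  using assms embed_poly_image by blast

lemma wD_B: "f \<in> B \<Longrightarrow> wD f \<in> B"
  by (erule embed_poly_cases) (simp add: wD_embed_poly B_mult B_W embed_poly_B Delta_closed)

lemma wD_add: "f \<in> B \<Longrightarrow> g \<in> B \<Longrightarrow> wD (f + g) = wD f + wD g"
proof -
  assume "f \<in> B" "g \<in> B"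
  then obtain F G where FG: "F \<in> carrier Aw" "G \<in> carrier Aw" "f = embed_poly F" "g = embed_poly G" by (metis embed_poly_cases)
  have "wD (f + g) = wD (embed_poly (F \<oplus>\<^bsub>Aw\<^esub> G))" using FG by (simp add: embed_poly_add)
  also have "\<dots> = tW \<star> embed_poly (\<Delta> F \<oplus>\<^bsub>Aw\<^esub> \<Delta> G)"
    using FG by (simp add: wD_embed_poly Delta_add)
  finally show ?thesis using FG by (simp add: wD_embed_poly embed_poly_add Delta_closed tmul_add_right)
qed

lemma wD_mult: "f \<in> B \<Longrightarrow> g \<in> B \<Longrightarrow> wD (f \<star> g) = wD f \<star> g + f \<star> wD g"
proof -
  assume "f \<in> B" "g \<in> B"
  then obtain F G where FG: "F \<in> carrier Aw" "G \<in> carrier Aw" "f = embed_poly F" "g = embed_poly G" by (metis embed_poly_cases)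
  have "wD (f \<star> g) = wD (embed_poly (F \<otimes>\<^bsub>Aw\<^esub> G))" using FG by (simp add: embed_poly_mult)
  also have "\<dots> = tW \<star> embed_poly ((\<Delta> F \<otimes>\<^bsub>Aw\<^esub> G) \<oplus>\<^bsub>Aw\<^esub> (F \<otimes>\<^bsub>Aw\<^esub> \<Delta> G))"
    using FG by (simp add: wD_embed_poly Delta_mult)
  also have "\<dots> = tW \<star> (embed_poly (\<Delta> F) \<star> embed_poly G) + tW \<star> (embed_poly F \<star> embed_poly (\<Delta> G))"
    using FG by (simp add: embed_poly_add embed_poly_mult Delta_closed tmul_add_right)
  also have "tW \<star> (embed_poly F \<star> embed_poly (\<Delta> G)) = embed_poly F \<star> (tW \<star> embed_poly (\<Delta> G))"
    by (metis W_central tmul_assoc)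
  finally show ?thesis using FG by (simp add: wD_embed_poly tmul_assoc)
qed

lemma wD_scal: "wD (scal c) = 0"
proof -
  have "embed_poly (c \<odot>\<^bsub>Aw\<^esub> \<one>\<^bsub>Aw\<^esub>) = scal c" by (simp add: embed_poly_smult embed_poly_one)
  moreover have "\<Delta> (c \<odot>\<^bsub>Aw\<^esub> \<one>\<^bsub>Aw\<^esub>) = \<zero>\<^bsub>Aw\<^esub>"
  proof
    fix i
    have one: "\<one>\<^bsub>Aw\<^esub> \<in> up A" using P.one_closed by (simp add: Aw_carrier)
    have z: "c \<odot>\<^bsub>A\<^esub> \<zero>\<^bsub>A\<^esub> = \<zero>\<^bsub>A\<^esub>"
      by (rule embed_inj) (simp_all add: A_smult_closed embed_smult embed_0)
    show "\<Delta> (c \<odot>\<^bsub>Aw\<^esub> \<one>\<^bsub>Aw\<^esub>) i = \<zero>\<^bsub>Aw\<^esub> i"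
      unfolding fun_cong[OF Aw_smult[OF one]] unfolding Aw_one Aw_zero
      by (cases "i = 0") (simp_all add: A_smult_closed der_smult der_1 der_0 z)
  qed
  moreover have "embed_poly \<zero>\<^bsub>Aw\<^esub> = 0" using embed_poly_bound[of 0 "\<zero>\<^bsub>Aw\<^esub>"] by (simp add: Aw_zero embed_0)
  ultimately show ?thesis using wD_embed_poly[OF Aw_smult_closed[OF P.one_closed], of c] by simp
qed

lemma wD_wpow: "f \<in> B \<Longrightarrow> wD (wpow n \<star> f) = wpow n \<star> wD f"
proof -
  assume f: "f \<in> B"
  have W: "wD tW = 0"
  proof -
    have "\<Delta> (poly_var A) = \<zero>\<^bsub>Aw\<^esub>" by (simp add: fun_eq_iff poly_var_eq Aw_zero der_0 der_1)
    moreover have "embed_poly \<zero>\<^bsub>Aw\<^esub> = 0" using embed_poly_bound[of 0 "\<zero>\<^bsub>Aw\<^esub>"] by (simp add: Aw_zero embed_0)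
    ultimately show ?thesis using wD_embed_poly[OF poly_var_closed] by (simp add: embed_poly_var)
  qed
  show ?thesis
    by (induction n) (simp_all add: f wD_mult W B_W B_mult B_wpow tmul_assoc)
qed

lemma wD_funpow: "F \<in> carrier Aw \<Longrightarrow> (wD ^^ n) (embed_poly F) = wpow n \<star> embed_poly (\<lambda>i. (\<delta> ^^ n) (F i))
   \<and> (\<lambda>i. (\<delta> ^^ n) (F i)) \<in> carrier Aw"
proof (induction n)
  case (Suc n)
  let ?G = "\<lambda>i. (\<delta> ^^ n) (F i)"
  have G: "?G \<in> carrier Aw" "(wD ^^ n) (embed_poly F) = wpow n \<star> embed_poly ?G" using Suc by auto
  have "(wD ^^ Suc n) (embed_poly F) = wpow n \<star> (tW \<star> embed_poly (\<Delta> ?G))"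
    using G by (simp add: wD_wpow embed_poly_B wD_embed_poly)
  then show ?case using Delta_closed[OF G(1)] by (simp add: tmul_assoc[symmetric]) (metis W_central)
qed simp

lemma wD_nilp: "f \<in> B \<Longrightarrow> \<exists>n. (wD ^^ n) f = 0"
proof -
  assume "f \<in> B"
  then obtain F where F: "F \<in> carrier Aw" "f = embed_poly F" by (rule embed_poly_cases)
  then have F': "F \<in> up A" by (simp add: Aw_carrier)
  obtain N where N: "\<And>i. i > N \<Longrightarrow> F i = \<zero>\<^bsub>A\<^esub>" using up_bound[OF F'] by blast
  have "\<forall>i. \<exists>n. (\<delta> ^^ n) (F i) = \<zero>\<^bsub>A\<^esub>" using nilp up_closed[OF F'] unfolding locally_nilpotent_def by blast
  then obtain h where h: "\<And>i. (\<delta> ^^ h i) (F i) = \<zero>\<^bsub>A\<^esub>" by metis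
  let ?n = "Max (h ` {..N})"
  have z: "(\<delta> ^^ ?n) (F i) = \<zero>\<^bsub>A\<^esub>" for i
  proof (cases "i \<le> N")
    case True
    then show ?thesis by (intro dern_zero_mono[OF h[of i]] Max_ge) auto
  next
    case False
    then show ?thesis by (simp add: N dern_0)
  qed
  have "embed_poly (\<lambda>i. (\<delta> ^^ ?n) (F i)) = 0"
    unfolding z using embed_poly_bound[of 0 "\<lambda>i. \<zero>\<^bsub>A\<^esub>"] by (simp add: embed_0)
  then show ?thesis using wD_funpow[OF F(1), of ?n] F(2) by auto
qed

text \<open>
  The automorphism \<open>exp(w \<delta>)\<close> multiplies each generator by a scalar, so the coefficient of \<open>w\<close> in the image
  of a generator vanishes. This coefficient is the value of \<open>\<delta>\<close>.
\<close>

lemma der_gen_zero: "\<delta> (qweyl_gen p l m q g) = \<zero>\<^bsub>A\<^esub>"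
proof -
  let ?u = "qweyl_gen p l m q g"
  have u: "?u \<in> carrier A" by (rule gen_carrier)
  have "B_lnd wD" by (simp add: B_lnd_def wD_B wD_add wD_mult wD_scal wD_nilp)
  note ctx = this char0
  have aut: "B_aut (expD wD)" by (rule B_aut_expD[OF ctx])
  obtain \<nu> where \<nu>: "expD wD (gen_im g) = scal \<nu> \<star> gen_im g" using aut by (rule gen_im_scaled)
  have Dn: "(wD ^^ n) (gen_im g) = wpow n \<star> embed ((\<delta> ^^ n) ?u)" for n
  proof -
    have "(\<lambda>i. (\<delta> ^^ n) (poly_const A ?u i)) = poly_const A ((\<delta> ^^ n) ?u)"
      by (simp add: fun_eq_iff poly_const_eq u dern_closed dern_0)
    then show ?thesis
      using wD_funpow[OF poly_const_closed[OF u], of n] by (simp add: embed_poly_const u dern_closed embed_gen)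
  qed
  obtain N where N: "\<And>n. n > N \<Longrightarrow> divpow wD n (gen_im g) = 0"
    using divpow_bound[OF ctx gen_im_B[of g]] by blast
  have "embed (\<delta> ?u) = 0"
  proof (rule poly_mapping_eqI)
    fix v :: expo
    obtain k b c d e where v: "v = (k, b, c, d, e)" by (cases v)
    show "lookup (embed (\<delta> ?u)) v = lookup 0 v"
    proof (cases "e = 0")
      case True
      have look: "lookup (divpow wD n (gen_im g)) (k, b, c, d, 1) = (if n = 1 then lookup (embed (\<delta> ?u)) (k, b, c, d, 0) else 0)" for n
      proof -
        have "divpow wD n (gen_im g) = scal (inverse (of_nat (fact n))) \<star> (embed ((\<delta> ^^ n) ?u) \<star> wpow n)"
          unfolding divpow_def[OF ctx] Dn wpow_central ..
        then show ?thesis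
          by (auto simp: lookup_flat_wpow[OF flat_embed[OF dern_closed[OF u]]])
      qed
      have "expD wD (gen_im g) = (\<Sum>n\<le>max N 1. divpow wD n (gen_im g))"
        using N by (intro expD_bound[OF ctx]) auto
      then have "lookup (expD wD (gen_im g)) (k, b, c, d, 1) = lookup (embed (\<delta> ?u)) (k, b, c, d, 0)"
        by (simp add: lookup_sum look)
      moreover have "lookup (gen_im g) (k, b, c, d, 1) = 0"
        by (rule flatD[OF flat_gen]) simp
      ultimately show ?thesis using \<nu> True v by simp
    next
      case False
      then show ?thesis using flatD[OF flat_embed[OF der_closed[OF u]]] v by simp
    qed
  qed
  then show ?thesis using embed_inj[OF der_closed[OF u] A.zero_closed] by (simp add: embed_0)
qed

lemma derivation_zero: "u \<in> carrier A \<Longrightarrow> \<delta> u = \<zero>\<^bsub>A\<^esub>"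
proof -
  have cl: "pres_class rels f \<in> carrier A" for f by (simp add: A_carrier)
  have "\<delta> (pres_class rels f) = \<zero>\<^bsub>A\<^esub>" for f
  proof (induction f rule: free_alg_induct)
    case (scalar c)
    have "pres_class rels (free_scalar c) = c \<odot>\<^bsub>A\<^esub> \<one>\<^bsub>A\<^esub>" by (simp add: qweyl_def pres_alg_simps)
    moreover have "c \<odot>\<^bsub>A\<^esub> \<zero>\<^bsub>A\<^esub> = \<zero>\<^bsub>A\<^esub>"
      by (rule embed_inj) (simp_all add: A_smult_closed embed_smult embed_0)
    ultimately show ?case by (simp add: der_smult der_1)
  next
    case (gen g f)
    have "pres_class rels (free_gen g * f) = qweyl_gen p l m q g \<otimes>\<^bsub>A\<^esub> pres_class rels f"
      by (simp add: qweyl_gen_def qweyl_def pres_alg_simps)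
    then show ?case using gen der_mult[OF gen_carrier[of g] cl[of f]] by (simp add: der_gen_zero gen_carrier cl)
  next
    case (add f g)
    have "pres_class rels (f + g) = pres_class rels f \<oplus>\<^bsub>A\<^esub> pres_class rels g"
      by (simp add: qweyl_def pres_alg_simps)
    then show ?case using add der_add[OF cl[of f] cl[of g]] by simp
  qed
  then show "u \<in> carrier A \<Longrightarrow> \<delta> u = \<zero>\<^bsub>A\<^esub>" by (auto simp: A_carrier)
qed

end

end

section \<open>Automorphisms of the polynomial extension\<close>

context qweyl_torus
begin

abbreviation (input) "cgen g \<equiv> poly_const A (qweyl_gen p l m q g)"

lemma cgen_closed: "cgen g \<in> carrier Aw"
  by (rule poly_const_closed[OF gen_carrier])

lemma embed_poly_cgen: "embed_poly (cgen g) = gen_im g"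
  by (simp add: embed_poly_const gen_carrier embed_gen)

lemma alg_aut_form:
  assumes "\<phi> \<in> alg_aut Aw"
  shows "\<exists>\<alpha> \<beta> \<gamma> a b. \<alpha> \<noteq> 0 \<and> \<beta> \<noteq> 0 \<and> \<gamma> \<noteq> 0 \<and> a \<noteq> 0 \<and>
     \<phi> (cgen Gx) = \<alpha> \<odot>\<^bsub>Aw\<^esub> cgen Gx \<and> \<phi> (cgen Gy) = inverse \<alpha> \<odot>\<^bsub>Aw\<^esub> cgen Gy \<and>
     \<phi> (cgen Gs) = \<beta> \<odot>\<^bsub>Aw\<^esub> cgen Gs \<and> \<phi> (cgen Gt) = \<gamma> \<odot>\<^bsub>Aw\<^esub> cgen Gt \<and>
     \<phi> (poly_var A) = (a \<odot>\<^bsub>Aw\<^esub> poly_var A) \<oplus>\<^bsub>Aw\<^esub> (b \<odot>\<^bsub>Aw\<^esub> \<one>\<^bsub>Aw\<^esub>)"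
proof -
  interpret P: ring Aw by (rule Aw_ring)
  let ?\<psi> = "transport \<phi>"
  have aut: "B_aut ?\<psi>" using assms by (rule B_aut_transport)
  have closed: "\<phi> F \<in> carrier Aw" if "F \<in> carrier Aw" for F
    using assms that unfolding alg_aut_def by (blast dest: ring_iso_memE(1))
  obtain \<alpha> where X: "\<alpha> \<noteq> 0" "?\<psi> tX = scal \<alpha> \<star> tX" "?\<psi> tY = scal (inverse \<alpha>) \<star> tY"
    using aut by (rule aut_XY)
  obtain \<beta> \<gamma> where S: "\<beta> \<noteq> 0" "\<gamma> \<noteq> 0" "?\<psi> tS = scal \<beta> \<star> tS" "?\<psi> tT = scal \<gamma> \<star> tT"
    using aut by (rule aut_ZST)
  obtain a b where W: "a \<noteq> 0" "?\<psi> tW = scal a \<star> tW + scal b"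
    using aut by (rule aut_W)
  have reflect: "\<phi> F = G" if "F \<in> carrier Aw" "G \<in> carrier Aw" "?\<psi> (embed_poly F) = embed_poly G" for F G
    using that embed_poly_inj_on closed[OF that(1)] by (auto simp: transport_embed_poly dest: inj_onD)
  have gen: "\<phi> (cgen g) = c \<odot>\<^bsub>Aw\<^esub> cgen g" if "?\<psi> (gen_im g) = scal c \<star> gen_im g" for g c
    using that by (intro reflect) (simp_all add: cgen_closed Aw_smult_closed embed_poly_smult embed_poly_cgen)
  have "\<phi> (poly_var A) = (a \<odot>\<^bsub>Aw\<^esub> poly_var A) \<oplus>\<^bsub>Aw\<^esub> (b \<odot>\<^bsub>Aw\<^esub> \<one>\<^bsub>Aw\<^esub>)"
    using W by (intro reflect)
      (simp_all add: poly_var_closed Aw_smult_closed embed_poly_add embed_poly_smult embed_poly_var embed_poly_one)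
  then show ?thesis
    using X S W gen[of Gx] gen[of Gy] gen[of Gs] gen[of Gt] by (simp, blast)
qed

lemma alg_aut_inv:
  assumes "\<phi> \<in> alg_aut Aw"
  shows "inv_into (carrier Aw) \<phi> \<in> alg_aut Aw"
proof -
  have iso: "\<phi> \<in> ring_iso Aw Aw" and sm: "\<And>c u. u \<in> carrier Aw \<Longrightarrow> \<phi> (c \<odot>\<^bsub>Aw\<^esub> u) = c \<odot>\<^bsub>Aw\<^esub> \<phi> u"
    using assms by (auto simp: alg_aut_def)
  let ?\<psi> = "inv_into (carrier Aw) \<phi>"
  have iso': "?\<psi> \<in> ring_iso Aw Aw" using ring_iso_set_sym[OF Aw_ring iso] .
  have bij: "bij_betw \<phi> (carrier Aw) (carrier Aw)" using ring_iso_memE(5)[OF iso] .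
  have "?\<psi> (c \<odot>\<^bsub>Aw\<^esub> u) = c \<odot>\<^bsub>Aw\<^esub> ?\<psi> u" if u: "u \<in> carrier Aw" for c u
  proof -
    have v: "?\<psi> u \<in> carrier Aw" using ring_iso_memE(1)[OF iso' u] .
    have "\<phi> (c \<odot>\<^bsub>Aw\<^esub> ?\<psi> u) = c \<odot>\<^bsub>Aw\<^esub> u"
      using sm[OF v] bij_betw_inv_into_right[OF bij u] by simp
    then show ?thesis using bij_betw_inv_into_left[OF bij Aw_smult_closed[OF v]] by metis
  qed
  then show ?thesis using iso' by (simp add: alg_aut_def)
qed

lemma flat_const:
  assumes "F \<in> carrier Aw" "flat (embed_poly F)"
  shows "F = poly_const A (F 0)"
proof -
  have F: "F \<in> up A" using assms(1) by (simp add: Aw_carrier)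
  have u: "F 0 \<in> carrier A" using F by (rule up_closed)
  have "embed_poly F = embed (F 0)"
  proof (rule poly_mapping_eqI)
    fix v :: expo
    obtain k b c d e where v: "v = (k, b, c, d, e)" by (cases v)
    show "lookup (embed_poly F) v = lookup (embed (F 0)) v"
    proof (cases "e = 0")
      case True
      then show ?thesis using lookup_embed_poly[OF F] v by simp
    next
      case False
      then have "v \<notin> keys (embed_poly F)" "v \<notin> keys (embed (F 0))"
        using assms(2) flat_embed[OF u] v unfolding flat_def by auto
      then show ?thesis by (simp add: in_keys_iff)
    qed
  qed
  then show ?thesis
    using assms(1) u by (intro inj_onD[OF embed_poly_inj_on]) (simp_all add: embed_poly_const poly_const_closed)
qed

text \<open>
  The generators of \<open>A\<close> are multiplied by scalars, so no \<open>w\<close> appears in the image of any element of \<open>A\<close>.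
\<close>

lemma alg_aut_const:
  assumes aut: "\<phi> \<in> alg_aut Aw" and u: "u \<in> carrier A"
  shows "\<phi> (poly_const A u) = poly_const A (\<phi> (poly_const A u) 0)"
proof (rule flat_const)
  have c: "poly_const A u \<in> carrier Aw" using u by (rule poly_const_closed)
  show "\<phi> (poly_const A u) \<in> carrier Aw"
    using aut c unfolding alg_aut_def by (blast dest: ring_iso_memE(1))
  have B: "B_aut (transport \<phi>)" using aut by (rule B_aut_transport)
  have "flat (transport \<phi> (torus_hom f))" for f
  proof (induction f rule: free_alg_induct)
    case (scalar c)
    then show ?case by (simp add: torus_hom_scalar aut_scal[OF B] flat_scal)
  next
    case (gen g f)
    obtain \<nu> where "transport \<phi> (gen_im g) = scal \<nu> \<star> gen_im g" using B by (rule gen_im_scaled)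
    then show ?case
      using gen by (simp add: torus_hom_mult torus_hom_gen aut_mult[OF B] gen_im_B torus_hom_B flat_mult flat_scal flat_gen)
  next
    case (add f g)
    then show ?case by (simp add: torus_hom_add aut_add[OF B] torus_hom_B flat_add)
  qed
  moreover obtain f where "u = pres_class rels f" using u A_carrier by auto
  ultimately have "flat (transport \<phi> (embed u))" by (simp add: embed_class)
  then show "flat (embed_poly (\<phi> (poly_const A u)))"
    using transport_embed_poly[OF c, of \<phi>] by (simp add: embed_poly_const u)
qed

lemma alg_aut_triangular:
  assumes aut: "\<phi> \<in> alg_aut Aw"
  shows "triangular A \<phi>"
proof -
  interpret A: ring A by (rule A_ring)
  interpret P: ring Aw by (rule Aw_ring)
  have iso: "\<phi> \<in> ring_iso Aw Aw" and sm: "\<And>c u. u \<in> carrier Aw \<Longrightarrow> \<phi> (c \<odot>\<^bsub>Aw\<^esub> u) = c \<odot>\<^bsub>Aw\<^esub> \<phi> u"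
    using aut by (auto simp: alg_aut_def)
  note E = ring_iso_memE[OF iso]
  define g where "g u = \<phi> (poly_const A u) 0" for u
  let ?c = "poly_const A"
  have g: "\<phi> (?c u) = ?c (g u)" if "u \<in> carrier A" for u
    unfolding g_def using alg_aut_const[OF aut that] .
  have g_closed: "g u \<in> carrier A" if "u \<in> carrier A" for u
    using E(1)[OF poly_const_closed[OF that]] unfolding g_def by (auto simp: Aw_carrier intro: up_closed)
  have c_inj: "u = v" if "u \<in> carrier A" "v \<in> carrier A" "?c u = ?c v" for u v
    using fun_cong[OF that(3), of 0] that(1,2) by (simp add: poly_const_eq)
  have TI: "F = G" if "F \<in> carrier Aw" "G \<in> carrier Aw" "embed_poly F = embed_poly G" for F G
    using that embed_poly_inj_on by (blast dest: inj_onD)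
  have c_mult: "?c (u \<otimes>\<^bsub>A\<^esub> v) = ?c u \<otimes>\<^bsub>Aw\<^esub> ?c v" if "u \<in> carrier A" "v \<in> carrier A" for u v
    using that by (intro TI) (simp_all add: poly_const_closed embed_poly_const embed_poly_mult embed_hom)
  have c_add: "?c (u \<oplus>\<^bsub>A\<^esub> v) = ?c u \<oplus>\<^bsub>Aw\<^esub> ?c v" if "u \<in> carrier A" "v \<in> carrier A" for u v
    using that by (intro TI) (simp_all add: poly_const_closed embed_poly_const embed_poly_add embed_hom)
  have c_smult: "?c (a \<odot>\<^bsub>A\<^esub> u) = a \<odot>\<^bsub>Aw\<^esub> ?c u" if "u \<in> carrier A" for a u
    using that by (intro TI) (simp_all add: poly_const_closed A_smult_closed Aw_smult_closed embed_poly_const embed_poly_smult embed_smult)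
  have c_one: "?c \<one>\<^bsub>A\<^esub> = \<one>\<^bsub>Aw\<^esub>"
    by (intro TI) (simp_all add: poly_const_closed embed_poly_const embed_poly_one embed_1)
  have "g \<in> alg_aut A"
    unfolding alg_aut_def
  proof (intro CollectI conjI allI ballI)
    show "g \<in> ring_iso A A"
    proof (rule ring_iso_memI)
      show "g u \<in> carrier A" if "u \<in> carrier A" for u using that by (rule g_closed)
      show "g (u \<otimes>\<^bsub>A\<^esub> v) = g u \<otimes>\<^bsub>A\<^esub> g v" if "u \<in> carrier A" "v \<in> carrier A" for u v
      proof (rule c_inj)
        show "?c (g (u \<otimes>\<^bsub>A\<^esub> v)) = ?c (g u \<otimes>\<^bsub>A\<^esub> g v)"
          using that E(2)[OF poly_const_closed poly_const_closed, of u v]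
          by (simp add: g[symmetric] c_mult g_closed)
      qed (simp_all add: that g_closed)
      show "g (u \<oplus>\<^bsub>A\<^esub> v) = g u \<oplus>\<^bsub>A\<^esub> g v" if "u \<in> carrier A" "v \<in> carrier A" for u v
      proof (rule c_inj)
        show "?c (g (u \<oplus>\<^bsub>A\<^esub> v)) = ?c (g u \<oplus>\<^bsub>A\<^esub> g v)"
          using that E(3)[OF poly_const_closed poly_const_closed, of u v]
          by (simp add: g[symmetric] c_add g_closed)
      qed (simp_all add: that g_closed)
      show "g \<one>\<^bsub>A\<^esub> = \<one>\<^bsub>A\<^esub>"
        by (rule c_inj) (simp_all add: g_closed g[symmetric] c_one E(4))
      have "inj_on g (carrier A)"
      proof (rule inj_onI)
        fix u v assume uv: "u \<in> carrier A" "v \<in> carrier A" "g u = g v"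
        then have "\<phi> (?c u) = \<phi> (?c v)" by (simp add: g)
        then have "?c u = ?c v"
          using E(5) uv poly_const_closed unfolding bij_betw_def by (blast dest: inj_onD)
        then show "u = v" using uv c_inj by blast
      qed
      \<comment> \<open>A preimage in \<open>A[w]\<close> lies in \<open>A\<close>, because the inverse automorphism preserves \<open>A\<close> as well.\<close>
      moreover have "v \<in> g ` carrier A" if v: "v \<in> carrier A" for v
      proof -
        let ?\<psi> = "inv_into (carrier Aw) \<phi>"
        have inv: "?\<psi> \<in> alg_aut Aw" using aut by (rule alg_aut_inv)
        let ?u = "?\<psi> (?c v) 0"
        have "?\<psi> (?c v) \<in> carrier Aw"
          using inv poly_const_closed[OF v] unfolding alg_aut_def by (blast dest: ring_iso_memE(1))
        then have u: "?u \<in> carrier A" by (auto simp: Aw_carrier intro: up_closed)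
        have "?\<psi> (?c v) = ?c ?u" by (rule alg_aut_const[OF inv v])
        then have "\<phi> (?c ?u) = ?c v" using bij_betw_inv_into_right[OF E(5) poly_const_closed[OF v]] by simp
        then have "g ?u = v" using g[OF u] c_inj[OF g_closed[OF u] v] by simp
        then show ?thesis using u by blast
      qed
      ultimately show "bij_betw g (carrier A) (carrier A)"
        using g_closed unfolding bij_betw_def by blast
    qed
    show "g (a \<odot>\<^bsub>A\<^esub> u) = a \<odot>\<^bsub>A\<^esub> g u" if "u \<in> carrier A" for a u
    proof (rule c_inj)
      show "?c (g (a \<odot>\<^bsub>A\<^esub> u)) = ?c (a \<odot>\<^bsub>A\<^esub> g u)"
        using that sm[OF poly_const_closed, of u a] by (simp add: g[symmetric] c_smult g_closed A_smult_closed)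
    qed (simp_all add: that g_closed A_smult_closed)
  qed
  moreover obtain a b where ab: "a \<noteq> 0" "\<phi> (poly_var A) = (a \<odot>\<^bsub>Aw\<^esub> poly_var A) \<oplus>\<^bsub>Aw\<^esub> (b \<odot>\<^bsub>Aw\<^esub> \<one>\<^bsub>Aw\<^esub>)"
    using alg_aut_form[OF aut] by blast
  moreover have "b \<odot>\<^bsub>A\<^esub> \<one>\<^bsub>A\<^esub> \<in> alg_center A"
    unfolding alg_center_def
  proof (intro CollectI conjI ballI)
    show "b \<odot>\<^bsub>A\<^esub> \<one>\<^bsub>A\<^esub> \<in> carrier A" by (simp add: A_smult_closed)
    fix u assume u: "u \<in> carrier A"
    show "(b \<odot>\<^bsub>A\<^esub> \<one>\<^bsub>A\<^esub>) \<otimes>\<^bsub>A\<^esub> u = u \<otimes>\<^bsub>A\<^esub> (b \<odot>\<^bsub>A\<^esub> \<one>\<^bsub>A\<^esub>)"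
      using u by (intro embed_inj) (simp_all add: A_smult_closed embed_hom embed_smult embed_1 scal_commute)
  qed
  moreover have "?c (b \<odot>\<^bsub>A\<^esub> \<one>\<^bsub>A\<^esub>) = b \<odot>\<^bsub>Aw\<^esub> \<one>\<^bsub>Aw\<^esub>"
    by (simp add: c_smult c_one)
  ultimately show ?thesis
    unfolding triangular_def using g by (intro bexI[of _ g] exI[of _ a] exI[of _ "b \<odot>\<^bsub>A\<^esub> \<one>\<^bsub>A\<^esub>"]) auto
qed

end

theorem theorem2p4:
  fixes p q l m :: "'k::field"
  assumes "p \<noteq> 0" "q \<noteq> 0" "l \<noteq> 0" "m \<noteq> 0"
    and "\<not> root_of_unity p" and "\<not> root_of_unity q"
  defines "A \<equiv> qweyl p l m q"
  defines "Aw \<equiv> poly_alg A"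
  defines "x \<equiv> poly_const A (qweyl_gen p l m q Gx)"
    and "y \<equiv> poly_const A (qweyl_gen p l m q Gy)"
    and "s \<equiv> poly_const A (qweyl_gen p l m q Gs)"
    and "t \<equiv> poly_const A (qweyl_gen p l m q Gt)"
    and "w \<equiv> poly_var A"
  shows "(\<forall>\<phi> \<in> alg_aut Aw.
            (\<exists>\<alpha> \<beta> \<gamma> a b :: 'k. \<alpha> \<noteq> 0 \<and> \<beta> \<noteq> 0 \<and> \<gamma> \<noteq> 0 \<and> a \<noteq> 0 \<and>
               \<phi> x = \<alpha> \<odot>\<^bsub>Aw\<^esub> x \<and>
               \<phi> y = inverse \<alpha> \<odot>\<^bsub>Aw\<^esub> y \<and>
               \<phi> s = \<beta> \<odot>\<^bsub>Aw\<^esub> s \<and>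
               \<phi> t = \<gamma> \<odot>\<^bsub>Aw\<^esub> t \<and>
               \<phi> w = (a \<odot>\<^bsub>Aw\<^esub> w) \<oplus>\<^bsub>Aw\<^esub> (b \<odot>\<^bsub>Aw\<^esub> \<one>\<^bsub>Aw\<^esub>)))
       \<and> (\<forall>\<phi> \<in> alg_aut Aw. triangular A \<phi>)
       \<and> (CHAR('k) = 0 \<longrightarrow>
            (\<forall>\<delta>. alg_derivation A \<delta> \<and> locally_nilpotent A \<delta> \<longrightarrow>
               (\<forall>u \<in> carrier A. \<delta> u = \<zero>\<^bsub>A\<^esub>)))"
proof -
  interpret qweyl_torus p q l m
    using assms(1-6) by unfold_locales
  show ?thesis
    unfolding A_def Aw_def x_def y_def s_def t_def w_def
    using alg_aut_form alg_aut_triangular derivation_zero by blast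
qed

end
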